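(* There is an algorithm that, given a graph $G$ on $n$ vertices and a weight function $w:V(G)\to\mathbb{N}$, outputs a minimum-weight dominating set of $G$ in time $O(2^{\mathsf{vc}(G)}\cdot n)$.
   Context: All graphs are simple, finite and undirected; $w(U)=\sum_{u\in U}w(u)$. A dominating set of $G$ is a set $U\subseteq V(G)$ such that every vertex outside $U$ has a neighbor in $U$. A vertex cover of $G$ is a set $U$ such that $G-U$ has no edges; $\mathsf{vc}(G)$ is the minimum size of a vertex cover of $G$. *)

theory Defs
  imports Main
begin

section \<open>Graphs\<close>

definition simple_graph :: "'a set \<Rightarrow> 'a set set \<Rightarrow> bool" where
  "simple_graph V E \<longleftrightarrow> finite V \<and> (\<forall>e\<in>E. e \<subseteq> V \<and> card e = 2)"

definition dominating_set :: "'a set \<Rightarrow> 'a set set \<Rightarrow> 'a set \<Rightarrow> bool" where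
  "dominating_set V E U \<longleftrightarrow> U \<subseteq> V \<and> (\<forall>v\<in>V - U. \<exists>u\<in>U. {u, v} \<in> E)"

definition min_weight_dominating_set ::
  "'a set \<Rightarrow> 'a set set \<Rightarrow> ('a \<Rightarrow> nat) \<Rightarrow> 'a set \<Rightarrow> bool" where
  "min_weight_dominating_set V E w U \<longleftrightarrow>
     dominating_set V E U \<and> (\<forall>U'. dominating_set V E U' \<longrightarrow> sum w U \<le> sum w U')"

text \<open>The edge set of the graph \<open>G - U\<close>.\<close>

definition edges_minus :: "'a set set \<Rightarrow> 'a set \<Rightarrow> 'a set set" where
  "edges_minus E U = {e \<in> E. e \<inter> U = {}}"

definition vertex_cover :: "'a set \<Rightarrow> 'a set set \<Rightarrow> 'a set \<Rightarrow> bool" where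
  "vertex_cover V E U \<longleftrightarrow> U \<subseteq> V \<and> edges_minus E U = {}"

definition vc :: "'a set \<Rightarrow> 'a set set \<Rightarrow> nat" where
  "vc V E = Min (card ` {U. vertex_cover V E U})"

section \<open>Random access machine\<close>

text \<open>
  Algorithms are programs of a unit-cost random access machine, written in structured form.
  A program has finitely many registers and a memory with indirect addressing, both holding
  natural numbers. The only arithmetic operations are addition and truncated subtraction.
  Since multiplication and shifts are absent, the length of the numbers grows by at most a
  constant number of bits per step, so unit cost is the customary convention and does not hide
  any computational power.
\<close>

datatype aexp = Const nat | Reg nat | Mem aexp | Add aexp aexp | Sub aexp aexp

datatype bexp = Less aexp aexp | Neg bexp | Conj bexp bexp

datatype com =
    Skip
  | Assign nat aexp
  | Store aexp aexp
  | Seq com com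
  | Cond bexp com com
  | While bexp com

datatype state = State (regs: "nat \<Rightarrow> nat") (mem: "nat \<Rightarrow> nat")

fun aval :: "aexp \<Rightarrow> state \<Rightarrow> nat" where
  "aval (Const k) s = k"
| "aval (Reg r) s = regs s r"
| "aval (Mem a) s = mem s (aval a s)"
| "aval (Add a b) s = aval a s + aval b s"
| "aval (Sub a b) s = aval a s - aval b s"

fun bval :: "bexp \<Rightarrow> state \<Rightarrow> bool" where
  "bval (Less a b) s \<longleftrightarrow> aval a s < aval b s"
| "bval (Neg b) s \<longleftrightarrow> \<not> bval b s"
| "bval (Conj b b') s \<longleftrightarrow> bval b s \<and> bval b' s"

fun acost :: "aexp \<Rightarrow> nat" where
  "acost (Const k) = 1"
| "acost (Reg r) = 1"
| "acost (Mem a) = acost a + 1"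
| "acost (Add a b) = acost a + acost b + 1"
| "acost (Sub a b) = acost a + acost b + 1"

fun bcost :: "bexp \<Rightarrow> nat" where
  "bcost (Less a b) = acost a + acost b + 1"
| "bcost (Neg b) = bcost b + 1"
| "bcost (Conj b b') = bcost b + bcost b' + 1"

text \<open>\<open>exec c s t s'\<close>: started in \<open>s\<close>, the program \<open>c\<close> halts in \<open>s'\<close> after exactly \<open>t\<close> steps.\<close>

inductive exec :: "com \<Rightarrow> state \<Rightarrow> nat \<Rightarrow> state \<Rightarrow> bool" where
  Skip: "exec Skip s 1 s"
| Assign: "exec (Assign r a) s (acost a + 1) (State ((regs s)(r := aval a s)) (mem s))"
| Store: "exec (Store a b) s (acost a + acost b + 1)
            (State (regs s) ((mem s)(aval a s := aval b s)))"
| Seq: "exec c1 s t1 s1 \<Longrightarrow> exec c2 s1 t2 s2 \<Longrightarrow> exec (Seq c1 c2) s (t1 + t2) s2"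
| CondTrue: "bval b s \<Longrightarrow> exec c1 s t s' \<Longrightarrow> exec (Cond b c1 c2) s (bcost b + 1 + t) s'"
| CondFalse: "\<not> bval b s \<Longrightarrow> exec c2 s t s' \<Longrightarrow> exec (Cond b c1 c2) s (bcost b + 1 + t) s'"
| WhileFalse: "\<not> bval b s \<Longrightarrow> exec (While b c) s (bcost b + 1) s"
| WhileTrue: "bval b s \<Longrightarrow> exec c s t1 s1 \<Longrightarrow> exec (While b c) s1 t2 s2 \<Longrightarrow>
    exec (While b c) s (bcost b + 1 + t1 + t2) s2"

inductive_cases exec_cases:
  "exec Skip s t s'"
  "exec (Assign r a) s t s'"
  "exec (Store a b) s t s'"
  "exec (Seq c1 c2) s t s'"
  "exec (Cond b c1 c2) s t s'"
  "exec (While b c) s t s'"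

text \<open>Programs are deterministic, so running time and final state are functions of the input.\<close>

lemma exec_deterministic:
  assumes "exec c s t s'" and "exec c s u s''"
  shows "u = t \<and> s'' = s'"
  using assms
proof (induction arbitrary: u s'' rule: exec.induct)
  case (Seq c1 s t1 s1 c2 t2 s2)
  from Seq.prems obtain u1 v1 u2 where "u = u1 + u2" "exec c1 s u1 v1" "exec c2 v1 u2 s''"
    by (rule exec_cases(4))
  with Seq.IH show ?case by metis
next
  case (CondTrue b s c1 t s' c2)
  from CondTrue.prems obtain u1 where "u = bcost b + 1 + u1" "exec c1 s u1 s''"
    by (rule exec_cases(5)) (use CondTrue.hyps in auto)
  with CondTrue.IH show ?case by metis
next
  case (CondFalse b s c2 t s' c1)
  from CondFalse.prems obtain u1 where "u = bcost b + 1 + u1" "exec c2 s u1 s''"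
    by (rule exec_cases(5)) (use CondFalse.hyps in auto)
  with CondFalse.IH show ?case by metis
next
  case (WhileFalse b s c)
  from WhileFalse.prems show ?case
    by (rule exec_cases(6)) (use WhileFalse.hyps in auto)
next
  case (WhileTrue b s c t1 s1 t2 s2)
  from WhileTrue.prems obtain u1 v1 u2 where
    "u = bcost b + 1 + u1 + u2" "exec c s u1 v1" "exec (While b c) v1 u2 s''"
    by (rule exec_cases(6)) (use WhileTrue.hyps in auto)
  with WhileTrue.IH show ?case by metis
qed (auto elim: exec_cases(1-3))

section \<open>Input and output\<close>

text \<open>
  A graph with vertex set \<open>{0..<n}\<close> is given by adjacency lists, each in arbitrary order.
\<close>

definition adjacency_lists :: "nat \<Rightarrow> nat set set \<Rightarrow> nat list list \<Rightarrow> bool" where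
  "adjacency_lists n E adj \<longleftrightarrow>
     length adj = n \<and> (\<forall>v<n. distinct (adj ! v) \<and> set (adj ! v) = {u. {u, v} \<in> E})"

text \<open>Memory layout of the input: \<open>n\<close>, the weights, the degrees, the adjacency lists.\<close>

definition encode_input :: "nat \<Rightarrow> (nat \<Rightarrow> nat) \<Rightarrow> nat list list \<Rightarrow> nat list" where
  "encode_input n w adj = n # map w [0..<n] @ map length adj @ concat adj"

definition initial_state :: "nat list \<Rightarrow> state" where
  "initial_state xs = State (\<lambda>r. 0) (\<lambda>i. if i < length xs then xs ! i else 0)"

text \<open>The output is a list, with its length in cell 0 and its elements in the cells that follow.\<close>

definition output_list :: "state \<Rightarrow> nat list" where
  "output_list s = map (mem s) [1..<mem s 0 + 1]"

end

theory Submission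
  imports Defs "HOL-Library.Nat_Bijection"
begin

text \<open>
  Let \<open>C\<close> be a minimum vertex cover, \<open>k = card C\<close>, and let \<open>I\<close> be the independent set of the
  remaining vertices. If a dominating set meets \<open>C\<close> in \<open>X\<close>, then it contains the forced vertices
  \<open>I - N(X)\<close>. What is left to dominate is the set \<open>Y\<close> of vertices of \<open>C\<close> outside \<open>N[X]\<close> and
  \<open>N(I - N(X))\<close>. No forced vertex has a neighbour in \<open>Y\<close>, so the cheapest completion is a cheapest
  cover of \<open>Y\<close> by neighbourhoods of vertices of \<open>I\<close>, a number that depends on \<open>Y\<close> but not on \<open>X\<close>.
  A single set cover table over the \<open>2\<^sup>k\<close> subsets of \<open>C\<close> therefore serves all \<open>X\<close> at once. It is
  filled in time \<open>O(2\<^sup>k n)\<close>, because for a fixed vertex \<open>v\<close> all masks \<open>S - N[v]\<close> are obtained in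
  constant time each by doubling, without bit operations.

  The cover itself is found by iterative deepening. A vertex with one uncovered neighbour needs no
  branching; a vertex \<open>v\<close> with more is either taken itself or all its neighbours are. This gives at
  most \<open>O((5/3)\<^sup>k)\<close> nodes, each processed in time \<open>O(k n)\<close>, which is \<open>O(2\<^sup>k n)\<close> in total.
\<close>

section \<open>Weakest preconditions with running time\<close>

text \<open>No number plays the role of infinity for masks that vertices of \<open>I\<close> cannot
  cover. The set cover table therefore starts from \<open>wsum\<close>, the price of taking the
  missing vertices of \<open>C\<close> themselves. A completion may thus use vertices of
  \<open>C\<close>, and the marked set may meet \<open>C\<close> in more than the mask
  \<open>X\<close> it was built from. For this reason the table is not specified exactly but from
  two sides: by \<open>sound\<close>, following \<open>LAST\<close> and \<open>NXT\<close> buys a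
  cover of a mask for at most the stored value; by \<open>opt\<close>, the stored value is at most
  the price of any choice of vertices of \<open>I\<close>. The first turns the computed minimum into
  a dominating set of at most that weight, the second compares this minimum with an arbitrary
  dominating set.

  The time bound leaves no room for n^2 when the cover is small. All adjacency lists together have
  length at most 2 vc(G) n, since every edge meets a minimum cover, and a single list of a vertex of
  \<open>I\<close> has length at most k. No per-vertex array is cleared completely within a loop
  over the vertices.\<close>

definition wp :: "com \<Rightarrow> state \<Rightarrow> (nat \<Rightarrow> state \<Rightarrow> bool) \<Rightarrow> bool" where
  "wp c s Q \<longleftrightarrow> (\<exists>t s'. exec c s t s' \<and> Q t s')"

definition rset :: "state \<Rightarrow> nat \<Rightarrow> nat \<Rightarrow> state" where
  "rset s r x = State ((regs s)(r := x)) (mem s)"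

lemma regs_rset [simp]: "regs (rset s r x) r' = (if r' = r then x else regs s r')"
  and mem_rset [simp]: "mem (rset s r x) = mem s"
  by (simp_all add: rset_def)

lemma wp_mono:
  assumes "wp c s Q" and "\<And>t s'. Q t s' \<Longrightarrow> Q' t s'"
  shows "wp c s Q'"
  using assms by (auto simp: wp_def)

text \<open>Determinism collapses the existential in \<open>wp\<close> to the only possible run.
  This makes the rules below equations, which the simplifier can use to execute straight-line
  code.\<close>

lemma wp_exec: "exec c s t s' \<Longrightarrow> wp c s Q = Q t s'"
  unfolding wp_def using exec_deterministic by blast

lemma wp_Skip [simp]: "wp Skip s Q = Q 1 s"
  by (rule wp_exec[OF exec.Skip])

lemma wp_Assign [simp]: "wp (Assign r a) s Q = Q (acost a + 1) (rset s r (aval a s))"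
  unfolding rset_def by (rule wp_exec[OF exec.Assign])

lemma wp_Store:
  "wp (Store a b) s Q =
    Q (acost a + acost b + 1) (State (regs s) ((mem s)(aval a s := aval b s)))"
  by (rule wp_exec[OF exec.Store])

lemma wp_Seq [simp]:
  "wp (Seq c1 c2) s Q = wp c1 s (\<lambda>t1 s1. wp c2 s1 (\<lambda>t2 s2. Q (t1 + t2) s2))"
  unfolding wp_def by (blast intro: exec.Seq elim: exec_cases(4))

lemma wp_Cond [simp]:
  "wp (Cond b c1 c2) s Q =
    (if bval b s then wp c1 s (\<lambda>t. Q (bcost b + 1 + t)) else wp c2 s (\<lambda>t. Q (bcost b + 1 + t)))"
proof -
  have "exec (Cond b c1 c2) s t s' \<longleftrightarrow>
    (\<exists>u. t = bcost b + 1 + u \<and> exec (if bval b s then c1 else c2) s u s')" for t s'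
  proof
    assume "exec (Cond b c1 c2) s t s'"
    then show "\<exists>u. t = bcost b + 1 + u \<and> exec (if bval b s then c1 else c2) s u s'"
      by (rule exec_cases(5)) auto
  next
    assume "\<exists>u. t = bcost b + 1 + u \<and> exec (if bval b s then c1 else c2) s u s'"
    then show "exec (Cond b c1 c2) s t s'"
      using exec.CondTrue exec.CondFalse by (metis (full_types))
  qed
  then show ?thesis
    unfolding wp_def by (cases "bval b s") (simp_all, blast+)
qed

text \<open>The function \<open>f\<close> is variant and time budget at once: each iteration pays
  for its body and its test out of \<open>f\<close>, and as the test costs at least one step,
  \<open>f\<close> also decreases strictly. Termination and running time come from one
  inequality.\<close>

lemma wp_While:
  assumes "I s"
    and step: "\<And>s. I s \<Longrightarrow> bval b s \<Longrightarrow> wp c s (\<lambda>t s'. I s' \<and> f s' + t + bcost b + 1 \<le> f s)"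
  shows "wp (While b c) s (\<lambda>t s'. t \<le> f s + bcost b + 1 \<and> I s' \<and> \<not> bval b s')"
  using \<open>I s\<close>
proof (induction "f s" arbitrary: s rule: less_induct)
  case less
  show ?case
  proof (cases "bval b s")
    case False
    then show ?thesis
      unfolding wp_def using less.prems exec.WhileFalse[of b s c] by fastforce
  next
    case True
    from step[OF less.prems True] obtain t1 s1 where 1: "exec c s t1 s1" "I s1"
      and dec: "f s1 + t1 + bcost b + 1 \<le> f s"
      unfolding wp_def by blast
    from less.hyps[of s1] 1 dec obtain t2 s2 where 2: "exec (While b c) s1 t2 s2" "I s2"
      "\<not> bval b s2" "t2 \<le> f s1 + bcost b + 1"
      unfolding wp_def by auto
    have "exec (While b c) s (bcost b + 1 + t1 + t2) s2"
      by (rule exec.WhileTrue[OF True 1(1) 2(1)])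
    then show ?thesis
      unfolding wp_def using 2 dec by (intro exI conjI) auto
  qed
qed

section \<open>Arrays\<close>

text \<open>The input occupies the cells below \<open>L\<close>, a number kept in register \<open>rL\<close>. Behind it,
  sixteen unbounded arrays are interleaved, so that stores to different arrays never collide.\<close>

abbreviation (input) "rL \<equiv> 2 :: nat"

definition arr :: "nat \<Rightarrow> state \<Rightarrow> nat \<Rightarrow> nat \<Rightarrow> nat" where
  "arr L s j i = mem s (L + (16 * i + j))"

definition aset :: "nat \<Rightarrow> state \<Rightarrow> nat \<Rightarrow> nat \<Rightarrow> nat \<Rightarrow> state" where
  "aset L s j i x = State (regs s) ((mem s)(L + (16 * i + j) := x))"

text \<open>The machine cannot multiply, so the index is scaled by 16 through four doublings. Each
  doubling duplicates the index expression, whence the factor 16 in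
  \<open>acost_Get\<close>.\<close>

definition Addr :: "nat \<Rightarrow> aexp \<Rightarrow> aexp" where
  "Addr j a = (let a2 = Add a a; a4 = Add a2 a2; a8 = Add a4 a4
               in Add (Reg rL) (Add (Add a8 a8) (Const j)))"

definition Get :: "nat \<Rightarrow> aexp \<Rightarrow> aexp" where
  "Get j a = Mem (Addr j a)"

definition Put :: "nat \<Rightarrow> aexp \<Rightarrow> aexp \<Rightarrow> com" where
  "Put j a b = Store (Addr j a) b"

lemma acost_Get [simp]: "acost (Get j a) = 16 * acost a + 20"
  by (simp add: Get_def Addr_def Let_def)

lemma aval_Get [simp]: "regs s rL = L \<Longrightarrow> aval (Get j a) s = arr L s j (aval a s)"
proof -
  assume "regs s rL = L"
  then have "aval (Addr j a) s = L + (16 * aval a s + j)"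
    by (simp add: Addr_def Let_def)
  then show ?thesis by (simp add: Get_def arr_def)
qed

lemma wp_Put:
  assumes "regs s rL = L"
  shows "wp (Put j a b) s Q =
    Q (16 * acost a + acost b + 20) (aset L s j (aval a s) (aval b s))"
proof -
  have "aval (Addr j a) s = L + (16 * aval a s + j)"
    using assms by (simp add: Addr_def Let_def)
  moreover have "acost (Addr j a) = 16 * acost a + 19"
    by (simp add: Addr_def Let_def)
  ultimately show ?thesis
    unfolding Put_def wp_Store aset_def by (simp add: algebra_simps)
qed

lemma regs_aset [simp]: "regs (aset L s j i x) = regs s"
  by (simp add: aset_def)

lemma mem_aset [simp]: "a < L \<Longrightarrow> mem (aset L s j i x) a = mem s a"
  by (simp add: aset_def)

lemma arr_rset [simp]: "arr L (rset s r x) = arr L s"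
  by (simp add: arr_def fun_eq_iff)

text \<open>Since \<open>j < 16\<close>, the offset \<open>16 * i + j\<close> determines
  \<open>j\<close> as its residue modulo 16 and then \<open>i\<close>.\<close>

lemma arr_aset [simp]:
  assumes "j < 16" "j' < 16"
  shows "arr L (aset L s j i x) j' i' = (if j' = j \<and> i' = i then x else arr L s j' i')"
proof -
  have "16 * i' + j' = 16 * i + j \<longleftrightarrow> j' = j \<and> i' = i"
    using assms by (metis add_left_cancel mod_less mod_mult_self4 mult_left_cancel numeral_neq_zero
        add_right_cancel)
  then show ?thesis by (simp add: arr_def aset_def)
qed

text \<open>The frame condition: \<open>R\<close> and \<open>A\<close> list the registers and arrays
  that may change. Every program piece carries one, and facts about all other data are transported
  by \<open>same_regs\<close>, \<open>same_arr\<close> and \<open>same_mem\<close>.\<close>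

definition same :: "nat \<Rightarrow> nat set \<Rightarrow> nat set \<Rightarrow> state \<Rightarrow> state \<Rightarrow> bool" where
  "same L R A s s' \<longleftrightarrow> (\<forall>r. r \<notin> R \<longrightarrow> regs s' r = regs s r) \<and>
     (\<forall>j i. j < 16 \<and> j \<notin> A \<longrightarrow> arr L s' j i = arr L s j i) \<and> (\<forall>a<L. mem s' a = mem s a)"

lemma same_refl [simp]: "same L R A s s"
  by (simp add: same_def)

lemma same_trans: "same L R A s s1 \<Longrightarrow> same L R A s1 s2 \<Longrightarrow> same L R A s s2"
  by (simp add: same_def)

lemma same_mono: "same L R A s s' \<Longrightarrow> R \<subseteq> R' \<Longrightarrow> A \<subseteq> A' \<Longrightarrow> same L R' A' s s'"
  by (auto simp: same_def)

lemma same_regs: "same L R A s s' \<Longrightarrow> r \<notin> R \<Longrightarrow> regs s' r = regs s r"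
  by (simp add: same_def)

lemma same_arr: "same L R A s s' \<Longrightarrow> j \<notin> A \<Longrightarrow> j < 16 \<Longrightarrow> arr L s' j = arr L s j"
  by (simp add: same_def fun_eq_iff)

lemma same_mem: "same L R A s s' \<Longrightarrow> a < L \<Longrightarrow> mem s' a = mem s a"
  by (simp add: same_def)

lemma same_rset [simp]: "r \<in> R \<Longrightarrow> same L R A s (rset s' r x) \<longleftrightarrow> same L R A s s'"
  by (auto simp: same_def)

lemma same_rset_left [simp]: "r \<in> R \<Longrightarrow> same L R A (rset s r x) s' \<longleftrightarrow> same L R A s s'"
  by (auto simp: same_def)

lemma same_aset [simp]: "j \<in> A \<Longrightarrow> j < 16 \<Longrightarrow> same L R A s (aset L s' j i x) \<longleftrightarrow> same L R A s s'"
  by (auto simp: same_def)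

lemma same_aset_left [simp]: "j \<in> A \<Longrightarrow> j < 16 \<Longrightarrow> same L R A (aset L s j i x) s' \<longleftrightarrow> same L R A s s'"
  by (auto simp: same_def)

definition For :: "nat \<Rightarrow> nat \<Rightarrow> com \<Rightarrow> com" where
  "For r q c = Seq (Assign r (Const 0))
     (While (Less (Reg r) (Reg q)) (Seq c (Assign r (Add (Reg r) (Const 1)))))"

text \<open>The 8 extra steps per round are 4 for the test and 4 for the increment; the final 6 are
  2 for the initialisation and 4 for the failing test. As \<open>r\<close> belongs to
  \<open>R\<close>, the frame does not protect the counter, so the body has to guarantee
  \<open>regs s2 r = i\<close> separately.\<close>

lemma wp_For:
  fixes B :: "nat \<Rightarrow> nat"
  assumes q: "q \<notin> R" "regs s q = N" and r: "r \<in> R"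
    and init: "I 0 (rset s r 0)"
    and step: "\<And>i s1. i < N \<Longrightarrow> same L R A s s1 \<Longrightarrow> regs s1 r = i \<Longrightarrow> I i s1 \<Longrightarrow>
      wp c s1 (\<lambda>t s2. t \<le> B i \<and> same L R A s1 s2 \<and> regs s2 r = i \<and> I (Suc i) (rset s2 r (Suc i)))"
  shows "wp (For r q c) s (\<lambda>t s'. t \<le> (\<Sum>i<N. B i + 8) + 6 \<and> same L R A s s' \<and> I N s')"
proof -
  define J where "J s1 \<longleftrightarrow> regs s1 r \<le> N \<and> same L R A s s1 \<and> I (regs s1 r) s1" for s1
  define f where "f s1 = (\<Sum>i\<in>{regs s1 r..<N}. B i + 8)" for s1
  have *: "wp (While (Less (Reg r) (Reg q)) (Seq c (Assign r (Add (Reg r) (Const 1))))) (rset s r 0)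
     (\<lambda>t s'. t \<le> f (rset s r 0) + bcost (Less (Reg r) (Reg q)) + 1 \<and> J s' \<and>
        \<not> bval (Less (Reg r) (Reg q)) s')"
  proof (rule wp_While)
    show "J (rset s r 0)" using init r by (simp add: J_def)
  next
    fix s1 assume J: "J s1" and b: "bval (Less (Reg r) (Reg q)) s1"
    have lt: "regs s1 r < N"
      using J b q same_regs[of L R A s s1 q] by (auto simp: J_def)
    have split: "f s1 = B (regs s1 r) + 8 + (\<Sum>i\<in>{Suc (regs s1 r)..<N}. B i + 8)"
      using lt by (simp add: f_def sum.atLeast_Suc_lessThan)
    show "wp (Seq c (Assign r (Add (Reg r) (Const 1)))) s1
      (\<lambda>t s'. J s' \<and> f s' + t + bcost (Less (Reg r) (Reg q)) + 1 \<le> f s1)"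
      unfolding wp_Seq wp_Assign
      by (rule wp_mono[OF step[of "regs s1 r"]])
        (use J lt r split in \<open>auto simp: J_def f_def intro: same_trans\<close>)
  qed
  have "f (rset s r 0) = (\<Sum>i<N. B i + 8)"
    by (simp add: f_def lessThan_atLeast0)
  then show ?thesis
    unfolding For_def wp_Seq wp_Assign aval.simps
    by (intro wp_mono[OF *]) (use q in \<open>auto simp: J_def dest: same_regs\<close>)
qed

lemma wp_For_const:
  assumes "q \<notin> R" "regs s q = N" "r \<in> R" "I 0 (rset s r 0)"
    and "\<And>i s1. i < N \<Longrightarrow> same L R A s s1 \<Longrightarrow> regs s1 r = i \<Longrightarrow> I i s1 \<Longrightarrow>
      wp c s1 (\<lambda>t s2. t \<le> B \<and> same L R A s1 s2 \<and> regs s2 r = i \<and> I (Suc i) (rset s2 r (Suc i)))"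
  shows "wp (For r q c) s (\<lambda>t s'. t \<le> N * (B + 8) + 6 \<and> same L R A s s' \<and> I N s')"
  using wp_For[of q R s N r I L A c "\<lambda>_. B"] assms by simp

section \<open>The size of the search tree\<close>

text \<open>\<open>pot r\<close> bounds the search below a partial cover with \<open>r\<close> units of budget left
  (\<open>r = 0\<close> meaning that the budget is exceeded): the first branch consumes one unit, the second one
  at least two. Hence \<open>pot\<close> grows like \<open>(5/3)\<^sup>r\<close> at most, which leaves a factor \<open>(6/5)\<^sup>r\<close>
  for the linear overhead of scanning the edges.\<close>

fun pot :: "nat \<Rightarrow> nat" where
  "pot 0 = 1"
| "pot (Suc 0) = 3"
| "pot (Suc (Suc r)) = 1 + pot (Suc r) + pot r"

lemma pot_pos: "pot r \<ge> 1"
  by (induction r rule: pot.induct) auto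

lemma pot_Suc: "pot (Suc r) \<ge> 1 + pot r + pot (r - 1)"
  by (cases r) auto

lemma pot_mono: "r \<le> r' \<Longrightarrow> pot r \<le> pot r'"
proof (rule lift_Suc_mono_le[of pot])
  show "pot m \<le> pot (Suc m)" for m
    using pot_Suc[of m] by simp
qed

text \<open>The numbers \<open>pot r + 1\<close> satisfy the Fibonacci recurrence, and 5/3 is a
  rational just above the golden ratio: 25/9 exceeds 5/3 + 1.\<close>

lemma pot_bound: "3 ^ r * (pot r + 1) \<le> 3 * 5 ^ r"
  by (induction r rule: pot.induct) (auto simp: algebra_simps)

text \<open>The constant is that of a geometric series: the terms \<open>3 * (5/3)^b\<close> up to
  \<open>b = k + 1\<close> add up to less than \<open>3 * (5/3)^(k+2) * 3/2\<close>, which is 25/2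
  times \<open>(5/3)^k\<close>.\<close>

lemma pot_sum_bound: "2 * 3 ^ k * (\<Sum>b = 1..Suc k. pot b + 1) \<le> 25 * 5 ^ k"
proof (induction k)
  case (Suc k)
  have "3 * (3 ^ Suc k * (pot (Suc (Suc k)) + 1)) \<le> 3 * (25 * 5 ^ k)"
    using pot_bound[of "Suc (Suc k)"] by simp
  with Suc show ?case by (simp add: algebra_simps)
qed simp

lemma linear_bound: "5 ^ k * (k + 1) \<le> 3 * 6 ^ (k :: nat)"
\<comment> \<open>The quotient (k+2)/(k+1) is at most 6/5 exactly from k = 4 on, so the induction
  starts there.\<close>
proof (cases "k < 4")
  case True
  then have "k = 0 \<or> k = 1 \<or> k = 2 \<or> k = 3" by auto
  then show ?thesis by auto
next
  case False
  then have "4 \<le> k" by simp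
  then show ?thesis
  proof (induction k rule: dec_induct)
    case (step k)
    have "5 * (5 ^ k * (k + 2)) \<le> 6 * (5 ^ k * (k + 1 :: nat))"
      using step.hyps by (simp add: algebra_simps)
    also have "\<dots> \<le> 6 * (3 * 6 ^ k)"
      using step.IH by simp
    finally show ?case by (simp add: algebra_simps)
  qed simp
qed

text \<open>The rates 5/3 of the tree and 6/5 of the linear factor multiply to 2, and the constants
  25/2 and 3 to 37.5, rounded up to 38.\<close>

lemma search_bound: "(k + 1) * (\<Sum>b = 1..Suc k. pot b + 1) \<le> 38 * 2 ^ k"
proof -
  define S where "S = (\<Sum>b = 1..Suc k. pot b + 1)"
  have "(5 ^ k * (k + 1)) * (2 * 3 ^ k * S) \<le> (3 * 6 ^ k) * (25 * 5 ^ k)"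
    unfolding S_def by (intro mult_mono linear_bound pot_sum_bound) auto
  moreover have "(6 :: nat) ^ k = 2 ^ k * 3 ^ k"
    by (simp flip: power_mult_distrib)
  ultimately have "(5 ^ k * 3 ^ k) * (2 * ((k + 1) * S)) \<le> (5 ^ k * 3 ^ k) * (75 * 2 ^ k)"
    by (simp only: mult_ac)
  then have "2 * ((k + 1) * S) \<le> 75 * 2 ^ k"
    by (subst (asm) nat_mult_le_cancel1) auto
  then show ?thesis unfolding S_def by linarith
qed

section \<open>The input graph\<close>

lemma concat_nth_offset:
  "v < length xss \<Longrightarrow> j < length (xss ! v) \<Longrightarrow>
    (\<Sum>u<v. length (xss ! u)) + j < length (concat xss) \<and>
    concat xss ! ((\<Sum>u<v. length (xss ! u)) + j) = xss ! v ! j"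
proof (induction xss arbitrary: v)
  case (Cons xs xss)
  show ?case
  proof (cases v)
    case 0
    with Cons.prems show ?thesis by (simp add: nth_append)
  next
    case (Suc v')
    have "(\<Sum>u<v. length ((xs # xss) ! u)) = length xs + (\<Sum>u<v'. length (xss ! u))"
      unfolding Suc by (subst sum.lessThan_Suc_shift) simp
    with Cons.IH[of v'] Cons.prems Suc show ?thesis
      by (simp add: nth_append)
  qed
qed simp

locale graph_input =
  fixes n :: nat and E :: "nat set set" and w :: "nat \<Rightarrow> nat" and adj :: "nat list list"
  assumes graph: "simple_graph {0..<n} E" and adjacency: "adjacency_lists n E adj"
begin

definition nb :: "nat \<Rightarrow> nat set" where
  "nb v = {u. {u, v} \<in> E}"

definition deg :: "nat \<Rightarrow> nat" where
  "deg v = length (adj ! v)"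

definition off :: "nat \<Rightarrow> nat" where
  "off v = 1 + n + n + (\<Sum>u<v. deg u)"

definition L :: nat where
  "L = off n"

definition inp :: "nat \<Rightarrow> nat" where
  "inp i = encode_input n w adj ! i"

lemma edge_bounds: "{u, v} \<in> E \<Longrightarrow> u < n \<and> v < n \<and> u \<noteq> v"
  using graph unfolding simple_graph_def by fastforce

lemma edgeE:
  assumes "e \<in> E"
  obtains u v where "e = {u, v}" "u < n" "v < n" "u \<noteq> v"
  using assms graph edge_bounds unfolding simple_graph_def card_2_iff by metis

lemma nb_sym: "u \<in> nb v \<longleftrightarrow> v \<in> nb u"
  by (simp add: nb_def insert_commute)

lemma nb_less: "u \<in> nb v \<Longrightarrow> u < n"
  using edge_bounds by (auto simp: nb_def)

lemma finite_nb [simp]: "finite (nb v)"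
  by (rule finite_subset[of _ "{..<n}"]) (auto dest: nb_less)

lemma length_adj: "length adj = n"
  using adjacency by (simp add: adjacency_lists_def)

lemma set_adj: "v < n \<Longrightarrow> set (adj ! v) = nb v"
  using adjacency by (simp add: adjacency_lists_def nb_def)

lemma distinct_adj: "v < n \<Longrightarrow> distinct (adj ! v)"
  using adjacency by (simp add: adjacency_lists_def)

lemma deg_card: "v < n \<Longrightarrow> deg v = card (nb v)"
  using distinct_card[OF distinct_adj] by (simp add: deg_def set_adj)

lemma deg_le: "v < n \<Longrightarrow> deg v \<le> n"
  using card_mono[of "{..<n}" "nb v"] nb_less by (auto simp: deg_card)

lemma off_mono: "u \<le> v \<Longrightarrow> off u \<le> off v"
  unfolding off_def by (auto intro!: sum_mono2)

lemma off_Suc: "off (Suc v) = off v + deg v"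
  by (simp add: off_def)

lemma off_deg_le: "v < n \<Longrightarrow> off v + deg v \<le> L"
  using off_mono[of "Suc v" n] by (simp add: L_def off_Suc)

lemma length_inp: "length (encode_input n w adj) = L"
proof -
  have "length (concat adj) = (\<Sum>u<n. deg u)"
    by (simp add: length_concat sum_list_sum_nth length_adj deg_def lessThan_atLeast0)
  then show ?thesis by (simp add: encode_input_def L_def off_def length_adj)
qed

lemma L_ge: "1 + n + n \<le> L"
  by (simp add: L_def off_def)

lemma inp_0: "inp 0 = n"
  by (simp add: inp_def encode_input_def)

lemma inp_weight: "v < n \<Longrightarrow> inp (Suc v) = w v"
  by (simp add: inp_def encode_input_def nth_append)

lemma inp_deg: "v < n \<Longrightarrow> inp (Suc (n + v)) = deg v"
  by (simp add: inp_def encode_input_def nth_append length_adj deg_def)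

lemma inp_adj: "v < n \<Longrightarrow> j < deg v \<Longrightarrow> inp (off v + j) = adj ! v ! j"
  using concat_nth_offset[of v adj j]
  by (simp add: inp_def encode_input_def nth_append length_adj deg_def off_def)

subsection \<open>Vertex covers\<close>

definition cover :: "nat set \<Rightarrow> bool" where
  "cover U \<longleftrightarrow> vertex_cover {0..<n} E U"

abbreviation vcn :: nat where
  "vcn \<equiv> vc {0..<n} E"

lemma cover_iff: "cover U \<longleftrightarrow> U \<subseteq> {0..<n} \<and> (\<forall>v<n. v \<notin> U \<longrightarrow> nb v \<subseteq> U)"
proof
  assume "cover U"
  then show "U \<subseteq> {0..<n} \<and> (\<forall>v<n. v \<notin> U \<longrightarrow> nb v \<subseteq> U)"
    by (auto simp: cover_def vertex_cover_def edges_minus_def nb_def)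
next
  assume U: "U \<subseteq> {0..<n} \<and> (\<forall>v<n. v \<notin> U \<longrightarrow> nb v \<subseteq> U)"
  have "e \<inter> U \<noteq> {}" if "e \<in> E" for e
    using that by (rule edgeE) (use U that in \<open>auto simp: nb_def\<close>)
  with U show "cover U"
    by (auto simp: cover_def vertex_cover_def edges_minus_def)
qed

lemma finite_covers: "finite {U. cover U}"
  by (rule finite_subset[of _ "Pow {0..<n}"]) (auto simp: cover_iff)

lemma cover_all: "cover {0..<n}"
  using nb_less by (auto simp: cover_iff)

lemma vc_le: "cover U \<Longrightarrow> vcn \<le> card U"
  using finite_covers unfolding vc_def cover_def by (auto intro!: Min_le)

lemma vc_attained: obtains U where "cover U" "card U = vcn"
proof -
  have "vcn \<in> card ` {U. cover U}"
    using finite_covers cover_all unfolding vc_def cover_def by (intro Min_in) auto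
  then show thesis using that by auto
qed

text \<open>Each arc of the graph has one of its two ends in a minimum cover \<open>U\<close>, hence
  lies in \<open>U\<close> times the vertices or in the vertices times \<open>U\<close>.\<close>

lemma sum_deg_le: "(\<Sum>v<n. deg v) \<le> 2 * vcn * n"
proof -
  obtain U where U: "cover U" "card U = vcn" by (rule vc_attained)
  have "finite U" using U(1) by (auto simp: cover_iff intro: finite_subset)
  have "(\<Sum>v<n. deg v) = card (SIGMA v:{..<n}. nb v)"
    by (simp add: deg_card)
  also have "\<dots> \<le> card (U \<times> {..<n} \<union> {..<n} \<times> U)"
    using \<open>finite U\<close> U(1) nb_less by (intro card_mono) (auto simp: cover_iff)
  also have "\<dots> \<le> card (U \<times> {..<n}) + card ({..<n} \<times> U)"
    by (rule card_Un_le)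
  finally show ?thesis by (simp add: card_cartesian_product U(2) mult.commute)
qed

lemma cover_branch: "cover D \<Longrightarrow> C \<subseteq> D \<Longrightarrow> v < n \<Longrightarrow> insert v C \<subseteq> D \<or> C \<union> nb v \<subseteq> D"
  by (auto simp: cover_iff)

text \<open>An exchange argument: if \<open>u\<close> is not in \<open>D\<close>, then
  \<open>v\<close> is, and replacing \<open>v\<close> by \<open>u\<close> keeps a cover, because the
  other neighbours of \<open>v\<close> already lie in \<open>C\<close>. Taking \<open>nb v\<close>
  is therefore safe without branching, though possibly for a different cover \<open>D'\<close> of no
  larger size.\<close>

lemma cover_pendant:
  assumes D: "cover D" "C \<subseteq> D" and v: "v < n" "v \<notin> C" and u: "nb v - C = {u}"
  shows "\<exists>D'. cover D' \<and> card D' \<le> card D \<and> C \<union> nb v \<subseteq> D'"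
proof (cases "u \<in> D")
  case True
  then show ?thesis using D u by (intro exI[of _ D]) auto
next
  case False
  have "u \<in> nb v" using u by auto
  then have "v \<in> D" using False D(1) v(1) by (auto simp: cover_iff)
  let ?D = "insert u (D - {v})"
  have "finite D" using D(1) by (auto simp: cover_iff intro: finite_subset)
  have nbv: "nb v \<subseteq> ?D" using u D(2) v(2) by auto
  moreover have "nb x \<subseteq> ?D" if "x < n" "x \<notin> ?D" for x
  proof (cases "x = v")
    case True
    with nbv show ?thesis by simp
  next
    case False
    then have "x \<notin> D" using that by auto
    then have "nb x \<subseteq> D" using D(1) that(1) by (auto simp: cover_iff)
    moreover have "v \<notin> nb x" using nbv that(2) by (auto simp: nb_sym[of v x])
    ultimately show ?thesis by auto
  qed
  ultimately have "cover ?D"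
    using D(1) nb_less[OF \<open>u \<in> nb v\<close>] by (auto simp: cover_iff)
  moreover have "card ?D \<le> card D"
    using card_Suc_Diff1[OF \<open>finite D\<close> \<open>v \<in> D\<close>] card_insert_disjoint[of "D - {v}" u]
      \<open>finite D\<close> False by (metis DiffD1 finite_Diff order_refl)
  moreover have "C \<union> nb v \<subseteq> ?D" using nbv D(2) v(2) by auto
  ultimately show ?thesis by blast
qed

end

section \<open>Preprocessing and vertex cover search\<close>

abbreviation (input) "rN \<equiv> 3 :: nat"
abbreviation (input) "rV \<equiv> 4 :: nat"
abbreviation (input) "rJ \<equiv> 5 :: nat"
abbreviation (input) "rD \<equiv> 6 :: nat"
abbreviation (input) "rO \<equiv> 7 :: nat"
abbreviation (input) "rB \<equiv> 8 :: nat"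
abbreviation (input) "rSP \<equiv> 9 :: nat"
abbreviation (input) "rE \<equiv> 10 :: nat"
abbreviation (input) "rTop \<equiv> 11 :: nat"
abbreviation (input) "rF \<equiv> 12 :: nat"
abbreviation (input) "rC \<equiv> 13 :: nat"
abbreviation (input) "rCD \<equiv> 14 :: nat"
abbreviation (input) "rCV \<equiv> 15 :: nat"

text \<open>\<open>OFF\<close> holds the start addresses of the adjacency lists and \<open>STK\<close> a stack of \<open>n\<close>-cell bitmaps,
  whose \<open>rSP\<close> entries end at index \<open>rE\<close>. The size bound of the current round is \<open>rB - 1\<close>.\<close>

abbreviation (input) "OFF \<equiv> 2 :: nat"
abbreviation (input) "STK \<equiv> 3 :: nat"

definition Deg :: "aexp \<Rightarrow> aexp" where
  "Deg a = Mem (Add (Const 1) (Add (Reg rN) a))"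

definition Wgt :: "aexp \<Rightarrow> aexp" where
  "Wgt a = Mem (Add (Const 1) a)"

abbreviation Nbr :: aexp where
  "Nbr \<equiv> Mem (Add (Reg rO) (Reg rJ))"

definition Nbrs :: "nat \<Rightarrow> com \<Rightarrow> com" where
  "Nbrs r c = Seq (Assign rD (Deg (Reg r))) (Seq (Assign rO (Get OFF (Reg r))) (For rJ rD c))"

definition Init :: com where
  "Init = Seq (Assign rN (Mem (Const 0)))
    (Seq (Assign rL (Add (Const 1) (Add (Reg rN) (Reg rN))))
    (Seq (For rV rN (Assign rL (Add (Reg rL) (Deg (Reg rV)))))
    (Seq (Assign rO (Add (Const 1) (Add (Reg rN) (Reg rN))))
    (For rV rN (Seq (Put OFF (Reg rV) (Reg rO)) (Assign rO (Add (Reg rO) (Deg (Reg rV)))))))))"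

definition Restart :: com where
  "Restart = Seq (Assign rB (Add (Reg rB) (Const 1)))
    (Seq (For rV rN (Put STK (Reg rV) (Const 0)))
    (Seq (Assign rSP (Const 1)) (Assign rE (Reg rN))))"

definition Count :: com where
  "Count = Seq (Assign rC (Const 0))
    (For rV rN (Assign rC (Add (Reg rC) (Get STK (Add (Reg rTop) (Reg rV))))))"

text \<open>The sum in the test is zero only if no uncovered edge was met so far and the current
  vertex is outside the partial cover. After the first hit the list of no further vertex is read,
  and \<open>rCV\<close>, \<open>rCD\<close> keep that vertex and its number of uncovered
  neighbours. A final \<open>rCD\<close> of 0 certifies a cover.\<close>

definition Scan :: com where
  "Scan = Seq (Assign rCD (Const 0))
    (For rV rN (Cond (Less (Add (Reg rCD) (Get STK (Add (Reg rTop) (Reg rV)))) (Const 1))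
      (Seq (Nbrs rV (Assign rCD (Add (Reg rCD) (Sub (Const 1) (Get STK (Add (Reg rTop) Nbr))))))
        (Assign rCV (Reg rV)))
      Skip))"

text \<open>The copy for the branch that takes the vertex goes on top of the stack, while
  \<open>rTop\<close> still points to the parent. The subsequent \<open>AddNbrs\<close> turns the
  parent in place into the other branch.\<close>

definition Branch :: com where
  "Branch = Seq (For rV rN (Put STK (Add (Reg rE) (Reg rV)) (Get STK (Add (Reg rTop) (Reg rV)))))
    (Seq (Put STK (Add (Reg rE) (Reg rCV)) (Const 1))
    (Seq (Assign rE (Add (Reg rE) (Reg rN))) (Assign rSP (Add (Reg rSP) (Const 1)))))"

definition AddNbrs :: com where
  "AddNbrs = Nbrs rCV (Put STK (Add (Reg rTop) Nbr) (Const 1))"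

definition Pop :: com where
  "Pop = Seq (Assign rSP (Sub (Reg rSP) (Const 1))) (Assign rE (Reg rTop))"

definition Visit :: com where
  "Visit = Seq (Assign rTop (Sub (Reg rE) (Reg rN)))
    (Seq Count
    (Cond (Less (Reg rC) (Reg rB))
      (Seq Scan
        (Cond (Less (Reg rCD) (Const 1))
          (Assign rF (Const 1))
          (Seq (Cond (Less (Const 1) (Reg rCD)) Branch Skip) AddNbrs)))
      Pop))"

definition Search :: com where
  "Search = Seq (Assign rB (Const 0)) (Seq (Assign rSP (Const 0)) (Seq (Assign rE (Const 0))
    (Seq (Assign rF (Const 0))
    (While (Less (Reg rF) (Const 1)) (Cond (Less (Reg rSP) (Const 1)) Restart Visit)))))"

lemma acost_Deg [simp]: "acost (Deg a) = acost a + 5"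
  and acost_Wgt [simp]: "acost (Wgt a) = acost a + 3"
  by (simp_all add: Deg_def Wgt_def)

section \<open>Access to the input\<close>

context graph_input
begin

definition ctx :: "state \<Rightarrow> bool" where
  "ctx s \<longleftrightarrow> regs s rN = n \<and> regs s rL = L \<and> (\<forall>a<L. mem s a = inp a) \<and>
     (\<forall>v<n. arr L s OFF v = off v)"

lemma ctx_same:
  "ctx s \<Longrightarrow> same L R A s s' \<Longrightarrow> rN \<notin> R \<Longrightarrow> rL \<notin> R \<Longrightarrow> OFF \<notin> A \<Longrightarrow> ctx s'"
  by (simp add: ctx_def same_regs same_mem same_arr)

lemma ctx_rset [simp]: "r \<noteq> rN \<Longrightarrow> r \<noteq> rL \<Longrightarrow> ctx (rset s r x) \<longleftrightarrow> ctx s"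
  by (simp add: ctx_def)

lemma ctx_aset [simp]: "j \<noteq> OFF \<Longrightarrow> j < 16 \<Longrightarrow> ctx (aset L s j i x) \<longleftrightarrow> ctx s"
  by (simp add: ctx_def)

lemma ctx_regs: "ctx s \<Longrightarrow> regs s rN = n" "ctx s \<Longrightarrow> regs s rL = L"
  by (simp_all add: ctx_def)

lemma aval_Wgt: "ctx s \<Longrightarrow> aval a s < n \<Longrightarrow> aval (Wgt a) s = w (aval a s)"
  using L_ge by (simp add: ctx_def Wgt_def inp_weight)

lemma aval_Deg: "ctx s \<Longrightarrow> aval a s < n \<Longrightarrow> aval (Deg a) s = deg (aval a s)"
  using L_ge by (simp add: ctx_def Deg_def inp_deg)

text \<open>The invariant speaks of the set \<open>X\<close> of neighbours seen so far and must not
  depend on the counter \<open>rJ\<close>. The arbitrary order of the adjacency lists is thereby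
  hidden from all uses.\<close>

lemma wp_Nbrs:
  assumes ctx: "ctx s" "regs s r = v" "v < n"
    and R: "rJ \<in> R" "rD \<notin> R" "rO \<notin> R" "rN \<notin> R" "rL \<notin> R" "OFF \<notin> A" "r \<noteq> rD" "r \<noteq> rO"
    and R': "R \<subseteq> R'" "rD \<in> R'" "rO \<in> R'"
    and init: "\<And>s'. same L {rD, rO, rJ} {} s s' \<Longrightarrow> I {} s'"
    and step: "\<And>X u s1. X \<subseteq> nb v \<Longrightarrow> u \<in> nb v \<Longrightarrow> u \<notin> X \<Longrightarrow> same L R' A s s1 \<Longrightarrow> ctx s1 \<Longrightarrow>
      mem s1 (regs s1 rO + regs s1 rJ) = u \<Longrightarrow> I X s1 \<Longrightarrow>
      wp c s1 (\<lambda>t s2. t \<le> B \<and> same L R A s1 s2 \<and> regs s2 rJ = regs s1 rJ \<and>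
        (\<forall>j. I (insert u X) (rset s2 rJ j)))"
  shows "wp (Nbrs r c) s (\<lambda>t s'. t \<le> deg v * (B + 8) + 60 \<and> same L R' A s s' \<and> I (nb v) s')"
proof -
  let ?s = "rset (rset s rD (deg v)) rO (off v)"
  let ?X = "\<lambda>j. set (take j (adj ! v))"
  have "wp (For rJ rD c) ?s (\<lambda>t s'. t \<le> deg v * (B + 8) + 6 \<and> same L R A ?s s' \<and> I (?X (deg v)) s')"
  proof (rule wp_For_const)
    show "I (?X 0) (rset ?s rJ 0)"
      using init by simp
  next
    fix j s1
    assume j: "j < deg v" and s1: "same L R A ?s s1" "regs s1 rJ = j" "I (?X j) s1"
    have ctx1: "ctx s1"
      by (rule ctx_same[OF _ s1(1)]) (use ctx R in auto)
    have "same L R' A ?s s1"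
      using same_mono[OF s1(1) R'(1)] by simp
    then have same: "same L R' A s s1"
      using R' by simp
    have "regs s1 rO = off v"
      using same_regs[OF s1(1) R(3)] by simp
    then have u: "mem s1 (regs s1 rO + regs s1 rJ) = adj ! v ! j"
      using ctx1 off_deg_le[OF ctx(3)] j s1(2) inp_adj[OF ctx(3) j] by (simp add: ctx_def)
    have jl: "j < length (adj ! v)"
      using j by (simp add: deg_def)
    have "adj ! v ! j \<in> nb v"
      using jl set_adj[OF ctx(3)] nth_mem by blast
    moreover have "?X j \<subseteq> nb v"
      using set_adj[OF ctx(3)] set_take_subset by fastforce
    moreover have "adj ! v ! j \<notin> ?X j"
      using distinct_adj[OF ctx(3)] jl
      by (auto simp: in_set_conv_nth nth_eq_iff_index_eq)
    moreover have "?X (Suc j) = insert (adj ! v ! j) (?X j)"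
      using jl by (simp add: take_Suc_conv_app_nth)
    ultimately show "wp c s1 (\<lambda>t s2. t \<le> B \<and> same L R A s1 s2 \<and> regs s2 rJ = j \<and>
        I (?X (Suc j)) (rset s2 rJ (Suc j)))"
      using step[OF _ _ _ same ctx1 u s1(3)] s1(2) by (auto elim!: wp_mono)
  qed (use R in auto)
  moreover have "?X (deg v) = nb v"
    using set_adj[OF ctx(3)] by (simp add: deg_def)
  ultimately have *: "wp (For rJ rD c) ?s
      (\<lambda>t s'. t \<le> deg v * (B + 8) + 6 \<and> same L R A ?s s' \<and> I (nb v) s')"
    by (auto elim: wp_mono)
  have fr: "same L R' A s s'" if "same L R A ?s s'" for s'
    using same_mono[OF that R'(1), of A] R' by simp
  have "aval (Deg (Reg r)) s = deg v"
    using ctx aval_Deg[of s "Reg r"] by simp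
  moreover have "aval (Get OFF (Reg r)) (rset s rD (deg v)) = off v"
    using ctx R by (subst aval_Get[of _ L]) (auto simp: ctx_def)
  ultimately show ?thesis
    unfolding Nbrs_def wp_Seq wp_Assign by (simp, intro wp_mono[OF *]) (auto intro: fr)
qed

lemma wp_Init:
  "wp Init (initial_state (encode_input n w adj))
    (\<lambda>t s. t \<le> 200 * (n + 1) \<and> ctx s \<and> (\<forall>j i. j < 16 \<longrightarrow> j \<noteq> OFF \<longrightarrow> arr L s j i = 0))"
proof -
  define s0 where "s0 = initial_state (encode_input n w adj)"
  have mem0: "\<forall>a<L. mem s0 a = inp a" and arr0: "\<forall>j i. arr L s0 j i = 0"
    by (simp_all add: s0_def initial_state_def length_inp inp_def arr_def)
  have L0: "0 < L" using L_ge by simp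
  define s1 where "s1 = rset (rset s0 rN n) rL (Suc (n + n))"
  \<comment> \<open>\<open>aval_Deg\<close> presupposes \<open>ctx\<close>, which fails until both
    loops have set up \<open>rL\<close> and \<open>OFF\<close>.\<close>
  have deg1: "aval (Deg (Reg r)) s = deg v"
    if "regs s rN = n" "\<forall>a<L. mem s a = inp a" "regs s r = v" "v < n" for s r v
    using that L_ge by (simp add: Deg_def inp_deg)
  have 1: "wp (For rV rN (Assign rL (Add (Reg rL) (Deg (Reg rV))))) s1
    (\<lambda>t s. t \<le> n * (20 + 8) + 6 \<and> same L {rV, rL} {} s1 s \<and> regs s rL = off n)"
  proof (rule wp_For_const[where I = "\<lambda>i s. regs s rL = off i"])
    fix i s assume "i < n" and s: "same L {rV, rL} {} s1 s" "regs s rV = i" "regs s rL = off i"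
    then have "aval (Deg (Reg rV)) s = deg i"
      using mem0 by (intro deg1) (auto simp: same_regs same_mem s1_def)
    then show "wp (Assign rL (Add (Reg rL) (Deg (Reg rV)))) s
        (\<lambda>t s2. t \<le> 20 \<and> same L {rV, rL} {} s s2 \<and> regs s2 rV = i \<and>
           regs (rset s2 rV (Suc i)) rL = off (Suc i))"
      using s by (simp add: off_Suc)
  qed (auto simp: s1_def off_def)
  have 2: "wp (For rV rN (Seq (Put OFF (Reg rV) (Reg rO)) (Assign rO (Add (Reg rO) (Deg (Reg rV)))))) s2
    (\<lambda>t s. t \<le> n * (100 + 8) + 6 \<and> same L {rV, rO} {OFF} s2 s \<and>
       (regs s rO = off n \<and> (\<forall>v<n. arr L s OFF v = off v)))"
    if s2: "regs s2 rN = n" "regs s2 rL = L" "\<forall>a<L. mem s2 a = inp a" "regs s2 rO = off 0" for s2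
  proof (rule wp_For_const[where I = "\<lambda>i s. regs s rO = off i \<and> (\<forall>v<i. arr L s OFF v = off v)"])
    fix i s
    assume i: "i < n" and s: "same L {rV, rO} {OFF} s2 s" "regs s rV = i"
      "regs s rO = off i \<and> (\<forall>v<i. arr L s OFF v = off v)"
    have L: "regs s rL = L" using s2 s by (simp add: same_regs)
    have "aval (Deg (Reg rV)) (aset L s OFF i (off i)) = deg i"
      using i s s2 by (intro deg1) (auto simp: same_regs same_mem)
    then show "wp (Seq (Put OFF (Reg rV) (Reg rO)) (Assign rO (Add (Reg rO) (Deg (Reg rV))))) s
        (\<lambda>t sa. t \<le> 100 \<and> same L {rV, rO} {OFF} s sa \<and> regs sa rV = i \<and>
           regs (rset sa rV (Suc i)) rO = off (Suc i) \<and>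
           (\<forall>v<Suc i. arr L (rset sa rV (Suc i)) OFF v = off v))"
      using s by (simp add: off_Suc wp_Put[OF L] less_Suc_eq)
  qed (use s2 in auto)
  have "wp Init s0 (\<lambda>t s. t \<le> 200 * (n + 1) \<and> ctx s \<and>
    (\<forall>j i. j < 16 \<longrightarrow> j \<noteq> OFF \<longrightarrow> arr L s j i = 0))"
    unfolding Init_def wp_Seq wp_Assign
    using mem0 L0 inp_0
    apply (simp add: s1_def[symmetric])
    apply (rule wp_mono[OF 1])
    apply (rule wp_mono[OF 2])
    using arr0 mem0
    by (auto simp: same_regs same_mem same_arr s1_def L_def ctx_def off_def)
  then show ?thesis by (simp add: s0_def)
qed

end

section \<open>Correctness of the vertex cover search\<close>

lemma sum_bits_eq_card:
  fixes f :: "nat \<Rightarrow> nat"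
  assumes "\<forall>x<n. f x \<le> 1"
  shows "(\<Sum>x<n. f x) = card {x. x < n \<and> f x \<noteq> 0}"
proof -
  have "(\<Sum>x<n. f x) = (\<Sum>x\<in>{..<n}. if f x \<noteq> 0 then 1 else 0)"
    using assms by (intro sum.cong) (auto simp: le_Suc_eq)
  also have "\<dots> = card {x \<in> {..<n}. f x \<noteq> 0}"
    by (simp add: sum.inter_filter[symmetric])
  finally show ?thesis by (simp add: Collect_conj_eq lessThan_def)
qed

context graph_input
begin

definition bm :: "state \<Rightarrow> nat \<Rightarrow> nat set" where
  "bm s p = {i. i < n \<and> arr L s STK (p + i) \<noteq> 0}"

text \<open>The time unit of the search: up to a constant factor the length of the input, and an
  upper bound for one visit or restart.\<close>

definition size_in :: nat where
  "size_in = n + 1 + (\<Sum>v<n. deg v)"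

lemma bm_less: "bm s p \<subseteq> {0..<n}"
  by (auto simp: bm_def)

lemma finite_bm [simp]: "finite (bm s p)"
  by (simp add: bm_def)

lemma wp_Restart:
  assumes "ctx s"
  shows "wp Restart s (\<lambda>t s'. t \<le> 200 * size_in \<and> same L {rV, rB, rSP, rE} {STK} s s' \<and>
    regs s' rB = Suc (regs s rB) \<and> regs s' rSP = 1 \<and> regs s' rE = n \<and>
    (\<forall>i<n. arr L s' STK i = 0))"
proof -
  let ?s = "rset s rB (Suc (regs s rB))"
  have *: "wp (For rV rN (Put STK (Reg rV) (Const 0))) ?s
    (\<lambda>t s'. t \<le> n * (100 + 8) + 6 \<and> same L {rV} {STK} ?s s' \<and>
      (\<forall>i<n. arr L s' STK i = 0))"
  proof (rule wp_For_const[where I = "\<lambda>i s. \<forall>x<i. arr L s STK x = 0"])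
    fix i s1 assume s1: "i < n" "same L {rV} {STK} ?s s1" "regs s1 rV = i" "\<forall>x<i. arr L s1 STK x = 0"
    have "regs s1 rL = L" using s1 assms by (simp add: same_regs ctx_regs)
    then show "wp (Put STK (Reg rV) (Const 0)) s1
      (\<lambda>t s2. t \<le> 100 \<and> same L {rV} {STK} s1 s2 \<and> regs s2 rV = i \<and>
          (\<forall>x<Suc i. arr L (rset s2 rV (Suc i)) STK x = 0))"
      using s1 by (simp add: wp_Put less_Suc_eq)
  qed (use assms in \<open>auto simp: ctx_regs\<close>)
  have fr: "same L {rV, rB, rSP, rE} {STK} s s'" if "same L {rV} {STK} ?s s'" for s'
    using same_mono[OF that, of "{rV, rB, rSP, rE}" "{STK}"] by simp
  show ?thesis
    unfolding Restart_def wp_Seq wp_Assign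
    by (simp, intro wp_mono[OF *])
      (use assms in \<open>auto simp: size_in_def same_regs ctx_regs intro: fr\<close>)
qed

lemma wp_Count:
  assumes "ctx s" "regs s rTop = p" "\<forall>i<n. arr L s STK (p + i) \<le> 1"
  shows "wp Count s (\<lambda>t s'. t \<le> 200 * size_in \<and> same L {rV, rC} {} s s' \<and>
    regs s' rC = card (bm s p))"
proof -
  let ?s = "rset s rC 0"
  have *: "wp (For rV rN (Assign rC (Add (Reg rC) (Get STK (Add (Reg rTop) (Reg rV)))))) ?s
    (\<lambda>t s'. t \<le> n * (100 + 8) + 6 \<and> same L {rV, rC} {} ?s s' \<and>
      regs s' rC = (\<Sum>x<n. arr L s STK (p + x)))"
  proof (rule wp_For_const[where I = "\<lambda>i s'. regs s' rC = (\<Sum>x<i. arr L s STK (p + x))"])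
    fix i s1 assume s1: "i < n" "same L {rV, rC} {} ?s s1" "regs s1 rV = i"
      "regs s1 rC = (\<Sum>x<i. arr L s STK (p + x))"
    have "regs s1 rL = L" "regs s1 rTop = p" "arr L s1 STK = arr L s STK"
      using s1 assms by (simp_all add: same_regs ctx_regs same_arr)
    then show "wp (Assign rC (Add (Reg rC) (Get STK (Add (Reg rTop) (Reg rV))))) s1
      (\<lambda>t s2. t \<le> 100 \<and> same L {rV, rC} {} s1 s2 \<and> regs s2 rV = i \<and>
          regs (rset s2 rV (Suc i)) rC = (\<Sum>x<Suc i. arr L s STK (p + x)))"
      using s1 by simp
  qed (use assms in \<open>auto simp: ctx_regs\<close>)
  have "(\<Sum>x<n. arr L s STK (p + x)) = card (bm s p)"
    using assms(3) sum_bits_eq_card[of n "\<lambda>x. arr L s STK (p + x)"] by (simp add: bm_def)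
  then show ?thesis
    unfolding Count_def wp_Seq wp_Assign
    by (simp, intro wp_mono[OF *]) (auto simp: size_in_def)
qed

lemma wp_Scan:
  assumes "ctx s" "regs s rTop = p" "\<forall>i<n. arr L s STK (p + i) \<le> 1"
  shows "wp Scan s (\<lambda>t s'. t \<le> 500 * size_in \<and> same L {rV, rJ, rD, rO, rCD, rCV} {} s s' \<and>
    (if regs s' rCD = 0 then \<forall>v<n. v \<notin> bm s p \<longrightarrow> nb v \<subseteq> bm s p
     else regs s' rCV < n \<and> regs s' rCV \<notin> bm s p \<and>
       regs s' rCD = card (nb (regs s' rCV) - bm s p)))"
proof -
  let ?s = "rset s rCD 0" and ?R = "{rV, rJ, rD, rO, rCD, rCV}"
  let ?inner = "Nbrs rV (Assign rCD (Add (Reg rCD) (Sub (Const 1) (Get STK (Add (Reg rTop) Nbr)))))"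
  let ?body = "Cond (Less (Add (Reg rCD) (Get STK (Add (Reg rTop) (Reg rV)))) (Const 1))
      (Seq ?inner (Assign rCV (Reg rV))) Skip"
  define I where "I i s' \<longleftrightarrow> (if regs s' rCD = 0 then \<forall>v<i. v \<notin> bm s p \<longrightarrow> nb v \<subseteq> bm s p
     else regs s' rCV < n \<and> regs s' rCV \<notin> bm s p \<and>
       regs s' rCD = card (nb (regs s' rCV) - bm s p))" for i s'
  have *: "wp (For rV rN ?body) ?s
    (\<lambda>t s'. t \<le> (\<Sum>i<n. (208 * deg i + 300) + 8) + 6 \<and> same L ?R {} ?s s' \<and> I n s')"
  proof (rule wp_For[where B = "\<lambda>i. 208 * deg i + 300"])
    fix i s1 assume s1: "i < n" "same L ?R {} ?s s1" "regs s1 rV = i" "I i s1"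
    have f1: "regs s1 rL = L" "regs s1 rTop = p" "arr L s1 STK = arr L s STK"
      using s1 assms by (simp_all add: same_regs ctx_regs same_arr)
    have c1: "ctx s1" using assms by (intro ctx_same[OF _ s1(2)]) auto
    have inner: "wp ?inner s1 (\<lambda>t s'. t \<le> deg i * (200 + 8) + 60 \<and>
        same L {rJ, rCD, rD, rO} {} s1 s' \<and> regs s' rCD = card (nb i - bm s p))"
      if "regs s1 rCD = 0"
    proof (rule wp_Nbrs[where I = "\<lambda>X s'. regs s' rCD = card (X - bm s p)" and R = "{rJ, rCD}"])
      fix X u s2
      assume X: "X \<subseteq> nb i" "u \<in> nb i" "u \<notin> X"
        and s2: "same L {rJ, rCD, rD, rO} {} s1 s2" "ctx s2" "mem s2 (regs s2 rO + regs s2 rJ) = u"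
          "regs s2 rCD = card (X - bm s p)"
      have fin: "finite X" using X(1) finite_nb finite_subset by blast
      have f2: "regs s2 rL = L" "regs s2 rTop = p" "arr L s2 STK = arr L s STK"
        using s2 f1 by (simp_all add: same_regs same_arr)
      have "u < n" using X(2) nb_less by blast
      then have "card (insert u X - bm s p) = card (X - bm s p) + (1 - arr L s STK (p + u))"
        using X(3) fin assms(3) by (auto simp: insert_Diff_if bm_def le_Suc_eq)
      then show "wp (Assign rCD (Add (Reg rCD) (Sub (Const 1) (Get STK (Add (Reg rTop) Nbr))))) s2
        (\<lambda>t s3. t \<le> 200 \<and> same L {rJ, rCD} {} s2 s3 \<and> regs s3 rJ = regs s2 rJ \<and>
           (\<forall>j. regs (rset s3 rJ j) rCD = card (insert u X - bm s p)))"
        using f2 s2 by simp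
    qed (use c1 s1 that in \<open>auto simp: same_regs\<close>)
    show "wp ?body s1 (\<lambda>t s2. t \<le> 208 * deg i + 300 \<and> same L ?R {} s1 s2 \<and> regs s2 rV = i \<and>
          I (Suc i) (rset s2 rV (Suc i)))"
    proof (cases "regs s1 rCD = 0 \<and> i \<notin> bm s p")
      case True
      then have b: "bval (Less (Add (Reg rCD) (Get STK (Add (Reg rTop) (Reg rV)))) (Const 1)) s1"
        using f1 s1 by (simp add: bm_def)
      have z: "card (nb i - bm s p) = 0 \<longleftrightarrow> nb i \<subseteq> bm s p"
        by auto
      have fr: "same L ?R {} s1 s'" "regs s' rV = i" if "same L {rJ, rCD, rD, rO} {} s1 s'" for s'
        using same_mono[OF that, of ?R "{}"] same_regs[OF that, of rV] s1 by auto
      show ?thesis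
        unfolding wp_Cond if_P[OF b] wp_Seq wp_Assign
        by (rule wp_mono[OF inner])
          (use True s1 z in \<open>auto simp: I_def less_Suc_eq fr\<close>)
    next
      case False
      then have b: "\<not> bval (Less (Add (Reg rCD) (Get STK (Add (Reg rTop) (Reg rV)))) (Const 1)) s1"
        using f1 s1 by (auto simp: bm_def)
      show ?thesis
        unfolding wp_Cond if_not_P[OF b] wp_Skip
        using False s1 by (auto simp: I_def less_Suc_eq)
    qed
  qed (use assms in \<open>auto simp: ctx_regs I_def\<close>)
  have "(\<Sum>i<n. (208 * deg i + 300) + 8) = 208 * (\<Sum>i<n. deg i) + 308 * n"
    by (simp add: sum.distrib sum_distrib_left)
  then have tm: "(\<Sum>i<n. (208 * deg i + 300) + 8) + 8 \<le> 500 * size_in"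
    by (simp add: size_in_def)
  show ?thesis
    unfolding Scan_def wp_Seq wp_Assign aval.simps
  proof (rule wp_mono[OF *], intro conjI)
    fix t s' assume 1: "t \<le> (\<Sum>i<n. (208 * deg i + 300) + 8) + 6 \<and> same L ?R {} ?s s' \<and> I n s'"
    then show "acost (Const 0) + 1 + t \<le> 500 * size_in"
      using tm by simp
    show "same L ?R {} s s'"
      using 1 by simp
    show "if regs s' rCD = 0 then \<forall>v<n. v \<notin> bm s p \<longrightarrow> nb v \<subseteq> bm s p
     else regs s' rCV < n \<and> regs s' rCV \<notin> bm s p \<and>
       regs s' rCD = card (nb (regs s' rCV) - bm s p)"
      using 1 unfolding I_def by blast
  qed
qed

lemma wp_Branch:
  assumes "ctx s" "regs s rTop = p" "regs s rE = p + n" "regs s rCV = v" "v < n"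
    and bits: "\<forall>i<p + n. arr L s STK i \<le> 1"
  shows "wp Branch s (\<lambda>t s'. t \<le> 500 * size_in \<and> same L {rV, rE, rSP} {STK} s s' \<and>
    regs s' rE = p + n + n \<and> regs s' rSP = Suc (regs s rSP) \<and>
    (\<forall>i<p + n. arr L s' STK i = arr L s STK i) \<and> (\<forall>i<p + n + n. arr L s' STK i \<le> 1) \<and>
    bm s' (p + n) = insert v (bm s p))"
proof -
  let ?e = "p + n"
  have *: "wp (For rV rN (Put STK (Add (Reg rE) (Reg rV)) (Get STK (Add (Reg rTop) (Reg rV))))) s
    (\<lambda>t s'. t \<le> n * (200 + 8) + 6 \<and> same L {rV} {STK} s s' \<and>
      ((\<forall>i<?e. arr L s' STK i = arr L s STK i) \<and> (\<forall>x<n. arr L s' STK (?e + x) = arr L s STK (p + x))))"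
  proof (rule wp_For_const[where I = "\<lambda>i s'. (\<forall>i<?e. arr L s' STK i = arr L s STK i) \<and>
      (\<forall>x<i. arr L s' STK (?e + x) = arr L s STK (p + x))"])
    fix i s1 assume s1: "i < n" "same L {rV} {STK} s s1" "regs s1 rV = i"
      "(\<forall>i<?e. arr L s1 STK i = arr L s STK i) \<and> (\<forall>x<i. arr L s1 STK (?e + x) = arr L s STK (p + x))"
    have f1: "regs s1 rL = L" "regs s1 rTop = p" "regs s1 rE = ?e"
      using s1 assms by (simp_all add: same_regs ctx_regs)
    then show "wp (Put STK (Add (Reg rE) (Reg rV)) (Get STK (Add (Reg rTop) (Reg rV)))) s1
      (\<lambda>t s2. t \<le> 200 \<and> same L {rV} {STK} s1 s2 \<and> regs s2 rV = i \<and>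
        (\<forall>ia<?e. arr L (rset s2 rV (Suc i)) STK ia = arr L s STK ia) \<and>
        (\<forall>x<Suc i. arr L (rset s2 rV (Suc i)) STK (?e + x) = arr L s STK (p + x)))"
      using s1 by (simp add: wp_Put[OF f1(1)] less_Suc_eq)
  qed (use assms in \<open>auto simp: ctx_regs\<close>)
  have fin: "(\<forall>i<?e. arr L s2 STK i = arr L s STK i) \<and> (\<forall>i<?e + n. arr L s2 STK i \<le> 1) \<and>
      bm s2 ?e = insert v (bm s p)"
    if s1: "\<forall>i<?e. arr L s1 STK i = arr L s STK i" "\<forall>x<n. arr L s1 STK (?e + x) = arr L s STK (p + x)"
      and s2: "arr L s2 STK = (arr L s1 STK)(?e + v := 1)" for s1 s2
  proof (intro conjI)
    show "\<forall>i<?e. arr L s2 STK i = arr L s STK i"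
      using s1 s2 by simp
    show "\<forall>i<?e + n. arr L s2 STK i \<le> 1"
    proof (intro allI impI)
      fix i assume i: "i < ?e + n"
      show "arr L s2 STK i \<le> 1"
      proof (cases "i < ?e")
        case True
        then show ?thesis using s1 s2 bits by simp
      next
        case False
        then obtain x where "i = ?e + x" using le_Suc_ex not_less by blast
        then show ?thesis using i s1 s2 bits by simp
      qed
    qed
    show "bm s2 ?e = insert v (bm s p)"
      using s1 s2 assms(5) by (auto simp: bm_def)
  qed
  have "wp Branch s (\<lambda>t s'. \<exists>s1. t \<le> 500 * size_in \<and> same L {rV, rE, rSP} {STK} s s' \<and>
    regs s' rE = p + n + n \<and> regs s' rSP = Suc (regs s rSP) \<and>
    (\<forall>i<?e. arr L s1 STK i = arr L s STK i) \<and> (\<forall>x<n. arr L s1 STK (?e + x) = arr L s STK (p + x)) \<and>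
    arr L s' STK = (arr L s1 STK)(?e + v := 1))"
    unfolding Branch_def wp_Seq
  proof (rule wp_mono[OF *], goal_cases)
    case (1 t s1)
    have "same L {rV, rE, rSP} {STK} s s1"
      by (rule same_mono[of L "{rV}" "{STK}"]) (use 1 in auto)
    moreover have "regs s1 rL = L" "regs s1 rN = n" "regs s1 rE = ?e" "regs s1 rCV = v"
      "regs s1 rSP = regs s rSP"
      using 1 assms by (auto simp: same_regs ctx_regs)
    ultimately show ?case
      using 1 by (auto simp: wp_Put size_in_def fun_eq_iff intro!: exI[of _ s1])
  qed
  then show ?thesis
    by (rule wp_mono) (use fin in blast)
qed

lemma wp_AddNbrs:
  assumes "ctx s" "regs s rTop = p" "regs s rCV = v" "v < n"
  shows "wp AddNbrs s (\<lambda>t s'. t \<le> 500 * size_in \<and> same L {rJ, rD, rO} {STK} s s' \<and>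
    (\<forall>i. arr L s' STK i = (if \<exists>u\<in>nb v. i = p + u then 1 else arr L s STK i)))"
proof -
  have *: "wp AddNbrs s (\<lambda>t s'. t \<le> deg v * (200 + 8) + 60 \<and> same L {rJ, rD, rO} {STK} s s' \<and>
    (\<forall>i. arr L s' STK i = (if \<exists>u\<in>nb v. i = p + u then 1 else arr L s STK i)))"
    unfolding AddNbrs_def
  proof (rule wp_Nbrs[where R = "{rJ}" and
      I = "\<lambda>X s'. \<forall>i. arr L s' STK i = (if \<exists>u\<in>X. i = p + u then 1 else arr L s STK i)"])
    fix X u s1
    assume s1: "same L {rJ, rD, rO} {STK} s s1" "ctx s1" "mem s1 (regs s1 rO + regs s1 rJ) = u"
      "\<forall>i. arr L s1 STK i = (if \<exists>u\<in>X. i = p + u then 1 else arr L s STK i)"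
    have "regs s1 rL = L" "regs s1 rTop = p"
      using s1 assms by (simp_all add: same_regs ctx_regs)
    then show "wp (Put STK (Add (Reg rTop) Nbr) (Const 1)) s1
        (\<lambda>t s2. t \<le> 200 \<and> same L {rJ} {STK} s1 s2 \<and> regs s2 rJ = regs s1 rJ \<and>
         (\<forall>j i. arr L (rset s2 rJ j) STK i =
             (if \<exists>u\<in>insert u X. i = p + u then 1 else arr L s STK i)))"
      using s1 by (simp add: wp_Put)
  qed (use assms in \<open>auto simp: same_arr\<close>)
  have "deg v \<le> (\<Sum>v<n. deg v)"
    using assms(4) by (intro member_le_sum) auto
  then show ?thesis
    by (intro wp_mono[OF *]) (auto simp: size_in_def)
qed

section \<open>Invariant, potential and running time of the search\<close>

abbreviation (input) SR :: "nat set" where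
  "SR \<equiv> {rV, rJ, rD, rO, rB, rSP, rE, rTop, rF, rC, rCD, rCV}"

lemma bm_cong: "(\<And>i. i < n \<Longrightarrow> arr L s' STK (p + i) = arr L s STK (p + i)) \<Longrightarrow> bm s' p = bm s p"
  by (auto simp: bm_def)

text \<open>The stack holds partial covers \<open>bm s (d * n)\<close> for \<open>d < regs s rSP\<close>. As long as no cover has
  been found, one of them extends to a cover of size below \<open>regs s rB\<close> if there is any such cover.\<close>

definition live :: "state \<Rightarrow> bool" where
  "live s \<longleftrightarrow> (\<forall>D. cover D \<longrightarrow> card D < regs s rB \<longrightarrow>
     (\<exists>d<regs s rSP. \<exists>D'. cover D' \<and> card D' < regs s rB \<and> bm s (d * n) \<subseteq> D'))"

definition found :: "state \<Rightarrow> bool" where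
  "found s \<longleftrightarrow> cover (bm s (regs s rTop)) \<and> card (bm s (regs s rTop)) \<le> vcn \<and>
     (\<forall>i<n. arr L s STK (regs s rTop + i) \<le> 1)"

definition sinv :: "state \<Rightarrow> bool" where
  "sinv s \<longleftrightarrow> ctx s \<and> regs s rE = regs s rSP * n \<and> (\<forall>i<regs s rSP * n. arr L s STK i \<le> 1) \<and>
     regs s rB \<le> Suc vcn \<and> (if regs s rF = 0 then live s else found s)"

text \<open>The first sum bounds the trees below the stacked partial covers by their remaining
  budgets; truncated subtraction gives overfull ones \<open>pot 0 = 1\<close>, the visit that pops
  them. The second sum charges every later round \<open>b\<close> with the tree of the empty partial
  cover and one restart, and no round goes beyond \<open>Suc vcn\<close>.\<close>

definition work :: "state \<Rightarrow> nat" where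
  "work s = (\<Sum>d<regs s rSP. pot (regs s rB - card (bm s (d * n)))) +
     (\<Sum>b = Suc (regs s rB)..Suc vcn. pot b + 1)"

definition phi :: "state \<Rightarrow> nat" where
  "phi s = (if regs s rF = 0 then 1 + work s else 0)"

lemma size_in_pos: "1 \<le> size_in"
  by (simp add: size_in_def)

lemma search_restart:
  assumes "sinv s" "regs s rF = 0" "regs s rSP = 0"
  shows "wp Restart s (\<lambda>t s'. t \<le> 2000 * size_in \<and> same L SR {STK} s s' \<and> sinv s' \<and> phi s' + 1 \<le> phi s)"
proof (rule wp_mono[OF wp_Restart])
  show "ctx s" using assms by (simp add: sinv_def)
next
  fix t s'
  assume s': "t \<le> 200 * size_in \<and> same L {rV, rB, rSP, rE} {STK} s s' \<and>
    regs s' rB = Suc (regs s rB) \<and> regs s' rSP = 1 \<and> regs s' rE = n \<and> (\<forall>i<n. arr L s' STK i = 0)"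
  then have fr: "same L {rV, rB, rSP, rE} {STK} s s'" by simp
  have ctx: "ctx s'"
    using assms by (intro ctx_same[OF _ fr]) (auto simp: sinv_def)
  have F: "regs s' rF = 0"
    using assms same_regs[OF fr] by simp
  obtain U where "cover U" "card U = vcn" by (rule vc_attained)
  \<comment> \<open>With an empty stack, \<open>live\<close> says that no cover has fewer than
    \<open>regs s rB\<close> vertices. Applied to a minimum cover it shows that the bound may be
    raised once more.\<close>
  then have B: "regs s rB \<le> vcn"
    using assms by (force simp: sinv_def live_def not_less[symmetric])
  have bm0: "bm s' 0 = {}"
    using s' by (auto simp: bm_def)
  have "live s'"
    using s' bm0 by (auto simp: live_def)
  moreover have "phi s' + 1 = phi s"
  proof -
    have "(\<Sum>b = Suc (regs s rB)..Suc vcn. pot b + 1) =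
        pot (Suc (regs s rB)) + 1 + (\<Sum>b = Suc (Suc (regs s rB))..Suc vcn. pot b + 1)"
      using B by (subst sum.atLeast_Suc_atMost) auto
    then show ?thesis
      using assms s' F bm0 by (simp add: phi_def work_def)
  qed
  moreover have "same L SR {STK} s s'"
    by (rule same_mono[OF fr]) auto
  ultimately show "t \<le> 2000 * size_in \<and> same L SR {STK} s s' \<and> sinv s' \<and> phi s' + 1 \<le> phi s"
    using s' ctx F B by (simp add: sinv_def)
qed

lemma search_visit:
  assumes inv: "sinv s" and F: "regs s rF = 0" and SP: "regs s rSP = Suc m"
  shows "wp Visit s (\<lambda>t s'. t \<le> 2000 * size_in \<and> same L SR {STK} s s' \<and> sinv s' \<and> phi s' + 1 \<le> phi s)"
proof -
  define p where "p = m * n"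
  define C where "C = bm s p"
  define b where "b = regs s rB"
  have ctx: "ctx s" and E: "regs s rE = p + n" and bits: "\<forall>i<p + n. arr L s STK i \<le> 1"
    and B: "b \<le> Suc vcn" and live: "live s"
    using inv F SP by (auto simp: sinv_def p_def b_def add.commute)
  \<comment> \<open>The lower stack entries lie entirely before the top block, so writes at
    \<open>p\<close> or later leave them intact.\<close>
  have below: "d * n + i < p" if "d < m" "i < n" for d i
  proof -
    have "d * n + i < Suc d * n" using that by simp
    also have "\<dots> \<le> p" unfolding p_def using that by (intro mult_le_mono1) simp
    finally show ?thesis .
  qed
  have [simp]: "finite C" by (simp add: C_def)
  define rest where "rest = (\<Sum>d<m. pot (b - card (bm s (d * n)))) + (\<Sum>b = Suc b..Suc vcn. pot b + 1)"
  have phi: "phi s = 1 + (rest + pot (b - card C))"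
    by (simp add: phi_def work_def F SP rest_def b_def C_def p_def)
  let ?s = "rset s rTop p"
  have top: "aval (Sub (Reg rE) (Reg rN)) s = p"
    using E ctx by (simp add: ctx_regs)
  have bm_rset: "bm (rset s' r x) = bm s'" for s' r x
    by (simp add: bm_def fun_eq_iff)
  have count: "wp Count ?s (\<lambda>t s'. t \<le> 200 * size_in \<and> same L {rV, rC} {} ?s s' \<and> regs s' rC = card C)"
    unfolding C_def bm_rset[of s rTop p, symmetric] by (rule wp_Count) (use ctx bits in auto)
  have *: "wp (Cond (Less (Reg rC) (Reg rB))
      (Seq Scan
        (Cond (Less (Reg rCD) (Const 1))
          (Assign rF (Const 1))
          (Seq (Cond (Less (Const 1) (Reg rCD)) Branch Skip) AddNbrs)))
      Pop) s1 (\<lambda>t s'. t \<le> 1200 * size_in + 500 * size_in \<and> same L SR {STK} s s' \<and> sinv s' \<and> phi s' + 1 \<le> phi s)"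
    if s1': "same L {rV, rC} {} ?s s1" "regs s1 rC = card C" for s1
  proof -
    have s1: "same L SR {STK} s s1"
      using same_mono[OF s1'(1), of SR "{STK}"] by simp
    have r1: "regs s1 rTop = p" "regs s1 rE = p + n" "regs s1 rB = b" "regs s1 rSP = Suc m"
      "regs s1 rF = 0" and a1: "arr L s1 STK = arr L s STK"
      using s1' E SP F by (simp_all add: same_regs same_arr b_def)
    have ctx1: "ctx s1"
      by (rule ctx_same[OF _ s1'(1)]) (use ctx in auto)
    have bm1: "bm s1 = bm s"
      using a1 by (simp add: bm_def fun_eq_iff)
    show ?thesis
    proof (cases "card C < b")
      case False
      let ?s' = "rset (rset s1 rSP m) rE p"
      have "live ?s'"
        unfolding live_def
      proof (intro allI impI)
        fix D assume "cover D" "card D < regs ?s' rB"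
        then obtain d D' where d: "d < Suc m" "cover D'" "card D' < b" "bm s (d * n) \<subseteq> D'"
          using live r1 SP by (auto simp: live_def b_def)
        have "finite D'" using d(2) by (auto simp: cover_iff intro: finite_subset)
        \<comment> \<open>The popped entry has at least \<open>b\<close> vertices and fits into no
          cover with fewer, so a lower entry witnesses liveness.\<close>
        have "d \<noteq> m"
          using False d card_mono[OF \<open>finite D'\<close> d(4)] by (auto simp: C_def p_def)
        then show "\<exists>d<regs ?s' rSP. \<exists>D'. cover D' \<and> card D' < regs ?s' rB \<and> bm ?s' (d * n) \<subseteq> D'"
          using d r1 by (intro exI[of _ d]) (auto simp: bm_rset bm1)
      qed
      then have "sinv ?s'"
        using ctx1 r1 bits a1 B by (auto simp: sinv_def p_def)
      moreover have "phi ?s' = 1 + rest"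
        by (simp add: phi_def work_def r1 rest_def bm_rset bm1)
      ultimately show ?thesis
        using False r1 s1 s1'(2) phi pot_pos[of "b - card C"] size_in_pos by (simp add: Pop_def)
    next
      case True
      then obtain r where r: "b - card C = Suc r" by (metis Suc_diff_Suc)
      have scan: "wp Scan s1 (\<lambda>t s'. t \<le> 500 * size_in \<and> same L {rV, rJ, rD, rO, rCD, rCV} {} s1 s' \<and>
        (if regs s' rCD = 0 then \<forall>v<n. v \<notin> C \<longrightarrow> nb v \<subseteq> C
         else regs s' rCV < n \<and> regs s' rCV \<notin> C \<and> regs s' rCD = card (nb (regs s' rCV) - C)))"
        unfolding C_def bm1[symmetric] by (rule wp_Scan) (use ctx1 r1 bits a1 in auto)
      have **: "wp (Cond (Less (Reg rCD) (Const 1)) (Assign rF (Const 1))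
          (Seq (Cond (Less (Const 1) (Reg rCD)) Branch Skip) AddNbrs)) s2
          (\<lambda>t s'. t \<le> 1100 * size_in \<and> same L SR {STK} s s' \<and> sinv s' \<and> phi s' + 1 \<le> phi s)"
        if s2': "same L {rV, rJ, rD, rO, rCD, rCV} {} s1 s2" and
          res: "if regs s2 rCD = 0 then \<forall>v<n. v \<notin> C \<longrightarrow> nb v \<subseteq> C
            else regs s2 rCV < n \<and> regs s2 rCV \<notin> C \<and> regs s2 rCD = card (nb (regs s2 rCV) - C)" for s2
      proof -
        have s2: "same L SR {STK} s s2"
          by (rule same_trans[OF s1 same_mono[OF s2']]) auto
        have r2: "regs s2 rTop = p" "regs s2 rE = p + n" "regs s2 rB = b" "regs s2 rSP = Suc m"
          "regs s2 rF = 0" and a2: "arr L s2 STK = arr L s STK"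
          using s2' r1 a1 by (simp_all add: same_regs same_arr b_def)
        have ctx2: "ctx s2"
          by (rule ctx_same[OF _ s2']) (use ctx1 in auto)
        have bm2: "bm s2 = bm s"
          using a2 by (simp add: bm_def fun_eq_iff)
        show ?thesis
        proof (cases "regs s2 rCD = 0")
          case True
          with res have "cover C"
            using bm_less[of s p] by (simp add: cover_iff C_def)
          \<comment> \<open>The cover is minimum because its size is below \<open>b\<close>, and
            \<open>b\<close> is at most \<open>Suc vcn\<close>.\<close>
          then have "sinv (rset s2 rF 1)"
            using ctx2 r2 bits a2 bm2 B \<open>card C < b\<close>
            by (auto simp: sinv_def found_def bm_rset p_def[symmetric] C_def[symmetric] add.commute)
          then show ?thesis
            using True s2 size_in_pos phi by (simp add: phi_def)
        next
          case False
          define v where "v = regs s2 rCV"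
          have v: "v < n" "v \<notin> C" and cd: "regs s2 rCD = card (nb v - C)"
            using False res by (simp_all add: v_def)
          define C1 where "C1 = C \<union> nb v"
          have C1: "card C1 = card C + card (nb v - C)"
            unfolding C1_def by (subst card_Un_disjoint[symmetric]) (auto intro: arg_cong[of _ _ card])
          have add: "wp AddNbrs s3 (\<lambda>t s'. t \<le> 500 * size_in \<and> same L SR {STK} s s' \<and>
              ctx s' \<and> regs s' rF = 0 \<and> regs s' rB = b \<and> regs s' rE = regs s3 rE \<and> regs s' rSP = regs s3 rSP \<and>
              (\<forall>d<m. bm s' (d * n) = bm s (d * n)) \<and> bm s' p = C1 \<and> bm s' (p + n) = bm s3 (p + n) \<and>
              (\<forall>i<regs s3 rE. arr L s' STK i \<le> 1))"
            if s3: "same L SR {STK} s s3" "ctx s3" "regs s3 rTop = p" "regs s3 rCV = v" "regs s3 rF = 0"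
              "regs s3 rB = b" "\<forall>i<p + n. arr L s3 STK i = arr L s STK i" "\<forall>i<regs s3 rE. arr L s3 STK i \<le> 1"
            for s3
          proof (rule wp_mono[OF wp_AddNbrs[OF s3(2,3,4) v(1)]])
            fix t s'
            assume s': "t \<le> 500 * size_in \<and> same L {rJ, rD, rO} {STK} s3 s' \<and>
              (\<forall>i. arr L s' STK i = (if \<exists>u\<in>nb v. i = p + u then 1 else arr L s3 STK i))"
            then have fr: "same L {rJ, rD, rO} {STK} s3 s'" by simp
            have "same L SR {STK} s s'"
              by (rule same_trans[OF s3(1) same_mono[OF fr]]) auto
            moreover have "ctx s'"
              by (rule ctx_same[OF s3(2) fr]) auto
            moreover have "bm s' (d * n) = bm s (d * n)" if "d < m" for d
              using below[OF that] s3 s' by (intro bm_cong) force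
            moreover have "bm s' p = C1"
              using s3 s' nb_less by (auto simp: bm_def C1_def C_def)
            moreover have "bm s' (p + n) = bm s3 (p + n)"
              using s' nb_less by (intro bm_cong) fastforce
            ultimately show "t \<le> 500 * size_in \<and> same L SR {STK} s s' \<and>
              ctx s' \<and> regs s' rF = 0 \<and> regs s' rB = b \<and> regs s' rE = regs s3 rE \<and> regs s' rSP = regs s3 rSP \<and>
              (\<forall>d<m. bm s' (d * n) = bm s (d * n)) \<and> bm s' p = C1 \<and> bm s' (p + n) = bm s3 (p + n) \<and>
              (\<forall>i<regs s3 rE. arr L s' STK i \<le> 1)"
              using s3 s' same_regs[OF fr] by auto
          qed
          have ex: "\<exists>d D'. d < Suc m \<and> cover D' \<and> card D' < b \<and> bm s (d * n) \<subseteq> D'"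
            if "cover D" "card D < b" for D
            using that live SP by (force simp: live_def b_def)
          show ?thesis
          proof (cases "regs s2 rCD = 1")
            case True
            then obtain u where u: "nb v - C = {u}"
              using cd card_1_singletonE by metis
            have fin: "sinv s' \<and> phi s' + 1 \<le> phi s"
              if s': "ctx s'" "regs s' rF = 0" "regs s' rB = b" "regs s' rE = p + n" "regs s' rSP = Suc m"
                "\<forall>d<m. bm s' (d * n) = bm s (d * n)" "bm s' p = C1" "\<forall>i<p + n. arr L s' STK i \<le> 1" for s'
            proof
              have "live s'"
                unfolding live_def
              proof (intro allI impI)
                fix D assume "cover D" "card D < regs s' rB"
                then obtain d D' where d: "d < Suc m" "cover D'" "card D' < b" "bm s (d * n) \<subseteq> D'"
                  using ex s' by metis
                show "\<exists>d<regs s' rSP. \<exists>D'. cover D' \<and> card D' < regs s' rB \<and> bm s' (d * n) \<subseteq> D'"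
                proof (cases "d = m")
                  case True
                  \<comment> \<open>The exchange may leave the cover \<open>D'\<close>. This is why
                    \<open>live\<close> only asks for some cover below the bound and not for an
                    extension to a given one.\<close>
                  obtain D'' where "cover D''" "card D'' \<le> card D'" "C1 \<subseteq> D''"
                    using cover_pendant[OF d(2) _ v u] d(4) True unfolding C1_def C_def p_def by auto
                  then show ?thesis
                    using s' d(3) by (intro exI[of _ m]) (auto simp: p_def)
                next
                  case False
                  then show ?thesis using s' d by (intro exI[of _ d]) auto
                qed
              qed
              then show "sinv s'"
                using s' B by (simp add: sinv_def p_def add.commute)
              have "phi s' = 1 + (rest + pot (b - card C1))"
                using s' by (simp add: phi_def work_def rest_def p_def)
              moreover have "b - card C1 = r" using C1 u r by simp
              ultimately show "phi s' + 1 \<le> phi s"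
                using phi r pot_Suc[of r] by simp
            qed
            have "wp AddNbrs s2 (\<lambda>t s'. t \<le> 500 * size_in \<and> same L SR {STK} s s' \<and> sinv s' \<and>
                phi s' + 1 \<le> phi s)"
              by (rule wp_mono[OF add[of s2]]) (use s2 ctx2 r2 a2 bits v_def fin in auto)
            then show ?thesis
              using True size_in_pos by (auto elim!: wp_mono)
          next
            case False2: False
            have fin: "sinv s' \<and> phi s' + 1 \<le> phi s"
              if s': "ctx s'" "regs s' rF = 0" "regs s' rB = b" "regs s' rE = p + n + n"
                "regs s' rSP = Suc (Suc m)" "\<forall>d<m. bm s' (d * n) = bm s (d * n)" "bm s' p = C1"
                "bm s' (p + n) = insert v C" "\<forall>i<p + n + n. arr L s' STK i \<le> 1" for s'
            proof
              have "live s'"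
                unfolding live_def
              proof (intro allI impI)
                fix D assume "cover D" "card D < regs s' rB"
                then obtain d D' where d: "d < Suc m" "cover D'" "card D' < b" "bm s (d * n) \<subseteq> D'"
                  using ex s' by metis
                show "\<exists>d<regs s' rSP. \<exists>D'. cover D' \<and> card D' < regs s' rB \<and> bm s' (d * n) \<subseteq> D'"
                proof (cases "d = m")
                  case True
                  then have "insert v C \<subseteq> D' \<or> C1 \<subseteq> D'"
                    using cover_branch[OF d(2) _ v(1), of C] d(4) unfolding C1_def C_def p_def by blast
                  then show ?thesis
                  proof
                    assume "insert v C \<subseteq> D'"
                    then show ?thesis
                      using s' d by (intro exI[of _ "Suc m"]) (auto simp: p_def add.commute)
                  next
                    assume "C1 \<subseteq> D'"
                    then show ?thesis
                      using s' d by (intro exI[of _ m]) (auto simp: p_def)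
                  qed
                next
                  case False
                  then show ?thesis using s' d by (intro exI[of _ d]) auto
                qed
              qed
              then show "sinv s'"
                using s' B by (simp add: sinv_def p_def algebra_simps)
              have "phi s' = 1 + (rest + pot (b - card C1) + pot (b - card (insert v C)))"
                using s' by (simp add: phi_def work_def rest_def p_def add.commute)
              moreover have "b - card (insert v C) = r"
                using v r by simp
              \<comment> \<open>At this point \<open>rCD\<close> is neither 0 nor 1, so adding the
                neighbours consumes at least two units of the budget \<open>Suc r\<close>.\<close>
              moreover have "pot (b - card C1) \<le> pot (r - 1)"
                using C1 cd r False False2 by (intro pot_mono) linarith
              ultimately show "phi s' + 1 \<le> phi s"
                using phi r pot_Suc[of r] by simp
            qed
            have branch: "wp Branch s2 (\<lambda>t s'. t \<le> 500 * size_in \<and> same L {rV, rE, rSP} {STK} s2 s' \<and>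
              regs s' rE = p + n + n \<and> regs s' rSP = Suc (regs s2 rSP) \<and>
              (\<forall>i<p + n. arr L s' STK i = arr L s2 STK i) \<and> (\<forall>i<p + n + n. arr L s' STK i \<le> 1) \<and>
              bm s' (p + n) = insert v (bm s2 p))"
              by (rule wp_Branch) (use ctx2 r2 a2 bits v v_def in auto)
            have "wp (Seq Branch AddNbrs) s2
              (\<lambda>t s'. t \<le> 1000 * size_in \<and> same L SR {STK} s s' \<and> sinv s' \<and> phi s' + 1 \<le> phi s)"
              unfolding wp_Seq
            proof (rule wp_mono[OF branch], goal_cases)
              case (1 t3 s3)
              then have fr: "same L {rV, rE, rSP} {STK} s2 s3" by simp
              have "same L SR {STK} s s3"
                by (rule same_trans[OF s2 same_mono[OF fr]]) auto
              moreover have "ctx s3"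
                by (rule ctx_same[OF ctx2 fr]) auto
              moreover have "regs s3 rTop = p" "regs s3 rCV = v" "regs s3 rF = 0" "regs s3 rB = b"
                using fr r2 v_def by (simp_all add: same_regs)
              ultimately show ?case
                using 1 r2 a2 bm2 fin
                by (intro wp_mono[OF add[of s3]]) (auto simp: C_def)
            qed
            then show ?thesis
              using False False2 size_in_pos by (auto elim!: wp_mono)
          qed
        qed
      qed
      have step: "wp (Seq Scan (Cond (Less (Reg rCD) (Const 1)) (Assign rF (Const 1))
          (Seq (Cond (Less (Const 1) (Reg rCD)) Branch Skip) AddNbrs))) s1
          (\<lambda>t s'. t \<le> 1100 * size_in + 500 * size_in \<and> same L SR {STK} s s' \<and> sinv s' \<and> phi s' + 1 \<le> phi s)"
        unfolding wp_Seq
        by (rule wp_mono[OF scan], rule wp_mono[OF **]) auto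
      have b: "bval (Less (Reg rC) (Reg rB)) s1"
        using True r1 s1'(2) by simp
      show ?thesis
        unfolding wp_Cond if_P[OF b]
        by (rule wp_mono[OF step]) (use size_in_pos in auto)
    qed
  qed
  show ?thesis
    unfolding Visit_def wp_Seq wp_Assign top
    by (rule wp_mono[OF count], rule wp_mono[OF *]) (use size_in_pos in auto)
qed

lemma wp_Search:
  assumes "ctx s"
  shows "wp Search s (\<lambda>t s'. t \<le> 2100 * size_in * (1 + (\<Sum>b = 1..Suc vcn. pot b + 1)) + 20 \<and>
    same L SR {STK} s s' \<and> found s')"
proof -
  let ?s = "rset (rset (rset (rset s rB 0) rSP 0) rE 0) rF 0"
  let ?b = "Less (Reg rF) (Const 1)"
  let ?c = "Cond (Less (Reg rSP) (Const 1)) Restart Visit"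
  have *: "wp (While ?b ?c) ?s (\<lambda>t s'. t \<le> 2100 * size_in * phi ?s + bcost ?b + 1 \<and>
    (sinv s' \<and> same L SR {STK} s s') \<and> \<not> bval ?b s')"
  proof (rule wp_While)
    \<comment> \<open>The initial bound is 0, and no cover has a negative number of spare vertices,
      that is, size below 0; liveness holds vacuously with the empty stack.\<close>
    have "live ?s" by (simp add: live_def)
    then show "sinv ?s \<and> same L SR {STK} s ?s"
      using assms by (simp add: sinv_def)
  next
    fix s1 assume s1: "sinv s1 \<and> same L SR {STK} s s1" and b: "bval ?b s1"
    have F: "regs s1 rF = 0" using b by simp
    have step: "wp ?c s1 (\<lambda>t s'. t \<le> 2000 * size_in + 10 \<and> same L SR {STK} s1 s' \<and> sinv s' \<and>
      phi s' + 1 \<le> phi s1)"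
    proof (cases "regs s1 rSP")
      case 0
      then show ?thesis
        by (simp, intro wp_mono[OF search_restart]) (use s1 F in auto)
    next
      case (Suc m)
      then show ?thesis
        by (simp, intro wp_mono[OF search_visit[of s1 m]]) (use s1 F in auto)
    qed
    show "wp ?c s1 (\<lambda>t s'. (sinv s' \<and> same L SR {STK} s s') \<and>
        2100 * size_in * phi s' + t + bcost ?b + 1 \<le> 2100 * size_in * phi s1)"
    proof (rule wp_mono[OF step], intro conjI)
      fix t s'
      assume s': "t \<le> 2000 * size_in + 10 \<and> same L SR {STK} s1 s' \<and> sinv s' \<and> phi s' + 1 \<le> phi s1"
      show "sinv s'" "same L SR {STK} s s'"
        using s1 s' same_trans by blast+
      have "2100 * size_in * (phi s' + 1) \<le> 2100 * size_in * phi s1"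
        using s' by (intro mult_le_mono2) simp
      then show "2100 * size_in * phi s' + t + bcost ?b + 1 \<le> 2100 * size_in * phi s1"
        using s' size_in_pos by (simp add: algebra_simps)
    qed
  qed
  have "phi ?s = 1 + (\<Sum>b = 1..Suc vcn. pot b + 1)"
    unfolding phi_def work_def by simp
  with * show ?thesis
    unfolding Search_def wp_Seq wp_Assign
    by (simp, elim wp_mono) (auto simp: sinv_def)
qed

lemma search_time:
  assumes "0 < n"
  shows "2100 * size_in * (1 + (\<Sum>b = 1..Suc vcn. pot b + 1)) \<le> 400000 * (2 ^ vcn * n)"
proof -
  define S where "S = (\<Sum>b = 1..Suc vcn. pot b + 1)"
  have "pot 1 + 1 \<le> S" unfolding S_def by (rule member_le_sum) auto
  then have "1 + S \<le> 2 * S" by simp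
  \<comment> \<open>The summand 1 in \<open>size_in\<close> is absorbed by a second
    \<open>n\<close>, which is where \<open>0 < n\<close> enters.\<close>
  moreover have "size_in \<le> 2 * n * (vcn + 1)"
    using sum_deg_le assms by (simp add: size_in_def algebra_simps)
  ultimately have "size_in * (1 + S) \<le> (2 * n * (vcn + 1)) * (2 * S)"
    by (intro mult_le_mono)
  also have "\<dots> = 4 * n * ((vcn + 1) * S)" by (simp only: mult_ac)
  also have "\<dots> \<le> 4 * n * (38 * 2 ^ vcn)"
    unfolding S_def by (intro mult_le_mono2 search_bound)
  finally have "2100 * (size_in * (1 + S)) \<le> 2100 * (4 * n * (38 * 2 ^ vcn))"
    by simp
  then show ?thesis
    unfolding S_def[symmetric] by (simp add: algebra_simps)
qed

end

section \<open>Programs listing the cover and tabulating the cut masks\<close>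

abbreviation (input) "rK \<equiv> 16 :: nat"
abbreviation (input) "rP \<equiv> 17 :: nat"
abbreviation (input) "rI \<equiv> 18 :: nat"
abbreviation (input) "rQ \<equiv> 19 :: nat"
abbreviation (input) "rS \<equiv> 20 :: nat"
abbreviation (input) "rI2 \<equiv> 21 :: nat"
abbreviation (input) "rU \<equiv> 22 :: nat"
abbreviation (input) "rQ2 \<equiv> 23 :: nat"
abbreviation (input) "rX \<equiv> 24 :: nat"
abbreviation (input) "rBV \<equiv> 25 :: nat"
abbreviation (input) "rBX \<equiv> 26 :: nat"
abbreviation (input) "rZ \<equiv> 27 :: nat"

text \<open>\<open>INC\<close> is the bitmap and \<open>CL\<close> the list of the cover \<open>C\<close>; \<open>FL\<close> and \<open>TB\<close> are the closed
  neighbourhood of the current vertex and the table of the masks without it. For a mask \<open>X\<close>, read as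
  the trace of a solution on \<open>C\<close>, \<open>COST\<close> is the weight of \<open>X\<close> and of the vertices it forces, and
  \<open>REM\<close> is the mask left to dominate. \<open>FA\<close> is the set cover table; \<open>LAST\<close> and \<open>NXT\<close> lead through an
  optimal cover, just as \<open>TOP\<close> and \<open>LOW\<close> lead through the elements of the mask. \<open>MK\<close> marks the
  solution.\<close>

abbreviation (input) "INC \<equiv> 4 :: nat"
abbreviation (input) "CL \<equiv> 5 :: nat"
abbreviation (input) "FL \<equiv> 6 :: nat"
abbreviation (input) "TB \<equiv> 7 :: nat"
abbreviation (input) "FA \<equiv> 8 :: nat"
abbreviation (input) "LAST \<equiv> 9 :: nat"
abbreviation (input) "NXT \<equiv> 10 :: nat"
abbreviation (input) "REM \<equiv> 11 :: nat"
abbreviation (input) "COST \<equiv> 12 :: nat"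
abbreviation (input) "TOP \<equiv> 13 :: nat"
abbreviation (input) "LOW \<equiv> 14 :: nat"
abbreviation (input) "MK \<equiv> 15 :: nat"

definition Enum :: com where
  "Enum = Seq (Assign rK (Const 0))
    (For rV rN (Seq (Put INC (Reg rV) (Get STK (Add (Reg rTop) (Reg rV))))
      (Cond (Less (Const 0) (Get STK (Add (Reg rTop) (Reg rV))))
        (Seq (Put CL (Reg rK) (Reg rV)) (Assign rK (Add (Reg rK) (Const 1)))) Skip)))"

definition Pow2 :: com where
  "Pow2 = Seq (Assign rP (Const 1)) (For rI rK (Assign rP (Add (Reg rP) (Reg rP))))"

text \<open>Only the cells of cover vertices are cleared; others may keep stale flags but are never
  read. Clearing all n cells for each of the n vertices would already take n^2 steps.\<close>

definition Flags :: com where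
  "Flags = Seq (For rI rK (Put FL (Get CL (Reg rI)) (Const 0)))
    (Seq (Put FL (Reg rU) (Const 1)) (Nbrs rU (Put FL Nbr (Const 1))))"

definition Table :: com where
  "Table = Seq Flags
    (Seq (Put TB (Const 0) (Const 0))
    (Seq (Assign rQ (Const 1))
    (For rI rK
      (Seq (Cond (Less (Const 0) (Get FL (Get CL (Reg rI)))) (Assign rZ (Const 0)) (Assign rZ (Reg rQ)))
      (Seq (For rS rQ (Put TB (Add (Reg rQ) (Reg rS)) (Add (Get TB (Reg rS)) (Reg rZ))))
        (Assign rQ (Add (Reg rQ) (Reg rQ))))))))"

section \<open>Bit masks\<close>

lemma set_decode_less: "X < 2 ^ k \<Longrightarrow> set_decode X \<subseteq> {..<k}"
proof
  fix i assume X: "X < 2 ^ k" and "i \<in> set_decode X"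
  then have "2 ^ i \<le> X"
    by (auto simp: set_decode_def intro: ccontr)
  then have "2 ^ i < (2 :: nat) ^ k" using X by (rule le_less_trans)
  then show "i \<in> {..<k}" by simp
qed

lemma set_encode_lessThan: "Suc (set_encode {..<k}) = 2 ^ k"
  by (induction k) (simp_all add: lessThan_Suc set_encode_insert)

lemma set_encode_less: "A \<subseteq> {..<k} \<Longrightarrow> set_encode A < 2 ^ k"
  using set_encode_lessThan[of k] sum_mono2[of "{..<k}" A "power (2 :: nat)"]
  by (simp add: set_encode_def less_eq_Suc_le)

lemma set_decode_add_power:
  assumes "X < 2 ^ i"
  shows "set_decode (2 ^ i + X) = insert i (set_decode X)"
proof -
  have "i \<notin> set_decode X" using set_decode_less[OF assms] by auto
  then have "set_encode (insert i (set_decode X)) = 2 ^ i + X"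
    by (simp add: set_encode_insert)
  then show ?thesis by (metis finite_insert finite_set_decode set_encode_inverse)
qed

lemma set_encode_Diff_le: "set_encode (set_decode X - B) \<le> X"
  using sum_mono2[of "set_decode X" "set_decode X - B" "power (2 :: nat)"] set_decode_inverse[of X]
  by (simp add: set_encode_def)

text \<open>A substitute for bit operations: whether a neighbourhood meets a mask is decided by
  comparing the cut mask with the mask as numbers.\<close>

lemma set_encode_Diff_less_iff:
  "set_encode (set_decode X - B) < X \<longleftrightarrow> B \<inter> set_decode X \<noteq> {}"
proof -
  have "set_encode (set_decode X - B) = X \<longleftrightarrow> set_decode X - B = set_decode X"
    by (metis finite_Diff finite_set_decode set_decode_inverse set_encode_inverse)
  then show ?thesis
    using set_encode_Diff_le[of X B] by (auto simp: le_less)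
qed

lemma sum_power_two: "(\<Sum>i<k. 2 ^ i) + 1 = (2 ^ k :: nat)"
  by (induction k) auto

section \<open>Masks relative to a listed vertex cover\<close>

locale covered = graph_input +
  fixes C :: "nat set" and cl :: "nat \<Rightarrow> nat" and k :: nat
  assumes cover_C: "cover C" and cl_image: "cl ` {..<k} = C" and cl_inj: "inj_on cl {..<k}"
begin

text \<open>The closed neighbourhood within \<open>C\<close>, in the coordinates of the listing
  \<open>cl\<close>. It is closed so that a selected cover vertex dominates itself; for
  \<open>v\<close> outside \<open>C\<close> it amounts to the open neighbourhood.\<close>

definition NI :: "nat \<Rightarrow> nat set" where
  "NI v = {i. i < k \<and> (cl i = v \<or> cl i \<in> nb v)}"

definition cut :: "nat \<Rightarrow> nat \<Rightarrow> nat" where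
  "cut v X = set_encode (set_decode X - NI v)"

definition dctx :: "state \<Rightarrow> bool" where
  "dctx s \<longleftrightarrow> ctx s \<and> regs s rK = k \<and> regs s rP = 2 ^ k \<and> (\<forall>i<k. arr L s CL i = cl i) \<and>
     (\<forall>v<n. arr L s INC v = (if v \<in> C then 1 else 0))"

lemma dctx_same:
  "dctx s \<Longrightarrow> same L R A s s' \<Longrightarrow> rN \<notin> R \<Longrightarrow> rL \<notin> R \<Longrightarrow> rK \<notin> R \<Longrightarrow> rP \<notin> R \<Longrightarrow>
    OFF \<notin> A \<Longrightarrow> CL \<notin> A \<Longrightarrow> INC \<notin> A \<Longrightarrow> dctx s'"
  using ctx_same[of s R A s'] by (simp add: dctx_def same_regs same_arr)

lemma dctx_regs:
  "dctx s \<Longrightarrow> regs s rL = L" "dctx s \<Longrightarrow> regs s rN = n" "dctx s \<Longrightarrow> regs s rK = k"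
  "dctx s \<Longrightarrow> regs s rP = 2 ^ k"
  by (simp_all add: dctx_def ctx_regs)

lemma dctx_ctx: "dctx s \<Longrightarrow> ctx s"
  by (simp add: dctx_def)

lemma dctx_CL: "dctx s \<Longrightarrow> i < k \<Longrightarrow> arr L s CL i = cl i"
  by (simp add: dctx_def)

lemma cl_less: "i < k \<Longrightarrow> cl i < n"
  using cl_image cover_C by (auto simp: cover_iff)

lemma cut_less: "X < 2 ^ k \<Longrightarrow> cut v X < 2 ^ k"
  unfolding cut_def using set_encode_Diff_le le_less_trans by blast

lemma set_decode_cut: "set_decode (cut v X) = set_decode X - NI v"
  by (simp add: cut_def)

lemma wp_Flags:
  assumes s: "dctx s" "regs s rU = v" "v < n"
  shows "wp Flags s (\<lambda>t s'. t \<le> 1000 * 2 ^ k + 208 * deg v \<and> same L {rI, rJ, rD, rO} {FL} s s' \<and>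
    (\<forall>i<k. arr L s' FL (cl i) = (if i \<in> NI v then 1 else 0)))"
proof -
  have 1: "wp (For rI rK (Put FL (Get CL (Reg rI)) (Const 0))) s
    (\<lambda>t s'. t \<le> k * (700 + 8) + 6 \<and> same L {rI} {FL} s s' \<and> (\<forall>j<k. arr L s' FL (cl j) = 0))"
  proof (rule wp_For_const[where I = "\<lambda>i s'. \<forall>j<i. arr L s' FL (cl j) = 0"])
    fix i s1 assume i: "i < k" and s1: "same L {rI} {FL} s s1" "regs s1 rI = i" "\<forall>j<i. arr L s1 FL (cl j) = 0"
    have f: "regs s1 rL = L" "arr L s1 CL i = cl i"
      using s s1 i by (simp_all add: same_regs same_arr dctx_regs dctx_CL)
    then show "wp (Put FL (Get CL (Reg rI)) (Const 0)) s1
      (\<lambda>t s2. t \<le> 700 \<and> same L {rI} {FL} s1 s2 \<and> regs s2 rI = i \<and>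
        (\<forall>j<Suc i. arr L (rset s2 rI (Suc i)) FL (cl j) = 0))"
      using s1 by (simp add: wp_Put[OF f(1)] less_Suc_eq)
  qed (use s in \<open>auto simp: dctx_regs\<close>)
  have 2: "wp (Nbrs rU (Put FL Nbr (Const 1))) s1
    (\<lambda>t s'. t \<le> deg v * (200 + 8) + 60 \<and> same L {rJ, rD, rO} {FL} s1 s' \<and>
      (\<forall>x. arr L s' FL x = (if x \<in> nb v then 1 else arr L s1 FL x)))"
    if s1: "ctx s1" "regs s1 rU = v" for s1
  proof (rule wp_Nbrs[where R = "{rJ}" and
      I = "\<lambda>X s'. \<forall>x. arr L s' FL x = (if x \<in> X then 1 else arr L s1 FL x)"])
    fix X u s2
    assume s2: "ctx s2" "mem s2 (regs s2 rO + regs s2 rJ) = u"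
      "\<forall>x. arr L s2 FL x = (if x \<in> X then 1 else arr L s1 FL x)"
    then show "wp (Put FL Nbr (Const 1)) s2
        (\<lambda>t s3. t \<le> 200 \<and> same L {rJ} {FL} s2 s3 \<and> regs s3 rJ = regs s2 rJ \<and>
          (\<forall>j x. arr L (rset s3 rJ j) FL x = (if x \<in> insert u X then 1 else arr L s1 FL x)))"
      by (simp add: wp_Put ctx_regs)
  qed (use s1 s in \<open>auto simp: same_arr\<close>)
  have k: "k * 708 + 200 \<le> 1000 * 2 ^ k" using less_exp[of k] by linarith
  show ?thesis
    unfolding Flags_def wp_Seq
  proof (rule wp_mono[OF 1], goal_cases)
    case (1 t1 s1)
    then have fr1: "same L {rI} {FL} s s1" and z: "\<forall>j<k. arr L s1 FL (cl j) = 0" by auto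
    let ?s = "aset L s1 FL v 1"
    have f1: "regs s1 rL = L" "regs s1 rU = v"
      using fr1 s by (simp_all add: same_regs dctx_regs)
    have c1: "ctx s1"
      by (rule ctx_same[OF _ fr1]) (use s in \<open>auto simp: dctx_def\<close>)
    show ?case
      unfolding wp_Put[OF f1(1)] aval.simps f1(2)
    proof (rule wp_mono[OF 2], goal_cases)
      case (3 t2 s2)
      have a: "same L {rI, rJ, rD, rO} {FL} s s1"
        by (rule same_mono[OF fr1]) auto
      have "same L {rI, rJ, rD, rO} {FL} ?s s2"
        by (rule same_mono[of L "{rJ, rD, rO}" "{FL}"]) (use 3 in auto)
      then have "same L {rI, rJ, rD, rO} {FL} s1 s2" by simp
      with a have "same L {rI, rJ, rD, rO} {FL} s s2"
        by (rule same_trans)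
      then show ?case using 1 3 z k by (auto simp: NI_def)
    qed (use c1 f1 in auto)
  qed
qed

lemma wp_Table:
  assumes s: "dctx s" "regs s rU = v" "v < n"
  shows "wp Table s (\<lambda>t s'. t \<le> 3500 * 2 ^ k + 208 * deg v \<and>
    same L {rI, rJ, rD, rO, rQ, rS, rZ} {FL, TB} s s' \<and> (\<forall>X<2 ^ k. arr L s' TB X = cut v X))"
proof -
  let ?R = "{rI, rJ, rD, rO, rQ, rS, rZ}" and ?A = "{FL, TB}"
  let ?R1 = "{rI, rQ, rS, rZ}"
  let ?fill = "For rS rQ (Put TB (Add (Reg rQ) (Reg rS)) (Add (Get TB (Reg rS)) (Reg rZ)))"
  let ?cond = "Cond (Less (Const 0) (Get FL (Get CL (Reg rI)))) (Assign rZ (Const 0)) (Assign rZ (Reg rQ))"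
  let ?loop = "For rI rK (Seq ?cond (Seq ?fill (Assign rQ (Add (Reg rQ) (Reg rQ)))))"
  have loop: "wp ?loop s0 (\<lambda>t s'. t \<le> (\<Sum>i<k. (208 * 2 ^ i + 1000) + 8) + 6 \<and>
      same L ?R1 {TB} s0 s' \<and> (regs s' rQ = 2 ^ k \<and> (\<forall>X<2 ^ k. arr L s' TB X = cut v X)))"
    if s0: "dctx s0" "\<forall>i<k. arr L s0 FL (cl i) = (if i \<in> NI v then 1 else 0)" "regs s0 rQ = 1"
      "arr L s0 TB 0 = 0" for s0
  proof (rule wp_For[where I = "\<lambda>i s'. regs s' rQ = 2 ^ i \<and> (\<forall>X<2 ^ i. arr L s' TB X = cut v X)"
        and B = "\<lambda>i. 208 * 2 ^ i + 1000"])
    fix i s1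
    assume i: "i < k" and s1: "same L ?R1 {TB} s0 s1" "regs s1 rI = i"
      "regs s1 rQ = 2 ^ i \<and> (\<forall>X<2 ^ i. arr L s1 TB X = cut v X)"
    \<comment> \<open>The contribution of the new top bit: it survives the cut exactly if
      \<open>cl i\<close> is outside the closed neighbourhood of \<open>v\<close>.\<close>
    define z :: nat where "z = (if i \<in> NI v then 0 else 2 ^ i)"
    let ?s = "rset s1 rZ z"
    have f1: "regs s1 rL = L" "arr L s1 CL i = cl i" "arr L s1 FL (cl i) = (if i \<in> NI v then 1 else 0)"
      using s0 s1 i by (simp_all add: same_regs same_arr dctx_regs dctx_CL)
    have cond: "wp ?cond s1 Q \<longleftrightarrow> Q (bcost (Less (Const 0) (Get FL (Get CL (Reg rI)))) + 3) ?s" for Q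
      using f1 s1 by (simp add: z_def)
    have new: "arr L s1 TB x + z = cut v (2 ^ i + x)" if "x < 2 ^ i" for x
    proof -
      have ni: "i \<notin> set_decode x" using set_decode_less[OF that] by auto
      then have "i \<notin> set_decode x - NI v" by simp
      then have "set_encode (insert i (set_decode x - NI v)) = 2 ^ i + cut v x"
        by (simp add: set_encode_insert cut_def)
      moreover have "arr L s1 TB x = cut v x" using s1 that by simp
      ultimately show ?thesis
        using that by (simp add: cut_def set_decode_add_power z_def insert_Diff_if)
    qed
    have fill: "wp ?fill ?s (\<lambda>t s'. t \<le> 2 ^ i * (200 + 8) + 6 \<and> same L {rS} {TB} ?s s' \<and>
      ((\<forall>X<2 ^ i + 2 ^ i. arr L s' TB X = cut v X)))"
    proof (rule wp_For_const[where I = "\<lambda>x s'. \<forall>X<2 ^ i + x. arr L s' TB X = cut v X"])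
      fix x s2
      assume x: "x < 2 ^ i" and s2: "same L {rS} {TB} ?s s2" "regs s2 rS = x"
        "\<forall>X<2 ^ i + x. arr L s2 TB X = cut v X"
      have f2: "regs s2 rL = L" "regs s2 rQ = 2 ^ i" "regs s2 rZ = z"
        using s1 s2 f1 by (simp_all add: same_regs)
      have "arr L s2 TB x + z = cut v (2 ^ i + x)"
        using new[OF x] x s1 s2 by simp
      then show "wp (Put TB (Add (Reg rQ) (Reg rS)) (Add (Get TB (Reg rS)) (Reg rZ))) s2
        (\<lambda>t s3. t \<le> 200 \<and> same L {rS} {TB} s2 s3 \<and> regs s3 rS = x \<and>
          (\<forall>X<2 ^ i + Suc x. arr L (rset s3 rS (Suc x)) TB X = cut v X))"
        using s2 by (simp add: wp_Put[OF f2(1)] f2 less_Suc_eq)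
    qed (use s1 in auto)
    show "wp (Seq ?cond (Seq ?fill (Assign rQ (Add (Reg rQ) (Reg rQ))))) s1
      (\<lambda>t s2. t \<le> 208 * 2 ^ i + 1000 \<and> same L ?R1 {TB} s1 s2 \<and> regs s2 rI = i \<and>
        regs (rset s2 rI (Suc i)) rQ = 2 ^ Suc i \<and>
        (\<forall>X<2 ^ Suc i. arr L (rset s2 rI (Suc i)) TB X = cut v X))"
      unfolding wp_Seq cond
    proof (rule wp_mono[OF fill], goal_cases)
      case (1 t s2)
      then have fr: "same L {rS} {TB} ?s s2" by simp
      have "same L ?R1 {TB} ?s s2"
        by (rule same_mono[OF fr]) auto
      moreover have "regs s2 rI = i" "regs s2 rQ = 2 ^ i"
        using fr s1 by (simp_all add: same_regs)
      ultimately show ?case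
        using 1 by (simp add: mult_2)
    qed
  qed (use s0 in \<open>auto simp: dctx_regs cut_def\<close>)
  have "(\<Sum>i<k. (208 * 2 ^ i + 1000) + 8) = 208 * (\<Sum>i<k. (2 :: nat) ^ i) + 1008 * k"
    by (simp add: sum.distrib sum_distrib_left)
  then have tm: "(\<Sum>i<k. (208 * 2 ^ i + 1000) + 8) + 100 \<le> 1400 * (2 :: nat) ^ k"
    using sum_power_two[of k] less_exp[of k] by linarith
  show ?thesis
    unfolding Table_def wp_Seq
  proof (rule wp_mono[OF wp_Flags[OF s]], goal_cases)
    case (1 t1 s1)
    then have fr1: "same L {rI, rJ, rD, rO} {FL} s s1" by simp
    let ?s = "rset (aset L s1 TB 0 0) rQ 1"
    have f1: "regs s1 rL = L"
      using fr1 s by (simp add: same_regs dctx_regs)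
    have d: "dctx s1"
      by (rule dctx_same[OF s(1) fr1]) auto
    have "same L ?R1 {TB} s1 ?s" by simp
    then have d': "dctx ?s"
      by (rule dctx_same[OF d]) auto
    show ?case
      unfolding wp_Put[OF f1] wp_Assign aval.simps
    proof (rule wp_mono[OF loop], goal_cases)
      case (5 t2 s2)
      have a: "same L ?R ?A s s1"
        by (rule same_mono[OF fr1]) auto
      have "same L ?R ?A ?s s2"
        by (rule same_mono[of L ?R1 "{TB}"]) (use 5 in auto)
      then have "same L ?R ?A s1 s2" by simp
      with a have "same L ?R ?A s s2"
        by (rule same_trans)
      then show ?case using 1 5 tm by simp
    qed (use d' 1 in auto)
  qed
qed

end

section \<open>Programs for the tables over the subsets of the cover\<close>

definition NewRow :: com where
  "NewRow = Seq (Assign rX (Add (Reg rQ2) (Reg rS)))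
    (Seq (Put TOP (Reg rX) (Reg rU))
    (Seq (Put LAST (Reg rX) (Reg rU))
    (Seq (Put LOW (Reg rX) (Reg rS))
    (Seq (Put NXT (Reg rX) (Reg rS))
    (Seq (Put COST (Reg rX) (Add (Get COST (Reg rS)) (Reg rZ)))
    (Seq (Put FA (Reg rX) (Add (Get FA (Reg rS)) (Reg rZ)))
    (Put REM (Reg rX) (Get TB (Get REM (Reg rS))))))))))"

definition Phase1 :: com where
  "Phase1 = Seq (Put REM (Const 0) (Sub (Reg rP) (Const 1)))
    (Seq (Put COST (Const 0) (Const 0))
    (Seq (Put FA (Const 0) (Const 0))
    (Seq (Assign rQ2 (Const 1))
    (For rI2 rK
      (Seq (Assign rU (Get CL (Reg rI2)))
      (Seq Table
      (Seq (Assign rZ (Wgt (Reg rU)))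
      (Seq (For rS rQ2 NewRow) (Assign rQ2 (Add (Reg rQ2) (Reg rQ2)))))))))))"

definition Relax :: com where
  "Relax = Cond (Less (Add (Reg rZ) (Get FA (Get TB (Reg rX)))) (Get FA (Reg rX)))
    (Seq (Put FA (Reg rX) (Add (Reg rZ) (Get FA (Get TB (Reg rX)))))
    (Seq (Put LAST (Reg rX) (Reg rU)) (Put NXT (Reg rX) (Get TB (Reg rX)))))
    Skip"

definition Force :: com where
  "Force = Cond (Less (Get TB (Reg rX)) (Reg rX)) Skip
    (Seq (Put REM (Reg rX) (Get TB (Get REM (Reg rX))))
      (Put COST (Reg rX) (Add (Get COST (Reg rX)) (Reg rZ))))"

definition Phase2 :: com where
  "Phase2 = For rV rN (Cond (Less (Const 0) (Get INC (Reg rV))) Skip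
    (Seq (Assign rU (Reg rV))
    (Seq Table
    (Seq (Assign rZ (Wgt (Reg rU))) (For rX rP (Seq Relax Force))))))"

definition Phase3 :: com where
  "Phase3 = Seq (Assign rBX (Const 0))
    (Seq (Assign rBV (Add (Get COST (Const 0)) (Get FA (Get REM (Const 0)))))
    (For rX rP
      (Seq (Assign rZ (Add (Get COST (Reg rX)) (Get FA (Get REM (Reg rX)))))
      (Cond (Less (Reg rZ) (Reg rBV)) (Seq (Assign rBV (Reg rZ)) (Assign rBX (Reg rX))) Skip))))"

context covered
begin

section \<open>Tabulation over the subsets of the cover\<close>

definition wsum :: "nat set \<Rightarrow> nat" where
  "wsum A = (\<Sum>i\<in>A. w (cl i))"

text \<open>The bound \<open>v\<close> restricts attention to the vertices processed so far, which
  allows invariants in the middle of \<open>Phase2\<close>. For \<open>v = n\<close> this is the set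
  of all forced vertices of the trace \<open>A\<close>, and \<open>left\<close> below is then the
  set \<open>Y\<close> of the overview.\<close>

definition forced :: "nat \<Rightarrow> nat set \<Rightarrow> nat set" where
  "forced v A = {u. u < v \<and> u \<notin> C \<and> NI u \<inter> A = {}}"

definition left :: "nat \<Rightarrow> nat set \<Rightarrow> nat set" where
  "left v A = {..<k} - (\<Union>i\<in>A. NI (cl i)) - (\<Union>u\<in>forced v A. NI u)"

definition row :: "nat \<Rightarrow> state \<Rightarrow> nat \<Rightarrow> bool" where
  "row v s X \<longleftrightarrow> arr L s COST X = wsum (set_decode X) + sum w (forced v (set_decode X)) \<and>
     arr L s REM X = set_encode (left v (set_decode X))"

definition split_top :: "state \<Rightarrow> nat \<Rightarrow> bool" where
  "split_top s X \<longleftrightarrow> (X > 0 \<longrightarrow> (\<exists>j<k. arr L s TOP X = cl j \<and> arr L s LOW X < X \<and>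
     j \<notin> set_decode (arr L s LOW X) \<and> set_decode X = insert j (set_decode (arr L s LOW X))))"

definition row0 :: "state \<Rightarrow> nat \<Rightarrow> bool" where
  "row0 s X \<longleftrightarrow> row 0 s X \<and> arr L s FA X = wsum (set_decode X) \<and> split_top s X \<and>
     (X > 0 \<longrightarrow> arr L s LAST X = arr L s TOP X \<and> arr L s NXT X = arr L s LOW X)"

text \<open>An inequality suffices in the last conjunct and is stable: \<open>FA\<close> only
  decreases, so a later improvement at the successor mask does no harm. The strict decrease along
  \<open>NXT\<close> makes the chain end at the empty mask.\<close>

definition sound :: "state \<Rightarrow> bool" where
  "sound s \<longleftrightarrow> (\<forall>X<2 ^ k. 0 < X \<longrightarrow> arr L s LAST X < n \<and> arr L s NXT X < X \<and>
     set_decode X \<subseteq> set_decode (arr L s NXT X) \<union> NI (arr L s LAST X) \<and>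
     w (arr L s LAST X) + arr L s FA (arr L s NXT X) \<le> arr L s FA X)"

text \<open>Partial covers are included, with the uncovered rest paid by \<open>wsum\<close>. For
  \<open>v = 0\<close> this is the initial table; for a set \<open>U\<close> that covers the mask,
  the second summand vanishes.\<close>

definition opt :: "nat \<Rightarrow> state \<Rightarrow> bool" where
  "opt v s \<longleftrightarrow> (\<forall>X<2 ^ k. \<forall>U. U \<subseteq> {u. u < v \<and> u \<notin> C} \<longrightarrow>
     arr L s FA X \<le> sum w U + wsum (set_decode X - (\<Union>u\<in>U. NI u)))"

lemma rset_tables [simp]:
  "row v (rset s r x) X = row v s X" "row0 (rset s r x) X = row0 s X"
  "sound (rset s r x) = sound s" "opt v (rset s r x) = opt v s"
  by (simp_all add: row_def row0_def split_top_def sound_def opt_def)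

lemma left_subset: "left v A \<subseteq> {..<k}"
  by (auto simp: left_def)

lemma finite_left [simp]: "finite (left v A)"
  using left_subset finite_subset by blast

lemma forced_0 [simp]: "forced 0 A = {}"
  by (simp add: forced_def)

lemma forced_Suc: "forced (Suc v) A = (if v \<notin> C \<and> NI v \<inter> A = {} then insert v (forced v A) else forced v A)"
  by (auto simp: forced_def less_Suc_eq)

lemma finite_forced [simp]: "finite (forced v A)"
  by (simp add: forced_def)

lemma left_Suc: "left (Suc v) A = (if v \<notin> C \<and> NI v \<inter> A = {} then left v A - NI v else left v A)"
  by (auto simp: left_def forced_Suc)

lemma cut_left: "cut v (set_encode (left u A)) = set_encode (left u A - NI v)"
  by (simp add: cut_def)

lemma wp_NewRow:
  assumes s: "regs s rL = L" "regs s rQ2 = 2 ^ i" "regs s rS = S" "regs s rU = cl i" "regs s rZ = w (cl i)"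
    and i: "i < k" and S: "S < 2 ^ i" and TB: "\<forall>X<2 ^ k. arr L s TB X = cut (cl i) X"
    and rows: "\<forall>X<2 ^ i + S. row0 s X"
  shows "wp NewRow s (\<lambda>t s'. t \<le> 1500 \<and> same L {rX} {TOP, LAST, LOW, NXT, COST, FA, REM} s s' \<and>
    regs s' rS = S \<and> (\<forall>X<2 ^ i + Suc S. row0 s' X))"
proof -
  let ?X = "2 ^ i + S"
  have rowS: "row0 s S" using rows S by simp
  have niS: "i \<notin> set_decode S" using set_decode_less[OF S] by auto
  have dec: "set_decode ?X = insert i (set_decode S)"
    using S by (rule set_decode_add_power)
  have "left 0 (insert i (set_decode S)) = left 0 (set_decode S) - NI (cl i)"
    by (auto simp: left_def)
  then have new_rem: "arr L s TB (arr L s REM S) = set_encode (left 0 (set_decode ?X))"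
    using TB rowS set_encode_less[OF left_subset] by (simp add: row0_def row_def dec cut_left)
  have new_w: "wsum (set_decode ?X) = wsum (set_decode S) + w (cl i)"
    using niS by (simp add: dec wsum_def)
  have *: "row0 s' X" if X: "X < 2 ^ i + Suc S"
    and upd: "\<And>j. j \<in> {TOP, LAST, LOW, NXT, COST, FA, REM} \<Longrightarrow> X \<noteq> ?X \<Longrightarrow> arr L s' j X = arr L s j X"
    and new: "arr L s' TOP ?X = cl i" "arr L s' LAST ?X = cl i" "arr L s' LOW ?X = S" "arr L s' NXT ?X = S"
      "arr L s' COST ?X = arr L s COST S + w (cl i)" "arr L s' FA ?X = arr L s FA S + w (cl i)"
      "arr L s' REM ?X = arr L s TB (arr L s REM S)" for s' X
  proof (cases "X = ?X")
    case True
    then show ?thesis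
      using new new_rem new_w rowS niS dec i
      by (auto simp: row0_def row_def split_top_def)
  next
    case False
    then have "row0 s X" using X rows by simp
    then show ?thesis
      using upd False by (simp add: row0_def row_def split_top_def)
  qed
  have "wp NewRow s (\<lambda>t s'. t \<le> 1500 \<and> same L {rX} {TOP, LAST, LOW, NXT, COST, FA, REM} s s' \<and>
    regs s' rS = S \<and> (\<forall>X. (\<forall>j\<in>{TOP, LAST, LOW, NXT, COST, FA, REM}. X \<noteq> ?X \<longrightarrow> arr L s' j X = arr L s j X)) \<and>
    arr L s' TOP ?X = cl i \<and> arr L s' LAST ?X = cl i \<and> arr L s' LOW ?X = S \<and> arr L s' NXT ?X = S \<and>
    arr L s' COST ?X = arr L s COST S + w (cl i) \<and> arr L s' FA ?X = arr L s FA S + w (cl i) \<and>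
    arr L s' REM ?X = arr L s TB (arr L s REM S))"
    unfolding NewRow_def using s by (simp add: wp_Put)
  then show ?thesis
    by (rule wp_mono) (intro conjI allI impI *; blast)
qed

abbreviation (input) "RT \<equiv> {rI, rJ, rD, rO, rQ, rS, rZ}"
abbreviation (input) "ROWS \<equiv> {TOP, LAST, LOW, NXT, COST, FA, REM}"

lemma wp_Phase1:
  assumes s: "dctx s"
  shows "wp Phase1 s (\<lambda>t s'. t \<le> k * (7000 * 2 ^ k + 208 * n) + 500 \<and>
    same L ({rI2, rU, rQ2, rX} \<union> RT) ({FL, TB} \<union> ROWS) s s' \<and> (\<forall>X<2 ^ k. row0 s' X))"
proof -
  let ?R = "{rI2, rU, rQ2, rX} \<union> RT" and ?A = "{FL, TB} \<union> ROWS"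
  let ?body = "Seq (Assign rU (Get CL (Reg rI2)))
      (Seq Table
      (Seq (Assign rZ (Wgt (Reg rU)))
      (Seq (For rS rQ2 NewRow) (Assign rQ2 (Add (Reg rQ2) (Reg rQ2))))))"
  have loop: "wp (For rI2 rK ?body) s0 (\<lambda>t s'. t \<le> k * ((6500 * 2 ^ k + 208 * n) + 8) + 6 \<and>
      same L ?R ?A s0 s' \<and> (regs s' rQ2 = 2 ^ k \<and> (\<forall>X<2 ^ k. row0 s' X)))"
    if s0: "dctx s0" "regs s0 rQ2 = 1" "row0 s0 0" for s0
  proof (rule wp_For_const[where I = "\<lambda>i s'. regs s' rQ2 = 2 ^ i \<and> (\<forall>X<2 ^ i. row0 s' X)"])
    fix i s1
    assume i: "i < k" and s1: "same L ?R ?A s0 s1" "regs s1 rI2 = i" "regs s1 rQ2 = 2 ^ i \<and> (\<forall>X<2 ^ i. row0 s1 X)"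
    have d1: "dctx s1" by (rule dctx_same[OF s0(1) s1(1)]) auto
    let ?s2 = "rset s1 rU (cl i)"
    have "same L {rU} {} s1 ?s2" by simp
    then have d2: "dctx ?s2" by (rule dctx_same[OF d1]) auto
    have U: "aval (Get CL (Reg rI2)) s1 = cl i"
      using d1 s1(2) i by (simp add: dctx_regs dctx_CL)
    have "(2 :: nat) ^ i \<le> 2 ^ k" using i by simp
    then have pw: "(2 :: nat) ^ i * 1508 + 100 \<le> 2 ^ k * 1608"
      using less_exp[of k] by linarith
    have small: "(2 :: nat) ^ i + 2 ^ i \<le> 2 ^ k"
      using power_increasing[of "Suc i" k "2 :: nat"] i by simp
    have dg: "deg (cl i) \<le> n" using deg_le cl_less[OF i] by blast
    have rows: "wp (For rS rQ2 NewRow) s3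
      (\<lambda>t s'. t \<le> 2 ^ i * (1500 + 8) + 6 \<and> same L {rS, rX} ROWS s3 s' \<and> (\<forall>X<2 ^ i + 2 ^ i. row0 s' X))"
      if s3: "regs s3 rL = L" "regs s3 rQ2 = 2 ^ i" "regs s3 rU = cl i" "regs s3 rZ = w (cl i)"
        "\<forall>X<2 ^ k. arr L s3 TB X = cut (cl i) X" "\<forall>X<2 ^ i. row0 s3 X" for s3
    proof (rule wp_For_const[where I = "\<lambda>x s'. \<forall>X<2 ^ i + x. row0 s' X"])
      fix x s4
      assume x: "x < 2 ^ i" and s4: "same L {rS, rX} ROWS s3 s4" "regs s4 rS = x" "\<forall>X<2 ^ i + x. row0 s4 X"
      show "wp NewRow s4 (\<lambda>t s5. t \<le> 1500 \<and> same L {rS, rX} ROWS s4 s5 \<and> regs s5 rS = x \<and>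
        (\<forall>X<2 ^ i + Suc x. row0 (rset s5 rS (Suc x)) X))"
        unfolding rset_tables
        by (rule wp_mono[OF wp_NewRow[of s4 i x]])
          (use s3 s4 x i in \<open>auto simp: same_regs same_arr intro: same_mono\<close>)
    qed (use s3 in \<open>auto simp: row0_def row_def split_top_def\<close>)
    show "wp ?body s1 (\<lambda>t s2. t \<le> 6500 * 2 ^ k + 208 * n \<and> same L ?R ?A s1 s2 \<and> regs s2 rI2 = i \<and>
      regs (rset s2 rI2 (Suc i)) rQ2 = 2 ^ Suc i \<and> (\<forall>X<2 ^ Suc i. row0 (rset s2 rI2 (Suc i)) X))"
      unfolding wp_Seq wp_Assign U
    proof (rule wp_mono[OF wp_Table[OF d2, of "cl i"]], goal_cases)
      case (3 t3 s3)
      then have fr3: "same L RT {FL, TB} ?s2 s3" by simp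
      have d3: "dctx s3" by (rule dctx_same[OF d2 fr3]) auto
      have U3: "regs s3 rU = cl i" using fr3 by (simp add: same_regs)
      have Z: "aval (Wgt (Reg rU)) s3 = w (cl i)"
        using aval_Wgt[OF dctx_ctx[OF d3], of "Reg rU"] U3 cl_less[OF i] by simp
      let ?s3 = "rset s3 rZ (w (cl i))"
      have "regs s3 rQ2 = 2 ^ i" using fr3 s1(3) by (simp add: same_regs)
      then have r3: "regs ?s3 rL = L" "regs ?s3 rQ2 = 2 ^ i" "regs ?s3 rU = cl i"
        using U3 dctx_regs[OF d3] by simp_all
      have rowa: "row0 ?s3 X" if "row0 s1 X" for X
        using that fr3 by (simp add: row0_def row_def split_top_def same_arr)
      show ?case
        unfolding Z
      proof (rule wp_mono[OF rows], goal_cases)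
        case (7 t4 s4)
        then have fr4: "same L {rS, rX} ROWS ?s3 s4" by simp
        have "same L ?R ?A ?s2 s3"
          by (rule same_mono[OF fr3]) auto
        then have a: "same L ?R ?A s1 s3" by simp
        have "same L ?R ?A ?s3 s4"
          by (rule same_mono[OF fr4]) auto
        then have "same L ?R ?A s3 s4" by simp
        with a have "same L ?R ?A s1 s4" by (rule same_trans)
        moreover have "regs s4 rI2 = i" "regs s4 rQ2 = 2 ^ i"
          using fr3 fr4 s1 by (simp_all add: same_regs)
        moreover have "52 + t3 + t4 \<le> 6500 * 2 ^ k + 208 * n"
        proof -
          have "t3 \<le> 3500 * 2 ^ k + 208 * deg (cl i)" "t4 \<le> 2 ^ i * 1508 + 6"
            using 3 7 by auto
          then show ?thesis using pw dg by linarith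
        qed
        ultimately show ?case
          using 7 by (simp add: row0_def row_def split_top_def mult_2)
      qed (use 3 r3 rowa s1(3) in auto)
    qed (use cl_less[OF i] in auto)
  qed (use s0 in \<open>auto simp: dctx_regs\<close>)
  have L: "regs s rL = L" using s by (simp add: dctx_regs)
  let ?s = "rset (aset L (aset L (aset L s REM 0 (2 ^ k - 1)) COST 0 0) FA 0 0) rQ2 1"
  have P: "aval (Sub (Reg rP) (Const 1)) s = 2 ^ k - 1"
    using s by (simp add: dctx_regs)
  have fr: "same L ?R ?A s ?s" by simp
  have d: "dctx ?s" by (rule dctx_same[OF s fr]) auto
  \<comment> \<open>The empty trace leaves all of \<open>C\<close> to dominate, and the code of the
    full set is \<open>2 ^ k - 1\<close>.\<close>
  have "left 0 {} = {..<k}" by (simp add: left_def)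
  then have r0: "row0 ?s 0"
    using set_encode_lessThan[of k] by (auto simp: row0_def row_def split_top_def wsum_def)
  have "(6500 * 2 ^ k + 208 * n) + 8 \<le> 7000 * (2 :: nat) ^ k + 208 * n"
    using less_exp[of k] by linarith
  then have tm: "k * ((6500 * 2 ^ k + 208 * n) + 8) \<le> k * (7000 * 2 ^ k + 208 * n)"
    by (rule mult_le_mono2)
  have *: "wp (For rI2 rK ?body) ?s (\<lambda>t s'. t \<le> k * (7000 * 2 ^ k + 208 * n) + 6 \<and>
      same L ?R ?A s s' \<and> (\<forall>X<2 ^ k. row0 s' X))"
  proof (rule wp_mono[OF loop[OF d _ r0]], goal_cases)
    case (2 t s')
    then have "t \<le> k * ((6500 * 2 ^ k + 208 * n) + 8) + 6" by (rule conjunct1)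
    then have "t \<le> k * (7000 * 2 ^ k + 208 * n) + 6" using tm by linarith
    then show ?case using 2 by simp
  qed simp
  show ?thesis
    unfolding Phase1_def wp_Seq
  proof ((subst wp_Put[of _ L], simp add: L)+, unfold wp_Assign P aval.simps(1), rule wp_mono[OF *],
      goal_cases)
    case (1 t s')
    then show ?case by simp
  qed
qed

text \<open>Initially each mask is covered by its own vertices: index \<open>j\<close> lies in
  \<open>NI (cl j)\<close>, so peeling off one bit along \<open>TOP\<close> and \<open>LOW\<close>
  is also a step of a cover chain.\<close>

lemma row0_sound:
  assumes "\<forall>X<2 ^ k. row0 s X"
  shows "sound s"
  unfolding sound_def
proof (intro allI impI)
  fix X :: nat assume X: "X < 2 ^ k" "0 < X"
  have r: "row0 s X" using assms X by simp
  then obtain j where j: "j < k" "arr L s LAST X = cl j" "arr L s NXT X = arr L s LOW X" "arr L s LOW X < X"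
    "j \<notin> set_decode (arr L s LOW X)" "set_decode X = insert j (set_decode (arr L s LOW X))"
    using X by (auto simp: row0_def split_top_def)
  have "row0 s (arr L s LOW X)" using assms X j by simp
  then have "arr L s FA X = w (cl j) + arr L s FA (arr L s LOW X)"
    using r j by (simp add: row0_def wsum_def)
  moreover have "j \<in> NI (cl j)" using j by (simp add: NI_def)
  ultimately show "arr L s LAST X < n \<and> arr L s NXT X < X \<and>
     set_decode X \<subseteq> set_decode (arr L s NXT X) \<union> NI (arr L s LAST X) \<and>
     w (arr L s LAST X) + arr L s FA (arr L s NXT X) \<le> arr L s FA X"
    using j cl_less by auto
qed

lemma wp_Relax:
  assumes s: "regs s rL = L" "regs s rX = X" "regs s rU = v" "regs s rZ = w v" "v < n" "X < 2 ^ k"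
    and TB: "\<forall>X<2 ^ k. arr L s TB X = cut v X" and snd: "sound s"
  shows "wp Relax s (\<lambda>t s'. t \<le> 1500 \<and> same L {} {FA, LAST, NXT} s s' \<and> sound s' \<and>
    (\<forall>Y. arr L s' FA Y \<le> arr L s FA Y) \<and> arr L s' FA X \<le> w v + arr L s FA (cut v X))"
proof (cases "w v + arr L s FA (cut v X) < arr L s FA X")
  case False
  then show ?thesis using s TB snd by (simp add: Relax_def)
next
  case True
  let ?s = "aset L (aset L (aset L s FA X (w v + arr L s FA (cut v X))) LAST X v) NXT X (cut v X)"
  \<comment> \<open>A strict improvement is impossible if the cut changes nothing. So the new link
    really decreases the mask, as \<open>sound\<close> demands.\<close>
  have "cut v X \<noteq> X" using True by auto
  then have lt: "cut v X < X"
    using set_encode_Diff_le[of X "NI v"] by (simp add: cut_def)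
  have "sound ?s"
    unfolding sound_def
  proof (intro allI impI)
    fix Y :: nat assume Y: "Y < 2 ^ k" "0 < Y"
    show "arr L ?s LAST Y < n \<and> arr L ?s NXT Y < Y \<and>
       set_decode Y \<subseteq> set_decode (arr L ?s NXT Y) \<union> NI (arr L ?s LAST Y) \<and>
       w (arr L ?s LAST Y) + arr L ?s FA (arr L ?s NXT Y) \<le> arr L ?s FA Y"
    proof (cases "Y = X")
      case True
      then show ?thesis using s(5) lt by (auto simp: set_decode_cut)
    next
      case False
      \<comment> \<open>If the link of \<open>Y\<close> leads to \<open>X\<close>, the lowered entry
        at \<open>X\<close> only strengthens the inequality for \<open>Y\<close>.\<close>
      then show ?thesis
        using snd Y True unfolding sound_def
        by (auto dest!: spec[of _ Y])
    qed
  qed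
  then show ?thesis
    using True s TB by (simp add: Relax_def wp_Put)
qed

lemma wp_Force:
  assumes s: "regs s rL = L" "regs s rX = X" "regs s rZ = w v" "v \<notin> C" "X < 2 ^ k"
    and TB: "\<forall>X<2 ^ k. arr L s TB X = cut v X" and row: "row v s X"
  shows "wp Force s (\<lambda>t s'. t \<le> 1000 \<and> same L {} {REM, COST} s s' \<and> row (Suc v) s' X \<and>
    (\<forall>Y. Y \<noteq> X \<longrightarrow> arr L s' REM Y = arr L s REM Y \<and> arr L s' COST Y = arr L s COST Y))"
proof (cases "NI v \<inter> set_decode X = {}")
  case False
  then have "cut v X < X" by (simp add: cut_def set_encode_Diff_less_iff)
  then show ?thesis
    using False s TB row by (simp add: Force_def row_def forced_Suc left_Suc)
next
  case True
  then have "\<not> cut v X < X" by (simp add: cut_def set_encode_Diff_less_iff)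
  moreover have "v \<notin> forced v (set_decode X)" by (simp add: forced_def)
  moreover have "arr L s REM X < 2 ^ k"
    using row set_encode_less[OF left_subset] by (simp add: row_def)
  ultimately show ?thesis
    using True s TB row
    by (simp add: Force_def row_def forced_Suc left_Suc wp_Put cut_left)
qed

text \<open>All neighbours of a vertex outside \<open>C\<close> lie in \<open>C\<close>. This keeps
  its table in time \<open>O(2^k)\<close>, with no summand n, as needed in a loop over n
  vertices.\<close>

lemma deg_le_k: "v < n \<Longrightarrow> v \<notin> C \<Longrightarrow> deg v \<le> k"
proof -
  assume v: "v < n" "v \<notin> C"
  then have "nb v \<subseteq> cl ` {..<k}" using cover_C by (simp add: cover_iff cl_image)
  then have "card (nb v) \<le> card {..<k}" using surj_card_le by blast
  then show ?thesis by (simp add: deg_card[OF v(1)])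
qed

abbreviation (input) "TABS \<equiv> {FA, LAST, NXT, REM, COST}"

lemma wp_Phase2:
  assumes s: "dctx s" and init: "opt 0 s" "sound s" "\<forall>X<2 ^ k. row 0 s X"
  shows "wp Phase2 s (\<lambda>t s'. t \<le> n * (8000 * 2 ^ k) + 6 \<and>
    same L ({rV, rU, rX} \<union> RT) ({FL, TB} \<union> TABS) s s' \<and>
    (opt n s' \<and> sound s' \<and> (\<forall>X<2 ^ k. row n s' X)))"
proof -
  let ?R = "{rV, rU, rX} \<union> RT" and ?A = "{FL, TB} \<union> TABS"
  let ?body = "Cond (Less (Const 0) (Get INC (Reg rV))) Skip
    (Seq (Assign rU (Reg rV)) (Seq Table
    (Seq (Assign rZ (Wgt (Reg rU))) (For rX rP (Seq Relax Force)))))"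
  have *: "wp Phase2 s (\<lambda>t s'. t \<le> n * (7800 * 2 ^ k + 8) + 6 \<and> same L ?R ?A s s' \<and>
    (opt n s' \<and> sound s' \<and> (\<forall>X<2 ^ k. row n s' X)))"
    unfolding Phase2_def
  proof (rule wp_For_const[where I = "\<lambda>v s'. opt v s' \<and> sound s' \<and> (\<forall>X<2 ^ k. row v s' X)"])
    fix v s1
    assume v: "v < n" and s1: "same L ?R ?A s s1" "regs s1 rV = v"
      "opt v s1 \<and> sound s1 \<and> (\<forall>X<2 ^ k. row v s1 X)"
    have d1: "dctx s1" by (rule dctx_same[OF s s1(1)]) auto
    have INC: "arr L s1 INC v = (if v \<in> C then 1 else 0)" using d1 v by (simp add: dctx_def)
    have two: "1 \<le> (2 :: nat) ^ k" by simp
    show "wp ?body s1 (\<lambda>t s2. t \<le> 7800 * 2 ^ k \<and> same L ?R ?A s1 s2 \<and> regs s2 rV = v \<and>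
      opt (Suc v) (rset s2 rV (Suc v)) \<and> sound (rset s2 rV (Suc v)) \<and>
      (\<forall>X<2 ^ k. row (Suc v) (rset s2 rV (Suc v)) X))"
    proof (cases "v \<in> C")
      case True
      then have "{u. u < Suc v \<and> u \<notin> C} = {u. u < v \<and> u \<notin> C}" by (auto simp: less_Suc_eq)
      then have "opt (Suc v) s1" "\<forall>X<2 ^ k. row (Suc v) s1 X"
        using True s1 by (simp_all add: opt_def row_def forced_Suc left_Suc)
      then show ?thesis
        using INC s1 True dctx_regs(1)[OF d1] two by simp
    next
      case False
      let ?s1 = "rset s1 rU v"
      have "same L {rU} {} s1 ?s1" by simp
      then have d1': "dctx ?s1" by (rule dctx_same[OF d1]) auto
      have inner: "wp (For rX rP (Seq Relax Force)) s2
        (\<lambda>t s'. t \<le> 2 ^ k * (2500 + 8) + 6 \<and> same L {rX} TABS s2 s' \<and>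
          ((\<forall>Y<2 ^ k. row (Suc v) s' Y) \<and> (\<forall>Y. 2 ^ k \<le> Y \<and> Y < 2 ^ k \<longrightarrow> row v s' Y) \<and>
           (\<forall>Y. arr L s' FA Y \<le> arr L s2 FA Y) \<and>
           (\<forall>Y<2 ^ k. arr L s' FA Y \<le> w v + arr L s2 FA (cut v Y)) \<and> sound s'))"
        if s2: "regs s2 rL = L" "regs s2 rP = 2 ^ k" "regs s2 rU = v" "regs s2 rZ = w v"
          "\<forall>X<2 ^ k. arr L s2 TB X = cut v X" "\<forall>X<2 ^ k. row v s2 X" "sound s2" for s2
      proof (rule wp_For_const[where I = "\<lambda>X s'. (\<forall>Y<X. row (Suc v) s' Y) \<and>
           (\<forall>Y. X \<le> Y \<and> Y < 2 ^ k \<longrightarrow> row v s' Y) \<and> (\<forall>Y. arr L s' FA Y \<le> arr L s2 FA Y) \<and>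
           (\<forall>Y<X. arr L s' FA Y \<le> w v + arr L s2 FA (cut v Y)) \<and> sound s'"])
        fix X s3
        assume X: "X < 2 ^ k" and s3: "same L {rX} TABS s2 s3" "regs s3 rX = X"
          "(\<forall>Y<X. row (Suc v) s3 Y) \<and> (\<forall>Y. X \<le> Y \<and> Y < 2 ^ k \<longrightarrow> row v s3 Y) \<and>
           (\<forall>Y. arr L s3 FA Y \<le> arr L s2 FA Y) \<and>
           (\<forall>Y<X. arr L s3 FA Y \<le> w v + arr L s2 FA (cut v Y)) \<and> sound s3"
        have f3: "regs s3 rL = L" "regs s3 rU = v" "regs s3 rZ = w v" "\<forall>X<2 ^ k. arr L s3 TB X = cut v X"
          using s2 s3 by (simp_all add: same_regs same_arr)
        have snd: "sound s3" using s3(3) by simp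
        show "wp (Seq Relax Force) s3 (\<lambda>t s4. t \<le> 2500 \<and> same L {rX} TABS s3 s4 \<and> regs s4 rX = X \<and>
          (\<forall>Y<Suc X. row (Suc v) (rset s4 rX (Suc X)) Y) \<and>
          (\<forall>Y. Suc X \<le> Y \<and> Y < 2 ^ k \<longrightarrow> row v (rset s4 rX (Suc X)) Y) \<and>
          (\<forall>Y. arr L (rset s4 rX (Suc X)) FA Y \<le> arr L s2 FA Y) \<and>
          (\<forall>Y<Suc X. arr L (rset s4 rX (Suc X)) FA Y \<le> w v + arr L s2 FA (cut v Y)) \<and>
          sound (rset s4 rX (Suc X)))"
          unfolding wp_Seq rset_tables arr_rset
        proof (rule wp_mono[OF wp_Relax[OF f3(1) s3(2) f3(2,3) v X f3(4) snd]], goal_cases)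
          case (1 t4 s4)
          then have fr4: "same L {} {FA, LAST, NXT} s3 s4" by simp
          have f4: "regs s4 rL = L" "regs s4 rX = X" "regs s4 rZ = w v" "\<forall>X<2 ^ k. arr L s4 TB X = cut v X"
            using f3 s3 fr4 by (simp_all add: same_regs same_arr)
          have rows4: "row u s4 Y \<longleftrightarrow> row u s3 Y" for u Y
            using fr4 by (simp add: row_def same_arr)
          then have "row v s4 X" using s3 X by simp
          show ?case
          proof (rule wp_mono[OF wp_Force[OF f4(1-3) False X f4(4) \<open>row v s4 X\<close>]], goal_cases)
            case (1 t5 s5)
            note relax = \<open>t4 \<le> 1500 \<and> _\<close>
            from 1 have fr5: "same L {} {REM, COST} s4 s5" by simp
            have a: "same L {rX} TABS s3 s4" by (rule same_mono[OF fr4]) auto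
            have b: "same L {rX} TABS s4 s5" by (rule same_mono[OF fr5]) auto
            have FA5: "arr L s5 FA = arr L s4 FA" using fr5 by (simp add: same_arr)
            have row5: "row u s5 Y \<longleftrightarrow> row u s3 Y" if "Y \<noteq> X" for u Y
              using that 1 rows4[of u Y] by (simp add: row_def)
            have "row (Suc v) s5 Y" if "Y < Suc X" for Y
              using that 1 row5[of Y] s3(3) by (cases "Y = X") auto
            moreover have "row v s5 Y" if "Suc X \<le> Y" "Y < 2 ^ k" for Y
              using that row5[of Y] s3(3) by auto
            moreover have le: "arr L s5 FA Y \<le> arr L s3 FA Y" "arr L s3 FA Y \<le> arr L s2 FA Y" for Y
              using relax s3(3) FA5 by simp_all
            moreover have "arr L s5 FA Y \<le> arr L s2 FA Y" for Y
              by (rule order_trans[OF le])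
            moreover have "arr L s5 FA Y \<le> w v + arr L s2 FA (cut v Y)" if "Y < Suc X" for Y
            proof (cases "Y = X")
              case True
              have "arr L s5 FA X \<le> w v + arr L s3 FA (cut v X)" using relax FA5 by simp
              then show ?thesis unfolding True using le(2)[of "cut v X"] by linarith
            next
              case False
              then have "arr L s3 FA Y \<le> w v + arr L s2 FA (cut v Y)" using that s3(3) by simp
              then show ?thesis using le(1)[of Y] by linarith
            qed
            moreover have "sound s5"
              using relax fr5 by (simp add: sound_def same_arr)
            moreover have "regs s5 rX = X" using fr5 f4 by (simp add: same_regs)
            ultimately show ?case
              using relax 1 same_trans[OF a b] by simp
          qed
        qed
      qed (use s2 in auto)
      have b: "\<not> bval (Less (Const 0) (Get INC (Reg rV))) s1"
        using INC False s1 dctx_regs(1)[OF d1] by simp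
      have V: "aval (Reg rV) s1 = v" using s1 by simp
      show ?thesis
        unfolding wp_Cond if_not_P[OF b] wp_Seq wp_Assign V
      proof (rule wp_mono[OF wp_Table[OF d1' _ v]], goal_cases)
        case (2 t2 s2)
        then have fr2: "same L RT {FL, TB} ?s1 s2" by simp
        have d2: "dctx s2" by (rule dctx_same[OF d1' fr2]) auto
        have U2: "regs s2 rU = v" using fr2 by (simp add: same_regs)
        have Z: "aval (Wgt (Reg rU)) s2 = w v"
          using aval_Wgt[OF dctx_ctx[OF d2], of "Reg rU"] U2 v by simp
        let ?s2 = "rset s2 rZ (w v)"
        have FA2: "arr L s2 FA = arr L s1 FA" using fr2 by (simp add: same_arr)
        have snd: "sound ?s2" and rows: "\<forall>X<2 ^ k. row v ?s2 X"
          using s1(3) fr2 by (simp_all add: sound_def row_def same_arr)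
        have r2: "regs ?s2 rL = L" "regs ?s2 rP = 2 ^ k"
          using dctx_regs[OF d2] by simp_all
        show ?case
          unfolding Z
        proof (rule wp_mono[OF inner], goal_cases)
          case (8 t3 s3)
          then have fr3: "same L {rX} TABS ?s2 s3" by simp
          have "same L ?R ?A ?s1 s2" by (rule same_mono[OF fr2]) auto
          then have a: "same L ?R ?A s1 s2" by simp
          have "same L ?R ?A ?s2 s3" by (rule same_mono[OF fr3]) auto
          then have "same L ?R ?A s2 s3" by simp
          with a have "same L ?R ?A s1 s3" by (rule same_trans)
          moreover have "regs s3 rV = v" using fr2 fr3 s1 by (simp add: same_regs)
          moreover have "opt (Suc v) s3"
            unfolding opt_def
          proof (intro allI impI)
            fix X :: nat and U assume X: "X < 2 ^ k" and U: "U \<subseteq> {u. u < Suc v \<and> u \<notin> C}"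
            show "arr L s3 FA X \<le> sum w U + wsum (set_decode X - (\<Union>u\<in>U. NI u))"
            proof (cases "v \<in> U")
              case True
              have "finite U" using U finite_subset by fastforce
              \<comment> \<open>Buying \<open>v\<close> reduces the mask \<open>X\<close> to
                \<open>cut v X\<close>, and the rest of \<open>U\<close> consists of earlier
                vertices. The old bound for that mask plus the relaxation gives the new one.\<close>
              have "U - {v} \<subseteq> {u. u < v \<and> u \<notin> C}" using U by (auto simp: less_Suc_eq)
              then have "arr L s1 FA (cut v X) \<le>
                  sum w (U - {v}) + wsum (set_decode (cut v X) - (\<Union>u\<in>U - {v}. NI u))"
                using s1(3) cut_less[OF X] by (simp add: opt_def)
              moreover have "set_decode (cut v X) - (\<Union>u\<in>U - {v}. NI u) = set_decode X - (\<Union>u\<in>U. NI u)"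
                using True by (auto simp: set_decode_cut)
              moreover have "arr L s3 FA X \<le> w v + arr L s1 FA (cut v X)"
                using 8 X FA2 by simp
              moreover have "sum w U = w v + sum w (U - {v})"
                using True \<open>finite U\<close> by (rule sum.remove[rotated])
              ultimately show ?thesis by simp
            next
              case False
              then have "U \<subseteq> {u. u < v \<and> u \<notin> C}" using U by (auto simp: less_Suc_eq)
              then have "arr L s1 FA X \<le> sum w U + wsum (set_decode X - (\<Union>u\<in>U. NI u))"
                using s1(3) X by (simp add: opt_def)
              moreover have "arr L s3 FA X \<le> arr L s1 FA X" using 8 FA2 by simp
              ultimately show ?thesis by linarith
            qed
          qed
          moreover have "110 + t2 + t3 \<le> 7800 * 2 ^ k"
          proof -
            have "t2 \<le> 3500 * 2 ^ k + 208 * deg v" "t3 \<le> 2508 * 2 ^ k + 6"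
              using 2 8 by (auto simp: mult.commute)
            then show ?thesis using deg_le_k[OF v False] less_exp[of k] by linarith
          qed
          ultimately show ?case using 8 by simp
        qed (use r2 U2 2 rows snd in auto)
      qed simp
    qed
  qed (use s init in \<open>auto simp: dctx_regs\<close>)
  have "7800 * 2 ^ k + 8 \<le> 8000 * (2 :: nat) ^ k"
    using less_exp[of k] by linarith
  then have tm: "n * (7800 * 2 ^ k + 8) \<le> n * (8000 * 2 ^ k)"
    by (rule mult_le_mono2)
  show ?thesis
  proof (rule wp_mono[OF *], goal_cases)
    case (1 t s')
    then have "t \<le> n * (7800 * 2 ^ k + 8) + 6" by (rule conjunct1)
    then have "t \<le> n * (8000 * 2 ^ k) + 6" using tm by linarith
    then show ?case using 1 by simp
  qed
qed

definition val :: "state \<Rightarrow> nat \<Rightarrow> nat" where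
  "val s X = arr L s COST X + arr L s FA (arr L s REM X)"

lemma wp_Phase3:
  assumes s: "dctx s"
  shows "wp Phase3 s (\<lambda>t s'. t \<le> 2000 * 2 ^ k \<and> same L {rX, rZ, rBV, rBX} {} s s' \<and>
    regs s' rBX < 2 ^ k \<and> (\<forall>X<2 ^ k. val s (regs s' rBX) \<le> val s X))"
proof -
  let ?body = "Seq (Assign rZ (Add (Get COST (Reg rX)) (Get FA (Get REM (Reg rX)))))
      (Cond (Less (Reg rZ) (Reg rBV)) (Seq (Assign rBV (Reg rZ)) (Assign rBX (Reg rX))) Skip)"
  let ?s = "rset (rset s rBX 0) rBV (val s 0)"
  have *: "wp (For rX rP ?body) ?s (\<lambda>t s'. t \<le> 2 ^ k * (1000 + 8) + 6 \<and>
    same L {rX, rZ, rBV, rBX} {} ?s s' \<and>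
    (regs s' rBX < 2 ^ k \<and> regs s' rBV = val s (regs s' rBX) \<and> (\<forall>X<2 ^ k. regs s' rBV \<le> val s X)))"
  proof (rule wp_For_const[where I = "\<lambda>x s'. regs s' rBX < 2 ^ k \<and> regs s' rBV = val s (regs s' rBX) \<and>
      (\<forall>X<x. regs s' rBV \<le> val s X)"])
    fix x s1
    assume x: "x < 2 ^ k" and s1: "same L {rX, rZ, rBV, rBX} {} ?s s1" "regs s1 rX = x"
      "regs s1 rBX < 2 ^ k \<and> regs s1 rBV = val s (regs s1 rBX) \<and> (\<forall>X<x. regs s1 rBV \<le> val s X)"
    have L: "regs s1 rL = L" using s1 s by (simp add: same_regs dctx_regs)
    have V: "aval (Add (Get COST (Reg rX)) (Get FA (Get REM (Reg rX)))) s1 = val s x"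
      using L s1 by (simp add: val_def same_arr)
    show "wp ?body s1 (\<lambda>t s2. t \<le> 1000 \<and> same L {rX, rZ, rBV, rBX} {} s1 s2 \<and> regs s2 rX = x \<and>
      regs (rset s2 rX (Suc x)) rBX < 2 ^ k \<and>
      regs (rset s2 rX (Suc x)) rBV = val s (regs (rset s2 rX (Suc x)) rBX) \<and>
      (\<forall>X<Suc x. regs (rset s2 rX (Suc x)) rBV \<le> val s X))"
      unfolding wp_Seq wp_Assign V
      using s1 x by (auto simp: less_Suc_eq intro: less_imp_le order_trans)
  qed (use s in \<open>auto simp: dctx_regs\<close>)
  have V: "aval (Add (Get COST (Const 0)) (Get FA (Get REM (Const 0)))) (rset s rBX 0) = val s 0"
    using s by (simp add: val_def dctx_regs)
  show ?thesis
    unfolding Phase3_def wp_Seq wp_Assign aval.simps(1) V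
  proof (rule wp_mono[OF *], goal_cases)
    case (1 t s')
    then have "t \<le> 1008 * 2 ^ k + 6" by (simp add: mult.commute)
    then have "700 + t \<le> 2000 * 2 ^ k" using less_exp[of k] by linarith
    then show ?case using 1 by auto
  qed
qed

end

section \<open>Programs reconstructing and printing a solution\<close>

definition Chain :: "nat \<Rightarrow> nat \<Rightarrow> com" where
  "Chain a h = While (Less (Const 0) (Reg rX))
    (Seq (Put MK (Get a (Reg rX)) (Const 1)) (Assign rX (Get h (Reg rX))))"

definition MarkForced :: com where
  "MarkForced = For rV rN (Cond (Less (Const 0) (Get INC (Reg rV))) Skip
    (Seq (Assign rC (Const 0))
    (Seq (Nbrs rV (Assign rC (Add (Reg rC) (Get MK Nbr))))
    (Cond (Less (Const 0) (Reg rC)) Skip (Put MK (Reg rV) (Const 1))))))"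

text \<open>The order matters: \<open>MarkForced\<close> looks for marked neighbours and must run
  while the marked cover vertices are exactly the trace. The second chain may mark further vertices
  of \<open>C\<close>.\<close>

definition Mark :: com where
  "Mark = Seq (Assign rX (Reg rBX))
    (Seq (Chain TOP LOW)
    (Seq MarkForced
    (Seq (Assign rX (Get REM (Reg rBX))) (Chain LAST NXT))))"

definition Output :: com where
  "Output = Seq (Assign rC (Const 0))
    (Seq (For rV rN (Cond (Less (Const 0) (Get MK (Reg rV)))
      (Seq (Assign rC (Add (Reg rC) (Const 1))) (Store (Reg rC) (Reg rV))) Skip))
    (Store (Const 0) (Reg rC)))"

definition Solve :: com where
  "Solve = Seq Phase1 (Seq Phase2 (Seq Phase3 (Seq Mark Output)))"

definition Prog :: com where
  "Prog = Seq Init (Seq Search (Seq Enum (Seq Pow2 Solve)))"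

context graph_input
begin

section \<open>Writing the output\<close>

definition mk :: "state \<Rightarrow> nat set" where
  "mk s = {x. arr L s MK x \<noteq> 0}"

lemma mk_rset [simp]: "mk (rset s r x) = mk s"
  by (simp add: mk_def)

lemma mk_aset [simp]: "mk (aset L s MK i (Suc 0)) = insert i (mk s)"
  by (auto simp: mk_def)

lemma wp_Output:
  assumes s: "ctx s" "mk s \<subseteq> {..<n}"
  shows "wp Output s (\<lambda>t s'. t \<le> 200 * (n + 1) \<and> distinct (output_list s') \<and>
    set (output_list s') = mk s)"
proof -
  define out where "out s' = map (mem s') [1..<regs s' rC + 1]" for s'
  let ?body = "Cond (Less (Const 0) (Get MK (Reg rV)))
      (Seq (Assign rC (Add (Reg rC) (Const 1))) (Store (Reg rC) (Reg rV))) Skip"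
  let ?s = "rset s rC 0"
  define I where "I v s' \<longleftrightarrow> arr L s' MK = arr L s MK \<and> regs s' rC \<le> v \<and> distinct (out s') \<and>
      set (out s') = mk s \<inter> {..<v}" for v s'
  \<comment> \<open>The output overwrites the input, so the frame is taken with \<open>L = 0\<close> and protects registers only.\<close>
  have *: "wp (For rV rN ?body) ?s (\<lambda>t s'. t \<le> n * (150 + 8) + 6 \<and> same 0 {rV, rC} UNIV ?s s' \<and> I n s')"
  proof (rule wp_For_const)
    fix v s1
    assume v: "v < n" and s1: "same 0 {rV, rC} UNIV ?s s1" "regs s1 rV = v" "I v s1"
    have L: "regs s1 rL = L" using s s1 by (simp add: same_regs ctx_regs)
    have MK1: "arr L s1 MK v = arr L s MK v" using s1 by (simp add: I_def)
    show "wp ?body s1 (\<lambda>t s2. t \<le> 150 \<and> same 0 {rV, rC} UNIV s1 s2 \<and> regs s2 rV = v \<and>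
        I (Suc v) (rset s2 rV (Suc v)))"
    proof (cases "v \<in> mk s")
      case False
      then have "mk s \<inter> {..<Suc v} = mk s \<inter> {..<v}" by (auto simp: less_Suc_eq)
      then show ?thesis
        using False s1 L MK1 by (simp add: mk_def I_def out_def)
    next
      case True
      define c where "c = Suc (regs s1 rC)"
      let ?s2 = "State (regs (rset s1 rC c)) ((mem s1)(c := v))"
      \<comment> \<open>At most \<open>n\<close> output elements are written and the input is longer
        than that, so the array \<open>MK\<close> behind it stays intact.\<close>
      have "c < L" using L_ge v s1 by (simp add: c_def I_def)
      then have "arr L ?s2 MK = arr L s MK"
        using s1 by (auto simp: I_def arr_def fun_eq_iff)
      moreover have o: "out ?s2 = out s1 @ [v]"
        by (simp add: out_def c_def)
      moreover have "mk s \<inter> {..<Suc v} = insert v (mk s \<inter> {..<v})"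
        using True by (auto simp: less_Suc_eq)
      ultimately have "I (Suc v) ?s2"
        using s1 by (auto simp: I_def c_def)
      then have "I (Suc v) (rset ?s2 rV (Suc v))"
        by (simp add: I_def out_def)
      moreover have "same 0 {rV, rC} UNIV s1 ?s2"
        by (simp add: same_def)
      ultimately show ?thesis
        using True s1 L MK1 by (simp add: mk_def wp_Store c_def)
    qed
  qed (use s in \<open>auto simp: ctx_regs I_def out_def\<close>)
  show ?thesis
    unfolding Output_def wp_Seq wp_Assign aval.simps
  proof (rule wp_mono[OF *], goal_cases)
    case (1 t s1)
    let ?s2 = "State (regs s1) ((mem s1)(0 := regs s1 rC))"
    have "output_list ?s2 = out s1"
      by (simp add: output_list_def out_def)
    moreover have "mk s \<inter> {..<n} = mk s" using s by auto
    ultimately show ?case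
      using 1 by (simp add: wp_Store I_def)
  qed
qed

section \<open>Listing the cover\<close>

lemma wp_Enum:
  assumes s: "ctx s" "regs s rTop = p"
  shows "wp Enum s (\<lambda>t s'. t \<le> 500 * (n + 1) \<and> same L {rV, rK} {INC, CL} s s' \<and>
    arr L s' CL ` {..<regs s' rK} = bm s p \<and> inj_on (arr L s' CL) {..<regs s' rK} \<and>
    (\<forall>v<n. arr L s' INC v = arr L s STK (p + v)))"
proof -
  let ?body = "Seq (Put INC (Reg rV) (Get STK (Add (Reg rTop) (Reg rV))))
      (Cond (Less (Const 0) (Get STK (Add (Reg rTop) (Reg rV))))
        (Seq (Put CL (Reg rK) (Reg rV)) (Assign rK (Add (Reg rK) (Const 1)))) Skip)"
  let ?s = "rset s rK 0"
  define I where "I v s' \<longleftrightarrow> arr L s' CL ` {..<regs s' rK} = bm s p \<inter> {..<v} \<and>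
    inj_on (arr L s' CL) {..<regs s' rK} \<and> (\<forall>u<v. arr L s' INC u = arr L s STK (p + u))" for v s'
  have *: "wp (For rV rN ?body) ?s (\<lambda>t s'. t \<le> n * (400 + 8) + 6 \<and> same L {rV, rK} {INC, CL} ?s s' \<and> I n s')"
  proof (rule wp_For_const)
    fix v s1
    assume v: "v < n" and s1: "same L {rV, rK} {INC, CL} ?s s1" "regs s1 rV = v" "I v s1"
    have f1: "regs s1 rL = L" "regs s1 rTop = p" "arr L s1 STK = arr L s STK"
      using s s1 by (simp_all add: same_regs ctx_regs same_arr)
    let ?s2 = "aset L s1 INC v (arr L s STK (p + v))"
    show "wp ?body s1 (\<lambda>t s2. t \<le> 400 \<and> same L {rV, rK} {INC, CL} s1 s2 \<and> regs s2 rV = v \<and>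
        I (Suc v) (rset s2 rV (Suc v)))"
    proof (cases "v \<in> bm s p")
      case False
      then have "bm s p \<inter> {..<Suc v} = bm s p \<inter> {..<v}" by (auto simp: less_Suc_eq)
      moreover have "arr L s STK (p + v) = 0" using False v by (simp add: bm_def)
      moreover have "arr L ?s2 CL = arr L s1 CL" by (simp add: fun_eq_iff)
      ultimately show ?thesis
        using s1 f1 by (simp add: wp_Put I_def less_Suc_eq)
    next
      case True
      let ?k = "regs s1 rK"
      let ?s3 = "aset L ?s2 CL ?k v"
      have CL3: "arr L ?s3 CL = (arr L s1 CL)(?k := v)" by (simp add: fun_eq_iff)
      have "bm s p \<inter> {..<Suc v} = insert v (bm s p \<inter> {..<v})"
        using True by (auto simp: less_Suc_eq)
      moreover have "((arr L s1 CL)(?k := v)) ` {..<Suc ?k} = insert v (arr L s1 CL ` {..<?k})"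
        by (auto simp: lessThan_Suc)
      moreover have "inj_on ((arr L s1 CL)(?k := v)) {..<Suc ?k}"
      proof -
        have "v \<notin> arr L s1 CL ` {..<?k}" "inj_on (arr L s1 CL) {..<?k}"
          using s1(3) by (simp_all add: I_def)
        then show ?thesis
          by (auto simp: lessThan_Suc inj_on_def)
      qed
      ultimately have "I (Suc v) (rset (rset ?s3 rK (Suc ?k)) rV (Suc v))"
        using s1 by (simp add: I_def CL3 less_Suc_eq)
      moreover have "arr L s STK (p + v) \<noteq> 0" using True by (simp add: bm_def)
      ultimately show ?thesis
        using s1 f1 by (simp add: wp_Put)
    qed
  qed (use s in \<open>auto simp: ctx_regs I_def\<close>)
  have "bm s p \<inter> {..<n} = bm s p" by (auto simp: bm_def)
  then show ?thesis
    unfolding Enum_def wp_Seq wp_Assign aval.simps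
    by (intro wp_mono[OF *]) (simp add: I_def)
qed

lemma wp_Pow2:
  "wp Pow2 s (\<lambda>t s'. t \<le> 20 * (regs s rK + 1) \<and> same L {rI, rP} {} s s' \<and> regs s' rP = 2 ^ regs s rK)"
proof -
  have *: "wp (For rI rK (Assign rP (Add (Reg rP) (Reg rP)))) (rset s rP 1)
    (\<lambda>t s'. t \<le> regs s rK * (4 + 8) + 6 \<and> same L {rI, rP} {} (rset s rP 1) s' \<and> regs s' rP = 2 ^ regs s rK)"
    by (rule wp_For_const[where I = "\<lambda>i s'. regs s' rP = 2 ^ i"]) auto
  show ?thesis
    unfolding Pow2_def wp_Seq wp_Assign aval.simps
    by (rule wp_mono[OF *]) simp
qed

end

context covered
begin

section \<open>Correctness of the tabulated solution\<close>

lemma NI_outside: "v < n \<Longrightarrow> v \<notin> C \<Longrightarrow> NI v = {i. i < k \<and> cl i \<in> nb v}"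
  using cl_image by (auto simp: NI_def)

lemma nb_outside: "v < n \<Longrightarrow> v \<notin> C \<Longrightarrow> u \<in> nb v \<Longrightarrow> \<exists>i<k. u = cl i"
  using cover_C cl_image by (force simp: cover_iff)

lemma selection_dominates:
  assumes A: "A \<subseteq> {..<k}" and H: "H \<subseteq> {..<n}" "left n A \<subseteq> (\<Union>h\<in>H. NI h)"
  shows "dominating_set {0..<n} E (cl ` A \<union> forced n A \<union> H)" (is "dominating_set _ _ ?M")
  unfolding dominating_set_def
proof (intro conjI ballI)
  show "?M \<subseteq> {0..<n}" using A H cl_less by (auto simp: forced_def)
next
  fix v assume v: "v \<in> {0..<n} - ?M"
  have "\<exists>u\<in>?M. u \<in> nb v"
  proof (cases "v \<in> C")
    case False
    then have "NI v \<inter> A \<noteq> {}" using v by (auto simp: forced_def)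
    then show ?thesis using False v NI_outside[of v] by auto
  next
    case True
    then obtain i where i: "i < k" "v = cl i" using cl_image by auto
    have hit: ?thesis if "x \<in> ?M" "i \<in> NI x" for x
    proof -
      have "v \<in> nb x" using that v i by (auto simp: NI_def)
      then show ?thesis using that(1) nb_sym by blast
    qed
    show ?thesis
    proof (cases "i \<in> left n A")
      case True
      then obtain h where "h \<in> H" "i \<in> NI h" using H by auto
      then show ?thesis using hit by blast
    next
      case False
      then consider j where "j \<in> A" "i \<in> NI (cl j)" | u where "u \<in> forced n A" "i \<in> NI u"
        using i by (auto simp: left_def)
      then show ?thesis
        by cases (use hit in blast)+
    qed
  qed
  then show "\<exists>u\<in>?M. {u, v} \<in> E" by (simp add: nb_def)
qed

text \<open>The set \<open>U\<close> contains three disjoint parts: its trace on \<open>C\<close>,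
  all forced vertices, since only the trace could dominate them from outside, and its unforced
  vertices outside \<open>C\<close>. The first two are paid by \<open>COST\<close>; the third covers
  the mask left, so \<open>opt\<close> bounds the table entry by its weight.\<close>

lemma val_le_dominating:
  assumes U: "dominating_set {0..<n} E U" and s: "opt n s" "\<forall>X<2 ^ k. row n s X"
  shows "\<exists>X<2 ^ k. val s X \<le> sum w U"
proof -
  have dom: "\<exists>u\<in>U. u \<in> nb v" if "v < n" "v \<notin> U" for v
    using U that by (auto simp: dominating_set_def nb_def)
  have Un: "U \<subseteq> {0..<n}" using U by (simp add: dominating_set_def)
  then have finU: "finite U" using finite_subset by blast
  define A where "A = {i. i < k \<and> cl i \<in> U}"
  have Ak: "A \<subseteq> {..<k}" by (auto simp: A_def)
  then have finA: "finite A" using finite_subset by blast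
  \<comment> \<open>A neighbour in the trace means that the vertex is not forced. Thus
    \<open>U1\<close> is disjoint from the forced set and the weights add up.\<close>
  define U1 where "U1 = {v\<in>U. v \<notin> C \<and> NI v \<inter> A \<noteq> {}}"
  have forcedU: "forced n A \<subseteq> U"
  proof
    fix v assume v: "v \<in> forced n A"
    show "v \<in> U"
    proof (rule ccontr)
      assume "v \<notin> U"
      then obtain u where u: "u \<in> U" "u \<in> nb v" using dom v by (auto simp: forced_def)
      then obtain i where "i < k" "u = cl i" using nb_outside[of v u] v by (auto simp: forced_def)
      then have "i \<in> NI v \<inter> A" using u by (auto simp: NI_def A_def)
      then show False using v by (auto simp: forced_def)
    qed
  qed
  have "left n A \<subseteq> (\<Union>u\<in>U1. NI u)"
  proof
    fix i assume i: "i \<in> left n A"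
    then have ik: "i < k" by (simp add: left_def)
    have "i \<notin> A" using i ik by (auto simp: left_def NI_def)
    then obtain u where u: "u \<in> U" "u \<in> nb (cl i)"
      using dom[of "cl i"] ik cl_less by (auto simp: A_def)
    then have iu: "i \<in> NI u" using ik by (auto simp: NI_def nb_sym[of u])
    have "u \<notin> C"
    proof
      assume "u \<in> C"
      then obtain j where "j < k" "u = cl j" using cl_image by auto
      then have "j \<in> A" "i \<in> NI (cl j)" using u iu by (auto simp: A_def)
      then show False using i by (auto simp: left_def)
    qed
    moreover have "NI u \<inter> A \<noteq> {}"
    proof
      assume "NI u \<inter> A = {}"
      then have "u \<in> forced n A" using \<open>u \<notin> C\<close> u Un by (auto simp: forced_def)
      then show False using i iu by (auto simp: left_def)
    qed
    ultimately show "i \<in> (\<Union>u\<in>U1. NI u)" using u iu by (auto simp: U1_def)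
  qed
  then have cov: "left n A - (\<Union>u\<in>U1. NI u) = {}" by blast
  define X where "X = set_encode A"
  have X: "X < 2 ^ k" "set_decode X = A"
    using Ak finA by (simp_all add: X_def set_encode_less)
  have Y: "set_encode (left n A) < 2 ^ k" by (rule set_encode_less[OF left_subset])
  have "U1 \<subseteq> {u. u < n \<and> u \<notin> C}" using Un by (auto simp: U1_def)
  then have "arr L s FA (set_encode (left n A)) \<le> sum w U1 + wsum (left n A - (\<Union>u\<in>U1. NI u))"
    using s(1)[unfolded opt_def, rule_format, OF Y, of U1] by simp
  then have F: "arr L s FA (set_encode (left n A)) \<le> sum w U1"
    by (simp add: cov wsum_def)
  have "wsum A = sum w (cl ` A)"
    unfolding wsum_def using inj_on_subset[OF cl_inj Ak] by (simp add: sum.reindex)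
  then have "val s X \<le> sum w (cl ` A) + sum w (forced n A) + sum w U1"
    using s(2) X F by (simp add: val_def row_def)
  also have "\<dots> = sum w (cl ` A \<union> forced n A) + sum w U1"
    using finA Ak cl_image by (subst sum.union_disjoint) (auto simp: forced_def)
  also have "\<dots> = sum w (cl ` A \<union> forced n A \<union> U1)"
    using finA finU Ak cl_image by (subst (2) sum.union_disjoint) (auto simp: forced_def U1_def)
  also have "\<dots> \<le> sum w U"
    using forcedU finU by (intro sum_mono2) (auto simp: A_def U1_def)
  finally show ?thesis using X(1) by blast
qed

section \<open>Marking an optimal solution\<close>

text \<open>The links strictly decrease the mask, so the mask itself is the loop variant and fewer
  than \<open>2 ^ k\<close> links are followed. The predicate \<open>P\<close> relates the marks
  made to the mask still ahead, so that the bit chain and the cover chain share one proof.\<close>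

lemma wp_Chain:
  assumes s: "regs s rL = L" "regs s rX < 2 ^ k" and a: "a < 16" "h < 16" "a \<noteq> MK" "h \<noteq> MK"
    and dec: "\<And>X. 0 < X \<Longrightarrow> X < 2 ^ k \<Longrightarrow> arr L s h X < X"
    and init: "P (mk s) (regs s rX)"
    and step: "\<And>M X. 0 < X \<Longrightarrow> X < 2 ^ k \<Longrightarrow> P M X \<Longrightarrow> P (insert (arr L s a X) M) (arr L s h X)"
  shows "wp (Chain a h) s (\<lambda>t s'. t \<le> 800 * 2 ^ k \<and> same L {rX} {MK} s s' \<and> P (mk s') 0)"
proof -
  let ?b = "Less (Const 0) (Reg rX)"
  let ?c = "Seq (Put MK (Get a (Reg rX)) (Const 1)) (Assign rX (Get h (Reg rX)))"
  have "wp (While ?b ?c) s (\<lambda>t s'. t \<le> 700 * regs s rX + bcost ?b + 1 \<and>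
    (same L {rX} {MK} s s' \<and> regs s' rX < 2 ^ k \<and> P (mk s') (regs s' rX)) \<and> \<not> bval ?b s')"
  proof (rule wp_While)
    fix s1
    assume s1: "same L {rX} {MK} s s1 \<and> regs s1 rX < 2 ^ k \<and> P (mk s1) (regs s1 rX)" and b: "bval ?b s1"
    let ?X = "regs s1 rX"
    have fr: "same L {rX} {MK} s s1" using s1 by simp
    have f1: "regs s1 rL = L" "arr L s1 a = arr L s a" "arr L s1 h = arr L s h"
      using same_regs[OF fr, of rL] same_arr[OF fr] s(1) a by simp_all
    have lt: "arr L s h ?X < ?X" using dec s1 b by simp
    then have "700 * arr L s h ?X + 700 \<le> 700 * ?X" by simp
    moreover have "P (insert (arr L s a ?X) (mk s1)) (arr L s h ?X)"
      using step s1 b by simp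
    ultimately show "wp ?c s1 (\<lambda>t s'. (same L {rX} {MK} s s' \<and> regs s' rX < 2 ^ k \<and> P (mk s') (regs s' rX)) \<and>
      700 * regs s' rX + t + bcost ?b + 1 \<le> 700 * regs s1 rX)"
      using f1 s1 lt a by (simp add: wp_Put)
  qed (use s init in auto)
  then show ?thesis
    unfolding Chain_def
  proof (rule wp_mono, goal_cases)
    case (1 t s')
    then have "t \<le> 700 * regs s rX + 4" by simp
    then have "t \<le> 800 * 2 ^ k" using s(2) by linarith
    then show ?case using 1 by auto
  qed
qed

lemma wp_MarkForced:
  assumes s: "dctx s" and A: "A \<subseteq> {..<k}" and mk: "mk s = cl ` A"
  shows "wp MarkForced s (\<lambda>t s'. t \<le> n * (500 * 2 ^ k) + 6 \<and>
    same L {rV, rC, rJ, rD, rO} {MK} s s' \<and> mk s' = cl ` A \<union> forced n A)"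
proof -
  let ?R = "{rV, rC, rJ, rD, rO}"
  let ?count = "Nbrs rV (Assign rC (Add (Reg rC) (Get MK Nbr)))"
  let ?body = "Cond (Less (Const 0) (Get INC (Reg rV))) Skip
    (Seq (Assign rC (Const 0)) (Seq ?count
    (Cond (Less (Const 0) (Reg rC)) Skip (Put MK (Reg rV) (Const 1)))))"
  have *: "wp MarkForced s (\<lambda>t s'. t \<le> n * (400 * 2 ^ k + 8) + 6 \<and> same L ?R {MK} s s' \<and>
    mk s' = cl ` A \<union> forced n A)"
    unfolding MarkForced_def
  proof (rule wp_For_const[where I = "\<lambda>v s'. mk s' = cl ` A \<union> forced v A"])
    fix v s1
    assume v: "v < n" and s1: "same L ?R {MK} s s1" "regs s1 rV = v" "mk s1 = cl ` A \<union> forced v A"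
    have d1: "dctx s1" by (rule dctx_same[OF s s1(1)]) auto
    have INC: "arr L s1 INC v = (if v \<in> C then 1 else 0)" using d1 v by (simp add: dctx_def)
    have L: "regs s1 rL = L" by (rule dctx_regs(1)[OF d1])
    show "wp ?body s1 (\<lambda>t s2. t \<le> 400 * 2 ^ k \<and> same L ?R {MK} s1 s2 \<and> regs s2 rV = v \<and>
      mk (rset s2 rV (Suc v)) = cl ` A \<union> forced (Suc v) A)"
    proof (cases "v \<in> C")
      case True
      have "43 \<le> 400 * (2 :: nat) ^ k" using less_exp[of k] by linarith
      then show ?thesis using True INC s1 L by (simp add: forced_Suc)
    next
      case False
      let ?s = "rset s1 rC 0"
      have count: "wp ?count ?s (\<lambda>t s'. t \<le> deg v * (150 + 8) + 60 \<and> same L {rC, rJ, rD, rO} {} ?s s' \<and>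
        (regs s' rC = 0 \<longleftrightarrow> nb v \<inter> mk s1 = {}))"
      proof (rule wp_Nbrs[where R = "{rC, rJ}" and I = "\<lambda>X s'. regs s' rC = 0 \<longleftrightarrow> X \<inter> mk s1 = {}"])
        fix X u s2
        assume s2: "same L {rC, rJ, rD, rO} {} ?s s2" "ctx s2" "mem s2 (regs s2 rO + regs s2 rJ) = u"
          "regs s2 rC = 0 \<longleftrightarrow> X \<inter> mk s1 = {}"
        have "arr L s2 MK = arr L s1 MK" using s2 by (simp add: same_arr)
        then show "wp (Assign rC (Add (Reg rC) (Get MK Nbr))) s2
          (\<lambda>t s3. t \<le> 150 \<and> same L {rC, rJ} {} s2 s3 \<and> regs s3 rJ = regs s2 rJ \<and>
            (\<forall>j. regs (rset s3 rJ j) rC = 0 \<longleftrightarrow> insert u X \<inter> mk s1 = {}))"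
          using s2 by (simp add: ctx_regs) (auto simp: mk_def)
      qed (use d1 v s1 in \<open>auto simp: dctx_ctx same_regs\<close>)
      \<comment> \<open>Forced vertices marked earlier lie outside \<open>C\<close>, and
        \<open>v\<close> has no neighbours there, so the test sees only the trace.\<close>
      have "nb v \<inter> mk s1 = {} \<longleftrightarrow> NI v \<inter> A = {}"
      proof -
        have "nb v \<subseteq> C" using cover_C False v by (simp add: cover_iff)
        then have "nb v \<inter> mk s1 = nb v \<inter> cl ` A" using s1(3) by (auto simp: forced_def)
        then show ?thesis using A NI_outside[OF v False] by auto
      qed
      then have mk2: "cl ` A \<union> forced (Suc v) A = (if nb v \<inter> mk s1 = {} then insert v (mk s1) else mk s1)"
        using False s1(3) by (simp add: forced_Suc)
      have b: "\<not> bval (Less (Const 0) (Get INC (Reg rV))) s1"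
        using INC False s1 L by simp
      show ?thesis
        unfolding wp_Cond if_not_P[OF b] wp_Seq wp_Assign aval.simps(1)
      proof (rule wp_mono[OF count], goal_cases)
        case (1 t s2)
        then have fr: "same L {rC, rJ, rD, rO} {} ?s s2" by simp
        have "same L ?R {MK} ?s s2" by (rule same_mono[OF fr]) auto
        moreover have "regs s2 rL = L" "regs s2 rV = v" "arr L s2 MK = arr L s1 MK"
          using fr L s1 by (simp_all add: same_regs same_arr)
        moreover from this have "mk s2 = mk s1" by (simp add: mk_def)
        moreover have "t + 200 \<le> 400 * 2 ^ k"
        proof -
          have "t \<le> 158 * deg v + 60" using 1 by (simp add: mult.commute)
          then show ?thesis using deg_le_k[OF v False] less_exp[of k] by linarith
        qed
        ultimately show ?case
          using 1 mk2 by (cases "nb v \<inter> mk s1 = {}") (simp_all add: wp_Put)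
      qed
    qed
  qed (use s mk in \<open>auto simp: dctx_regs\<close>)
  have "400 * 2 ^ k + 8 \<le> 500 * (2 :: nat) ^ k"
    using less_exp[of k] by linarith
  then have tm: "n * (400 * 2 ^ k + 8) \<le> n * (500 * 2 ^ k)"
    by (rule mult_le_mono2)
  show ?thesis
  proof (rule wp_mono[OF *], goal_cases)
    case (1 t s')
    then have "t \<le> n * (400 * 2 ^ k + 8) + 6" by (rule conjunct1)
    then have "t \<le> n * (500 * 2 ^ k) + 6" using tm by linarith
    then show ?case using 1 by simp
  qed
qed

lemma wp_Mark:
  assumes s: "dctx s" and X: "regs s rBX = X" "X < 2 ^ k" and "mk s = {}"
    and tabs: "\<forall>X<2 ^ k. split_top s X" "sound s" "row n s X"
  shows "wp Mark s (\<lambda>t s'. t \<le> n * (500 * 2 ^ k) + 2000 * 2 ^ k \<and> ctx s' \<and>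
    (\<exists>H\<subseteq>{..<n}. mk s' = cl ` set_decode X \<union> forced n (set_decode X) \<union> H \<and>
      left n (set_decode X) \<subseteq> (\<Union>h\<in>H. NI h) \<and> sum w H \<le> arr L s FA (arr L s REM X)))"
proof -
  define A where "A = set_decode X"
  have A: "A \<subseteq> {..<k}" unfolding A_def by (rule set_decode_less[OF X(2)])
  have L: "regs s rL = L" by (rule dctx_regs(1)[OF s])
  let ?s = "rset s rX X"
  let ?R = "{rX, rV, rC, rJ, rD, rO}"
  have chain1: "wp (Chain TOP LOW) ?s (\<lambda>t s'. t \<le> 800 * 2 ^ k \<and> same L {rX} {MK} ?s s' \<and>
    mk s' \<union> cl ` set_decode 0 = cl ` A)"
  proof (rule wp_Chain[where P = "\<lambda>M Y. M \<union> cl ` set_decode Y = cl ` A"])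
    fix M and Y :: nat assume "0 < Y" "Y < 2 ^ k" and M: "M \<union> cl ` set_decode Y = cl ` A"
    then obtain j where "arr L s TOP Y = cl j" "set_decode Y = insert j (set_decode (arr L s LOW Y))"
      using tabs(1) by (auto simp: split_top_def)
    with M show "insert (arr L ?s TOP Y) M \<union> cl ` set_decode (arr L ?s LOW Y) = cl ` A"
      by auto
  next
    fix Y :: nat assume "0 < Y" "Y < 2 ^ k"
    then show "arr L ?s LOW Y < Y" using tabs(1) by (auto simp: split_top_def)
  qed (use L X assms(4) in \<open>auto simp: A_def\<close>)
  define B where "B = cl ` A \<union> forced n A"
  define f0 where "f0 = arr L s FA (arr L s REM X)"
  \<comment> \<open>The set \<open>H\<close> collects the vertices bought so far: they cover
    everything left except for the mask \<open>Y\<close> ahead, and their weight plus the price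
    stored for \<open>Y\<close> stays within the original price \<open>f0\<close>.\<close>
  define P where "P M Y \<longleftrightarrow> (\<exists>H\<subseteq>{..<n}. M = B \<union> H \<and> left n A \<subseteq> set_decode Y \<union> (\<Union>h\<in>H. NI h) \<and>
      sum w H + arr L s FA Y \<le> f0)" for M Y
  have chain2: "wp (Chain LAST NXT) s3 (\<lambda>t s'. t \<le> 800 * 2 ^ k \<and> same L {rX} {MK} s3 s' \<and> P (mk s') 0)"
    if s3: "regs s3 rL = L" "regs s3 rX = arr L s REM X" "mk s3 = B" "arr L s3 LAST = arr L s LAST"
      "arr L s3 NXT = arr L s NXT" for s3
  proof (rule wp_Chain)
    have R: "arr L s REM X = set_encode (left n A)" using tabs(3) by (simp add: row_def A_def)
    then show "regs s3 rX < 2 ^ k" using s3 set_encode_less[OF left_subset] by simp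
    show "P (mk s3) (regs s3 rX)"
      unfolding P_def using s3 R by (intro exI[of _ "{}"]) (simp add: f0_def)
    show "arr L s3 NXT Y < Y" if "0 < Y" "Y < 2 ^ k" for Y
      using tabs(2) that s3 by (simp add: sound_def)
    fix M and Y :: nat assume Y: "0 < Y" "Y < 2 ^ k" and "P M Y"
    then obtain H where H: "H \<subseteq> {..<n}" "M = B \<union> H" "left n A \<subseteq> set_decode Y \<union> (\<Union>h\<in>H. NI h)"
      "sum w H + arr L s FA Y \<le> f0" by (auto simp: P_def)
    let ?h = "arr L s LAST Y" and ?Y = "arr L s NXT Y"
    have snd: "?h < n" "set_decode Y \<subseteq> set_decode ?Y \<union> NI ?h" "w ?h + arr L s FA ?Y \<le> arr L s FA Y"
      using tabs(2) Y by (auto simp: sound_def)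
    have "finite H" using H(1) finite_subset by blast
    then have "sum w (insert ?h H) \<le> w ?h + sum w H"
      by (cases "?h \<in> H") (auto simp: insert_absorb)
    then have "sum w (insert ?h H) + arr L s FA ?Y \<le> f0" using H(4) snd(3) by linarith
    then have "P (insert ?h M) ?Y"
      unfolding P_def using H snd by (intro exI[of _ "insert ?h H"]) auto
    then show "P (insert (arr L s3 LAST Y) M) (arr L s3 NXT Y)" using s3 by simp
  qed (use s3 in auto)
  show ?thesis
    unfolding Mark_def wp_Seq wp_Assign aval.simps(2) X(1)
  proof (rule wp_mono[OF chain1], goal_cases)
    case (1 t1 s1)
    then have fr1: "same L {rX} {MK} ?s s1" and mk1: "mk s1 = cl ` A" by auto
    have "same L ?R {MK} ?s s1" by (rule same_mono[OF fr1]) auto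
    then have a1: "same L ?R {MK} s s1" by simp
    have d1: "dctx s1" by (rule dctx_same[OF s a1]) auto
    show ?case
    proof (rule wp_mono[OF wp_MarkForced[OF d1 A mk1]], goal_cases)
      case (1 t2 s2)
      then have fr2: "same L {rV, rC, rJ, rD, rO} {MK} s1 s2" by simp
      have "same L ?R {MK} s1 s2" by (rule same_mono[OF fr2]) auto
      with a1 have a2: "same L ?R {MK} s s2" by (rule same_trans)
      have d2: "dctx s2" by (rule dctx_same[OF s a2]) auto
      have L2: "regs s2 rL = L" by (rule dctx_regs(1)[OF d2])
      have v: "aval (Get REM (Reg rBX)) s2 = arr L s REM X"
        using L2 a2 X by (simp add: same_regs same_arr)
      have mk2: "mk s2 = B" using 1 by (simp add: B_def)
      have a2': "arr L s2 LAST = arr L s LAST" "arr L s2 NXT = arr L s NXT"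
        using same_arr[OF a2] by simp_all
      let ?s2 = "rset s2 rX (arr L s REM X)"
      show ?case
        unfolding v
      proof (rule wp_mono[OF chain2], goal_cases)
        case (6 t3 s3)
        then have fr3: "same L {rX} {MK} ?s2 s3" by simp
        have "ctx ?s2" using d2 by (simp add: dctx_ctx)
        then have "ctx s3" by (rule ctx_same[OF _ fr3]) auto
        moreover have "\<exists>H\<subseteq>{..<n}. mk s3 = B \<union> H \<and> left n A \<subseteq> (\<Union>h\<in>H. NI h) \<and> sum w H \<le> f0"
        proof -
          obtain H where "H \<subseteq> {..<n}" "mk s3 = B \<union> H" "left n A \<subseteq> set_decode 0 \<union> (\<Union>h\<in>H. NI h)"
            "sum w H + arr L s FA 0 \<le> f0"
            using 6 unfolding P_def by blast
          then show ?thesis by (intro exI[of _ H]) simp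
        qed
        moreover have "100 + t1 + t2 + t3 \<le> n * (500 * 2 ^ k) + 2000 * 2 ^ k"
        proof -
          have "t1 \<le> 800 * 2 ^ k" "t2 \<le> n * (500 * 2 ^ k) + 6" "t3 \<le> 800 * 2 ^ k"
            using \<open>t1 \<le> _ \<and> _\<close> \<open>t2 \<le> _ \<and> _\<close> 6 by blast+
          then show ?thesis using less_exp[of k] by linarith
        qed
        ultimately show ?case by (simp add: A_def B_def f0_def)
      qed (use L2 mk2 a2' in simp_all)
    qed
  qed
qed

section \<open>The solver for a given cover\<close>

lemma k_eq: "k = card C"
  using card_image[OF cl_inj] cl_image by simp

lemma k_le_n: "k \<le> n"
  using card_mono[of "{0..<n}" C] cover_C by (simp add: k_eq cover_iff)

lemma wp_Solve:
  assumes s: "dctx s" and "mk s = {}"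
  shows "wp Solve s (\<lambda>t s'. (0 < n \<longrightarrow> t \<le> 30000 * (2 ^ k * n)) \<and> distinct (output_list s') \<and>
    min_weight_dominating_set {0..<n} E w (set (output_list s')))"
  unfolding Solve_def wp_Seq
proof (rule wp_mono[OF wp_Phase1[OF s]], goal_cases)
  case (1 t1 s1)
  then have fr1: "same L ({rI2, rU, rQ2, rX} \<union> RT) ({FL, TB} \<union> ROWS) s s1"
    and rows: "\<forall>X<2 ^ k. row0 s1 X" and t1: "t1 \<le> k * (7000 * 2 ^ k + 208 * n) + 500" by blast+
  have d1: "dctx s1" by (rule dctx_same[OF s fr1]) auto
  have opt1: "opt 0 s1" using rows by (simp add: opt_def row0_def)
  have row1: "\<forall>X<2 ^ k. row 0 s1 X" using rows by (simp add: row0_def)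
  show ?case
  proof (rule wp_mono[OF wp_Phase2[OF d1 opt1 row0_sound[OF rows] row1]], goal_cases)
    case (1 t2 s2)
    then have fr2: "same L ({rV, rU, rX} \<union> RT) ({FL, TB} \<union> TABS) s1 s2"
      and o2: "opt n s2" "sound s2" "\<forall>X<2 ^ k. row n s2 X" and t2: "t2 \<le> n * (8000 * 2 ^ k) + 6" by blast+
    have d2: "dctx s2" by (rule dctx_same[OF d1 fr2]) auto
    show ?case
    proof (rule wp_mono[OF wp_Phase3[OF d2]], goal_cases)
      case (1 t3 s3)
      define X where "X = regs s3 rBX"
      from 1 have fr3: "same L {rX, rZ, rBV, rBX} {} s2 s3" and X: "X < 2 ^ k"
        and best: "\<forall>Y<2 ^ k. val s2 X \<le> val s2 Y" and t3: "t3 \<le> 2000 * 2 ^ k"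
        unfolding X_def by blast+
      have d3: "dctx s3" by (rule dctx_same[OF d2 fr3]) auto
      have a3: "arr L s3 j = arr L s2 j" if "j < 16" for j
        using that same_arr[OF fr3] by simp
      have a2: "arr L s2 j = arr L s1 j" if "j \<in> {TOP, LOW, MK}" for j
        using that same_arr[OF fr2] by auto
      have "arr L s1 MK = arr L s MK" using fr1 by (simp add: same_arr)
      then have mk3: "mk s3 = {}" using assms(2) a2 a3 by (simp add: mk_def)
      have split3: "\<forall>X<2 ^ k. split_top s3 X"
        using rows a2 a3 by (simp add: row0_def split_top_def)
      have snd3: "sound s3" and row3: "row n s3 X"
        using o2 X a3 by (simp_all add: sound_def row_def)
      let ?A = "set_decode X"
      have A: "?A \<subseteq> {..<k}" by (rule set_decode_less[OF X])
      show ?case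
      proof (rule wp_mono[OF wp_Mark[OF d3 X_def[symmetric] X mk3 split3 snd3 row3]], goal_cases)
        case (1 t4 s4)
        then obtain H where ctx4: "ctx s4" and H: "H \<subseteq> {..<n}"
          "mk s4 = cl ` ?A \<union> forced n ?A \<union> H" "left n ?A \<subseteq> (\<Union>h\<in>H. NI h)"
          "sum w H \<le> arr L s3 FA (arr L s3 REM X)" and t4: "t4 \<le> n * (500 * 2 ^ k) + 2000 * 2 ^ k"
          by blast
        have "finite H" using H(1) finite_subset by blast
        have dom: "dominating_set {0..<n} E (mk s4)"
          unfolding H(2) by (rule selection_dominates[OF A H(1,3)])
        then have mk4: "mk s4 \<subseteq> {..<n}" by (auto simp: dominating_set_def)
        \<comment> \<open>Only an inequality, because \<open>H\<close> may overlap the trace and the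
          forced vertices.\<close>
        have "sum w (mk s4) \<le> sum w (cl ` ?A) + sum w (forced n ?A) + sum w H"
        proof -
          have "sum w (mk s4) \<le> sum w (cl ` ?A \<union> forced n ?A) + sum w H"
            unfolding H(2) using \<open>finite H\<close> by (subst sum_Un_nat) auto
          moreover have "sum w (cl ` ?A \<union> forced n ?A) \<le> sum w (cl ` ?A) + sum w (forced n ?A)"
            by (subst sum_Un_nat) auto
          ultimately show ?thesis by linarith
        qed
        also have "sum w (cl ` ?A) = wsum ?A"
          unfolding wsum_def using inj_on_subset[OF cl_inj A] by (simp add: sum.reindex)
        finally have "sum w (mk s4) \<le> val s2 X"
          using H(4) row3 a3 by (simp add: val_def row_def)
        then have "min_weight_dominating_set {0..<n} E w (mk s4)"
          unfolding min_weight_dominating_set_def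
          using dom best val_le_dominating[OF _ o2(1,3)] by (meson order_trans)
        moreover have "t1 + (t2 + (t3 + (t4 + 200 * (n + 1)))) \<le> 30000 * (2 ^ k * n)" if "0 < n"
        proof -
          define N where "N = 2 ^ k * n"
          have pn: "2 ^ k \<le> N" "n \<le> N" "1 \<le> N" using that by (simp_all add: N_def)
          \<comment> \<open>The k neighbourhood tables of \<open>Phase1\<close> have
            \<open>2 ^ k\<close> entries each, and a cover has at most n vertices.\<close>
          have "k * 2 ^ k \<le> N" using k_le_n by (simp add: N_def)
          moreover have "k * n \<le> N" using less_exp[of k] by (simp add: N_def)
          moreover have "t1 \<le> 7000 * (k * 2 ^ k) + 208 * (k * n) + 500"
            using t1 by (simp add: algebra_simps)
          ultimately have "t1 \<le> 7208 * N + 500" by linarith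
          moreover have "t2 \<le> 8000 * N + 6"
            using t2 by (simp add: algebra_simps N_def)
          moreover have "t3 \<le> 2000 * N"
            using t3 pn(1) by linarith
          moreover have "t4 \<le> 2500 * N"
          proof -
            have "t4 \<le> 500 * N + 2000 * 2 ^ k" using t4 by (simp add: algebra_simps N_def)
            then show ?thesis using pn(1) by linarith
          qed
          ultimately show ?thesis using pn(2,3) unfolding N_def[symmetric] by simp
        qed
        ultimately show ?case
          by (intro wp_mono[OF wp_Output[OF ctx4 mk4]]) (auto intro: order_trans[rotated])
      qed
    qed
  qed
qed

end

section \<open>The complete algorithm\<close>

context graph_input
begin

lemma wp_Prog:
  "wp Prog (initial_state (encode_input n w adj)) (\<lambda>t s. distinct (output_list s) \<and>
    min_weight_dominating_set {0..<n} E w (set (output_list s)) \<and> (n > 0 \<longrightarrow> t \<le> 500000 * (2 ^ vcn * n)))"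
  unfolding Prog_def wp_Seq
proof (rule wp_mono[OF wp_Init], goal_cases)
  case (1 t0 s0)
  then have ctx0: "ctx s0" and zero: "\<forall>i. arr L s0 MK i = 0" and t0: "t0 \<le> 200 * (n + 1)" by auto
  show ?case
  proof (rule wp_mono[OF wp_Search[OF ctx0]], goal_cases)
    case (1 t1 s1)
    define T where "T = 2100 * size_in * (1 + (\<Sum>b = 1..Suc vcn. pot b + 1))"
    from 1 have fr1: "same L SR {STK} s0 s1" and found: "found s1" and t1: "t1 \<le> T + 20"
      unfolding T_def by blast+
    define p where "p = regs s1 rTop"
    define C where "C = bm s1 p"
    have C: "cover C" "card C \<le> vcn" and bits: "\<forall>i<n. arr L s1 STK (p + i) \<le> 1"
      using found by (simp_all add: found_def p_def C_def)
    have ctx1: "ctx s1" by (rule ctx_same[OF ctx0 fr1]) auto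
    show ?case
    proof (rule wp_mono[OF wp_Enum[OF ctx1 p_def[symmetric]]], goal_cases)
      case (1 t2 s2)
      define k where "k = regs s2 rK"
      define cl where "cl = arr L s2 CL"
      from 1 have fr2: "same L {rV, rK} {INC, CL} s1 s2" and cl: "cl ` {..<k} = C" "inj_on cl {..<k}"
        and INC: "\<forall>v<n. arr L s2 INC v = arr L s1 STK (p + v)" and t2: "t2 \<le> 500 * (n + 1)"
        by (auto simp: k_def cl_def C_def)
      interpret covered n E w adj C cl k
        by unfold_locales (use C cl in auto)
      have ctx2: "ctx s2" by (rule ctx_same[OF ctx1 fr2]) auto
      show ?case
      proof (rule wp_mono[OF wp_Pow2[of s2]], goal_cases)
        case (1 t3 s3)
        then have fr3: "same L {rI, rP} {} s2 s3" and P: "regs s3 rP = 2 ^ k" and t3: "t3 \<le> 20 * (k + 1)"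
          by (auto simp: k_def)
        have ctx3: "ctx s3" by (rule ctx_same[OF ctx2 fr3]) auto
        have "arr L s3 INC v = (if v \<in> C then 1 else 0)" if "v < n" for v
          using that INC bits same_arr[OF fr3, of INC] by (auto simp: C_def bm_def le_Suc_eq)
        moreover have "regs s3 rK = k" "arr L s3 CL = cl"
          using same_regs[OF fr3, of rK] same_arr[OF fr3, of CL] by (simp_all add: k_def cl_def)
        ultimately have d3: "dctx s3"
          using ctx3 P by (simp add: dctx_def)
        have "arr L s3 MK = arr L s0 MK"
          using same_arr[OF fr1, of MK] same_arr[OF fr2, of MK] same_arr[OF fr3, of MK] by simp
        then have mk3: "mk s3 = {}" using zero by (simp add: mk_def)
        have "k \<le> vcn" using C(2) by (simp add: k_eq)
        show ?case
        proof (rule wp_mono[OF wp_Solve[OF d3 mk3]], goal_cases)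
          case (1 t4 s4)
          moreover have "t0 + (t1 + (t2 + (t3 + t4))) \<le> 500000 * (2 ^ vcn * n)" if "0 < n"
          proof -
            define N where "N = 2 ^ vcn * n"
            have "T \<le> 400000 * N" unfolding T_def N_def by (rule search_time[OF that])
            moreover have "n \<le> N" "1 \<le> N" using that by (simp_all add: N_def)
            moreover have "t4 \<le> 30000 * N"
            proof -
              have "2 ^ k * n \<le> N" using \<open>k \<le> vcn\<close> by (simp add: N_def)
              moreover have "t4 \<le> 30000 * (2 ^ k * n)" using 1 that by blast
              ultimately show ?thesis by linarith
            qed
            ultimately show ?thesis using t0 t1 t2 t3 k_le_n unfolding N_def[symmetric] by simp
          qed
          ultimately show ?case by blast
        qed
      qed
    qed
  qed
qed

end

theorem theorem19:
  "\<exists>(P :: com) (c :: nat). \<forall>(n :: nat) (E :: nat set set) (w :: nat \<Rightarrow> nat) (adj :: nat list list).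
     simple_graph {0..<n} E \<longrightarrow> adjacency_lists n E adj \<longrightarrow>
     (\<exists>t s. exec P (initial_state (encode_input n w adj)) t s \<and>
        distinct (output_list s) \<and>
        min_weight_dominating_set {0..<n} E w (set (output_list s)) \<and>
        (n > 0 \<longrightarrow> t \<le> c * (2 ^ vc {0..<n} E * n)))"
proof (rule exI[of _ Prog], rule exI[of _ 500000], intro allI impI)
  fix n :: nat and E :: "nat set set" and w :: "nat \<Rightarrow> nat" and adj :: "nat list list"
  assume "simple_graph {0..<n} E" and "adjacency_lists n E adj"
  then interpret graph_input n E w adj by unfold_locales
  show "\<exists>t s. exec Prog (initial_state (encode_input n w adj)) t s \<and>
        distinct (output_list s) \<and>
        min_weight_dominating_set {0..<n} E w (set (output_list s)) \<and>
        (n > 0 \<longrightarrow> t \<le> 500000 * (2 ^ vc {0..<n} E * n))"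
    using wp_Prog by (simp add: wp_def)
qed

end
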